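(* Let $\Gamma$ be a countable discrete group satisfying one of the following: (i) $\Gamma$ is torsion-free, has positive first $L^2$-Betti number, and every nonzero element of $\mathbb{Z}\Gamma$ acts without kernel (i.e. injectively) on $\ell^2(\Gamma)$; or (ii) $\Gamma=\Gamma_1\times\cdots\times\Gamma_n$ for some integer $n\ge 2$, where each $\Gamma_i$ is either a torsion-free non-amenable (word-)hyperbolic group or a group as in (i). Then $L(\Gamma)$ does not admit any Cartan subalgebra $\mathcal{A}$ with $\lambda(\Gamma)\subseteq \mathcal{N}_{L(\Gamma)}(\mathcal{A})$.
   Context: For a discrete group $\Gamma$, let $\lambda:\Gamma\to \mathcal{U}(\ell^2(\Gamma))$ be the left regular representation, $\lambda(s)\delta_t=\delta_{st}$, and let $L(\Gamma)=\overline{\mathrm{span}\{\lambda(s):s\in\Gamma\}}^{\,w.o.t.}\subseteq \mathbb{B}(\ell^2(\Gamma))$ be the group von Neumann algebra, with its canonical faithful normal trace. The first $L^2$-Betti number $\beta_1^{(2)}(\Gamma)$ is the (Lück/von Neumann) dimension over $L(\Gamma)$ of $H^1(\Gamma,\ell^2(\Gamma))$ (equivalently of $H_1(\Gamma,\ell^2(\Gamma))$). The group ring $\mathbb{Z}\Gamma$ acts on $\ell^2(\Gamma)$ by extending $\lambda$ linearly. For a tracial von Neumann algebra $\mathcal{M}$ with unitary group $\mathcal{U}(\mathcal{M})$ and a von Neumann subalgebra $\mathcal{A}\subset\mathcal{M}$, the normalizer is $\mathcal{N}_{\mathcal{M}}(\mathcal{A})=\{u\in\mathcal{U}(\mathcal{M}):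 u\mathcal{A}u^*=\mathcal{A}\}$. $\mathcal{A}$ is a Cartan subalgebra of $\mathcal{M}$ if (a) $\mathcal{A}$ is a maximal abelian $*$-subalgebra of $\mathcal{M}$, and (b) $\mathcal{N}_{\mathcal{M}}(\mathcal{A})$ generates $\mathcal{M}$ as a von Neumann algebra. *)

theory Defs
  imports
    "HOL-Analysis.Analysis"
    "HOL-Library.Function_Algebras"
    "HOL-Library.Poly_Mapping"
    "HOL-Algebra.Product_Groups"
begin

section \<open>The Hilbert space of square-summable functions\<close>

text \<open>
  The space over an index set \<open>A\<close> consists of the functions on the whole type that vanish off \<open>A\<close>,
  so that equality of vectors is equality of functions. Sums of vectors are pointwise
  (from \<^theory>\<open>HOL-Library.Function_Algebras\<close>).
\<close>

definition ell2 :: "'a set \<Rightarrow> ('a \<Rightarrow> complex) set" where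
  "ell2 A = {\<xi>. (\<forall>s. s \<notin> A \<longrightarrow> \<xi> s = 0) \<and> (\<lambda>s. (cmod (\<xi> s))\<^sup>2) summable_on A}"

definition ell2_inner :: "'a set \<Rightarrow> ('a \<Rightarrow> complex) \<Rightarrow> ('a \<Rightarrow> complex) \<Rightarrow> complex" where
  "ell2_inner A \<xi> \<eta> = (\<Sum>\<^sub>\<infinity>s\<in>A. \<xi> s * cnj (\<eta> s))"

definition ell2_norm :: "'a set \<Rightarrow> ('a \<Rightarrow> complex) \<Rightarrow> real" where
  "ell2_norm A \<xi> = sqrt (\<Sum>\<^sub>\<infinity>s\<in>A. (cmod (\<xi> s))\<^sup>2)"

definition scale_vec :: "complex \<Rightarrow> ('a \<Rightarrow> complex) \<Rightarrow> ('a \<Rightarrow> complex)" where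
  "scale_vec c \<xi> = (\<lambda>s. c * \<xi> s)"

definition delta :: "'a \<Rightarrow> 'a \<Rightarrow> complex" where
  "delta t = (\<lambda>s. if s = t then 1 else 0)"


section \<open>Bounded operators and von Neumann algebras\<close>

type_synonym 'a oper = "('a \<Rightarrow> complex) \<Rightarrow> ('a \<Rightarrow> complex)"

text \<open>
  Operators are extensional, i.e. \<^const>\<open>undefined\<close> off the Hilbert space, so that equality of
  operators is equality of functions.
\<close>

definition bounded_ops :: "'a set \<Rightarrow> 'a oper set" where
  "bounded_ops A = {T \<in> ell2 A \<rightarrow>\<^sub>E ell2 A.
     (\<forall>\<xi>\<in>ell2 A. \<forall>\<eta>\<in>ell2 A. T (\<xi> + \<eta>) = T \<xi> + T \<eta>) \<and>
     (\<forall>c. \<forall>\<xi>\<in>ell2 A. T (scale_vec c \<xi>) = scale_vec c (T \<xi>)) \<and>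
     (\<exists>K. \<forall>\<xi>\<in>ell2 A. ell2_norm A (T \<xi>) \<le> K * ell2_norm A \<xi>)}"

definition op_id :: "'a set \<Rightarrow> 'a oper" where
  "op_id A = (\<lambda>\<xi>\<in>ell2 A. \<xi>)"

definition op_add :: "'a set \<Rightarrow> 'a oper \<Rightarrow> 'a oper \<Rightarrow> 'a oper" where
  "op_add A S T = (\<lambda>\<xi>\<in>ell2 A. S \<xi> + T \<xi>)"

definition op_scale :: "'a set \<Rightarrow> complex \<Rightarrow> 'a oper \<Rightarrow> 'a oper" where
  "op_scale A c T = (\<lambda>\<xi>\<in>ell2 A. scale_vec c (T \<xi>))"

definition op_mult :: "'a set \<Rightarrow> 'a oper \<Rightarrow> 'a oper \<Rightarrow> 'a oper" where
  "op_mult A S T = compose (ell2 A) S T"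

definition adjoint_op :: "'a set \<Rightarrow> 'a oper \<Rightarrow> 'a oper" where
  "adjoint_op A T = (THE S. S \<in> bounded_ops A \<and>
     (\<forall>\<xi>\<in>ell2 A. \<forall>\<eta>\<in>ell2 A. ell2_inner A (T \<xi>) \<eta> = ell2_inner A \<xi> (S \<eta>)))"

text \<open>The weak operator topology is the initial topology for the functionals
  \<open>T \<mapsto> \<langle>T \<xi>, \<eta>\<rangle>\<close>.\<close>

definition wot :: "'a set \<Rightarrow> 'a oper topology" where
  "wot A = pullback_topology (bounded_ops A)
     (\<lambda>T. \<lambda>(\<xi>, \<eta>)\<in>ell2 A \<times> ell2 A. ell2_inner A (T \<xi>) \<eta>)
     (product_topology (\<lambda>_. euclidean) (ell2 A \<times> ell2 A))"

definition star_subalgebra :: "'a set \<Rightarrow> 'a oper set \<Rightarrow> bool" where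
  "star_subalgebra A M \<longleftrightarrow> M \<subseteq> bounded_ops A \<and> M \<noteq> {} \<and>
     (\<forall>S\<in>M. \<forall>T\<in>M. op_add A S T \<in> M \<and> op_mult A S T \<in> M) \<and>
     (\<forall>c. \<forall>T\<in>M. op_scale A c T \<in> M) \<and>
     (\<forall>T\<in>M. adjoint_op A T \<in> M)"

definition abelian_ops :: "'a set \<Rightarrow> 'a oper set \<Rightarrow> bool" where
  "abelian_ops A M \<longleftrightarrow> (\<forall>S\<in>M. \<forall>T\<in>M. op_mult A S T = op_mult A T S)"

definition von_neumann_algebra :: "'a set \<Rightarrow> 'a oper set \<Rightarrow> bool" where
  "von_neumann_algebra A M \<longleftrightarrow> star_subalgebra A M \<and> op_id A \<in> M \<and> closedin (wot A) M"

definition unitaries :: "'a set \<Rightarrow> 'a oper set \<Rightarrow> 'a oper set" where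
  "unitaries A M = {u \<in> M. op_mult A (adjoint_op A u) u = op_id A \<and>
                           op_mult A u (adjoint_op A u) = op_id A}"

definition normalizer_ops :: "'a set \<Rightarrow> 'a oper set \<Rightarrow> 'a oper set \<Rightarrow> 'a oper set" where
  "normalizer_ops A M N =
     {u \<in> unitaries A M. (\<lambda>x. op_mult A (op_mult A u x) (adjoint_op A u)) ` N = N}"

definition maximal_abelian :: "'a set \<Rightarrow> 'a oper set \<Rightarrow> 'a oper set \<Rightarrow> bool" where
  "maximal_abelian A M N \<longleftrightarrow> star_subalgebra A N \<and> abelian_ops A N \<and> N \<subseteq> M \<and>
     (\<forall>N'. star_subalgebra A N' \<and> abelian_ops A N' \<and> N \<subseteq> N' \<and> N' \<subseteq> M \<longrightarrow> N' = N)"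

definition cartan_subalgebra :: "'a set \<Rightarrow> 'a oper set \<Rightarrow> 'a oper set \<Rightarrow> bool" where
  "cartan_subalgebra A M N \<longleftrightarrow> von_neumann_algebra A N \<and> N \<subseteq> M \<and>
     maximal_abelian A M N \<and>
     von_neumann_algebra A hull (normalizer_ops A M N) = M"


section \<open>The group von Neumann algebra\<close>

definition left_reg :: "('a, 'm) monoid_scheme \<Rightarrow> 'a \<Rightarrow> 'a oper" where
  "left_reg G s = (\<lambda>\<xi>\<in>ell2 (carrier G).
     (\<lambda>t. if t \<in> carrier G then \<xi> (inv\<^bsub>G\<^esub> s \<otimes>\<^bsub>G\<^esub> t) else 0))"

definition left_reg_span :: "('a, 'm) monoid_scheme \<Rightarrow> 'a oper set" where
  "left_reg_span G =
     {(\<lambda>\<xi>\<in>ell2 (carrier G). \<Sum>s\<in>F. scale_vec (c s) (left_reg G s \<xi>)) | F c.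
        finite F \<and> F \<subseteq> carrier G}"

definition group_vna :: "('a, 'm) monoid_scheme \<Rightarrow> 'a oper set" where
  "group_vna G = wot (carrier G) closure_of left_reg_span G"

definition vna_trace :: "('a, 'm) monoid_scheme \<Rightarrow> 'a oper \<Rightarrow> complex" where
  "vna_trace G x = ell2_inner (carrier G) (x (delta \<one>\<^bsub>G\<^esub>)) (delta \<one>\<^bsub>G\<^esub>)"

definition group_ring_act :: "('a, 'm) monoid_scheme \<Rightarrow> ('a \<Rightarrow>\<^sub>0 int) \<Rightarrow> 'a oper" where
  "group_ring_act G a = (\<lambda>\<xi>\<in>ell2 (carrier G).
     \<Sum>s\<in>Poly_Mapping.keys a. scale_vec (of_int (Poly_Mapping.lookup a s)) (left_reg G s \<xi>))"

definition group_ring_acts_injectively :: "('a, 'm) monoid_scheme \<Rightarrow> bool" where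
  "group_ring_acts_injectively G \<longleftrightarrow>
     (\<forall>a. Poly_Mapping.keys a \<subseteq> carrier G \<and> a \<noteq> 0 \<longrightarrow>
          inj_on (group_ring_act G a) (ell2 (carrier G)))"


section \<open>The first L2-Betti number\<close>

text \<open>
  The right action of \<open>L(\<Gamma>)\<close> on \<open>\<ell>\<^sup>2(\<Gamma>)\<close> commuting with \<open>\<lambda>\<close> is \<open>\<xi> \<cdot> x = J x\<^sup>* J \<xi>\<close>, with \<open>J\<close> the
  modular conjugation; thus \<open>\<delta>\<^sub>t \<cdot> \<lambda>(s) = \<delta>\<^sub>t\<^sub>s\<close>. It makes \<open>H\<^sup>1(\<Gamma>, \<ell>\<^sup>2(\<Gamma>))\<close> a right module over \<open>L(\<Gamma>)\<close>.
\<close>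

definition mod_conj :: "('a, 'm) monoid_scheme \<Rightarrow> 'a oper" where
  "mod_conj G \<xi> = (\<lambda>t. if t \<in> carrier G then cnj (\<xi> (inv\<^bsub>G\<^esub> t)) else 0)"

definition right_act :: "('a, 'm) monoid_scheme \<Rightarrow> ('a \<Rightarrow> complex) \<Rightarrow> 'a oper \<Rightarrow> ('a \<Rightarrow> complex)" where
  "right_act G \<xi> x = mod_conj G (adjoint_op (carrier G) x (mod_conj G \<xi>))"

definition cocycles :: "('a, 'm) monoid_scheme \<Rightarrow> ('a \<Rightarrow> 'a \<Rightarrow> complex) monoid" where
  "cocycles G = \<lparr>
     carrier = {b \<in> carrier G \<rightarrow>\<^sub>E ell2 (carrier G).
       \<forall>s\<in>carrier G. \<forall>t\<in>carrier G. b (s \<otimes>\<^bsub>G\<^esub> t) = b s + left_reg G s (b t)},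
     monoid.mult = (\<lambda>b c. \<lambda>s\<in>carrier G. b s + c s),
     one = (\<lambda>s\<in>carrier G. 0)\<rparr>"

definition coboundaries :: "('a, 'm) monoid_scheme \<Rightarrow> ('a \<Rightarrow> 'a \<Rightarrow> complex) set" where
  "coboundaries G = (\<lambda>\<xi>. \<lambda>s\<in>carrier G. left_reg G s \<xi> - \<xi>) ` ell2 (carrier G)"

definition H1 :: "('a, 'm) monoid_scheme \<Rightarrow> ('a \<Rightarrow> 'a \<Rightarrow> complex) set monoid" where
  "H1 G = cocycles G Mod coboundaries G"

text \<open>The class of \<open>b\<close> times \<open>x\<close> is the class of \<open>b \<cdot> x\<close>. All sets in the following union coincide,
  because coboundaries are stable under the action.\<close>

definition H1_act :: "('a, 'm) monoid_scheme \<Rightarrow> ('a \<Rightarrow> 'a \<Rightarrow> complex) set \<Rightarrow> 'a oper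
    \<Rightarrow> ('a \<Rightarrow> 'a \<Rightarrow> complex) set" where
  "H1_act G C x =
     (\<Union>b\<in>C. coboundaries G #>\<^bsub>cocycles G\<^esub> (\<lambda>s\<in>carrier G. right_act G (b s) x))"

text \<open>
  Up to isomorphism, the finitely generated projective right \<open>L(\<Gamma>)\<close>-modules are \<open>p L(\<Gamma>)\<^sup>n\<close> for a
  projection \<open>p\<close> among the \<open>n \<times> n\<close> matrices over \<open>L(\<Gamma>)\<close>; elements are columns, on which \<open>L(\<Gamma>)\<close>
  acts by entrywise multiplication from the right. The dimension of \<open>p L(\<Gamma>)\<^sup>n\<close> is the
  unnormalized trace of \<open>p\<close>.
\<close>

definition mat_vec :: "('a, 'm) monoid_scheme \<Rightarrow> nat \<Rightarrow> (nat \<Rightarrow> nat \<Rightarrow> 'a oper)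
    \<Rightarrow> (nat \<Rightarrow> 'a oper) \<Rightarrow> (nat \<Rightarrow> 'a oper)" where
  "mat_vec G n p v = (\<lambda>i\<in>{..<n}. \<lambda>\<xi>\<in>ell2 (carrier G). \<Sum>j<n. p i j (v j \<xi>))"

definition matrix_projection :: "('a, 'm) monoid_scheme \<Rightarrow> nat \<Rightarrow> (nat \<Rightarrow> nat \<Rightarrow> 'a oper) \<Rightarrow> bool" where
  "matrix_projection G n p \<longleftrightarrow>
     (\<forall>i<n. \<forall>j<n. p i j \<in> group_vna G \<and> adjoint_op (carrier G) (p i j) = p j i \<and>
        p i j = (\<lambda>\<xi>\<in>ell2 (carrier G). \<Sum>k<n. p i k (p k j \<xi>)))"

definition projective_module :: "('a, 'm) monoid_scheme \<Rightarrow> nat \<Rightarrow> (nat \<Rightarrow> nat \<Rightarrow> 'a oper)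
    \<Rightarrow> (nat \<Rightarrow> 'a oper) monoid" where
  "projective_module G n p = \<lparr>
     carrier = mat_vec G n p ` ({..<n} \<rightarrow>\<^sub>E group_vna G),
     monoid.mult = (\<lambda>v w. \<lambda>i\<in>{..<n}. op_add (carrier G) (v i) (w i)),
     one = (\<lambda>i\<in>{..<n}. \<lambda>\<xi>\<in>ell2 (carrier G). 0)\<rparr>"

definition projective_act :: "('a, 'm) monoid_scheme \<Rightarrow> nat \<Rightarrow> (nat \<Rightarrow> 'a oper) \<Rightarrow> 'a oper
    \<Rightarrow> (nat \<Rightarrow> 'a oper)" where
  "projective_act G n v x = (\<lambda>i\<in>{..<n}. op_mult (carrier G) (v i) x)"

text \<open>
  Lueck's dimension of a right \<open>L(\<Gamma>)\<close>-module, given by its additive group \<open>M\<close> and the action \<open>act\<close>: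
  the supremum of the dimensions of its finitely generated projective submodules, each presented
  as the image of an injective module homomorphism from some \<open>p L(\<Gamma>)\<^sup>n\<close>.
\<close>

definition lueck_dim :: "('a, 'm) monoid_scheme \<Rightarrow> ('b, 'k) monoid_scheme \<Rightarrow> ('b \<Rightarrow> 'a oper \<Rightarrow> 'b)
    \<Rightarrow> ennreal" where
  "lueck_dim G M act = Sup {ennreal (Re (\<Sum>i<n. vna_trace G (p i i))) | n p.
     matrix_projection G n p \<and>
     (\<exists>\<phi>\<in>mon (projective_module G n p) M.
        \<forall>v\<in>carrier (projective_module G n p). \<forall>x\<in>group_vna G.
          \<phi> (projective_act G n v x) = act (\<phi> v) x)}"

definition L2_betti_1 :: "('a, 'm) monoid_scheme \<Rightarrow> ennreal" where
  "L2_betti_1 G = lueck_dim G (H1 G) (H1_act G)"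


section \<open>Properties of groups\<close>

definition torsion_free :: "('a, 'm) monoid_scheme \<Rightarrow> bool" where
  "torsion_free G \<longleftrightarrow> (\<forall>x\<in>carrier G. \<forall>n::nat. n > 0 \<and> x [^]\<^bsub>G\<^esub> n = \<one>\<^bsub>G\<^esub> \<longrightarrow> x = \<one>\<^bsub>G\<^esub>)"

text \<open>Amenability of a discrete group: existence of a left-invariant finitely additive
  probability measure on all subsets.\<close>

definition amenable :: "('a, 'm) monoid_scheme \<Rightarrow> bool" where
  "amenable G \<longleftrightarrow> (\<exists>\<mu> :: 'a set \<Rightarrow> real.
     (\<forall>E. E \<subseteq> carrier G \<longrightarrow> 0 \<le> \<mu> E) \<and>
     \<mu> (carrier G) = 1 \<and>
     (\<forall>E F. E \<subseteq> carrier G \<and> F \<subseteq> carrier G \<and> E \<inter> F = {} \<longrightarrow> \<mu> (E \<union> F) = \<mu> E + \<mu> F) \<and>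
     (\<forall>s\<in>carrier G. \<forall>E. E \<subseteq> carrier G \<longrightarrow> \<mu> (s <#\<^bsub>G\<^esub> E) = \<mu> E))"

definition word_length :: "('a, 'm) monoid_scheme \<Rightarrow> 'a set \<Rightarrow> 'a \<Rightarrow> nat" where
  "word_length G S g = (LEAST k. \<exists>ws. length ws = k \<and> set ws \<subseteq> S \<union> m_inv G ` S \<and>
     foldr (monoid.mult G) ws \<one>\<^bsub>G\<^esub> = g)"

definition word_dist :: "('a, 'm) monoid_scheme \<Rightarrow> 'a set \<Rightarrow> 'a \<Rightarrow> 'a \<Rightarrow> real" where
  "word_dist G S x y = real (word_length G S (inv\<^bsub>G\<^esub> x \<otimes>\<^bsub>G\<^esub> y))"

definition gromov_product :: "('a \<Rightarrow> 'a \<Rightarrow> real) \<Rightarrow> 'a \<Rightarrow> 'a \<Rightarrow> 'a \<Rightarrow> real" where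
  "gromov_product d w x y = (d x w + d y w - d x y) / 2"

text \<open>Gromov's definition: finitely generated, and the word metric of a finite generating set
  satisfies the four-point inequality.\<close>

definition hyperbolic_group :: "('a, 'm) monoid_scheme \<Rightarrow> bool" where
  "hyperbolic_group G \<longleftrightarrow> (\<exists>S. finite S \<and> S \<subseteq> carrier G \<and> generate G S = carrier G \<and>
     (\<exists>\<delta>::real. \<forall>w\<in>carrier G. \<forall>x\<in>carrier G. \<forall>y\<in>carrier G. \<forall>z\<in>carrier G.
        gromov_product (word_dist G S) w x z \<ge>
          min (gromov_product (word_dist G S) w x y) (gromov_product (word_dist G S) w y z) - \<delta>))"

definition positive_betti_class :: "('a, 'm) monoid_scheme \<Rightarrow> bool" where
  "positive_betti_class G \<longleftrightarrow> group G \<and> countable (carrier G) \<and> torsion_free G \<and>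
     L2_betti_1 G > 0 \<and> group_ring_acts_injectively G"

end

theory Submission
  imports Defs "HOL-Real_Asymp.Real_Asymp"
begin

text \<open>
  A Cartan subalgebra \<open>\<A>\<close> normalized by \<open>\<Gamma>\<close> is a \<open>\<Gamma>\<close>-invariant maximal abelian subalgebra; only this is
  used. For \<open>s \<in> \<Gamma>\<close> let \<open>p\<^sub>s \<in> \<A>\<close> be the projection onto the vectors on which every \<open>a \<in> \<A>\<close> agrees with
  \<open>\<lambda>(s) a \<lambda>(s)\<^sup>*\<close>; by maximality \<open>p\<^sub>s \<lambda>(s) \<in> \<A>\<close>. If all \<open>p\<^sub>s\<close> with \<open>s \<noteq> \<one>\<close> vanish, then \<open>\<A>\<close> is scalar
  and \<open>\<Gamma>\<close> is trivial. Otherwise, as \<open>\<A>\<close> is abelian and \<open>\<Gamma>\<close> torsion-free, \<open>p\<^sub>s\<close> and \<open>p\<^sub>t\<close> are orthogonal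
  unless \<open>s\<close> and \<open>t\<close> commute. The trace being finite and conjugation invariant, some \<open>s \<noteq> \<one>\<close> has only
  boundedly many pairwise non-commuting conjugates, and this passes to the factors of a product.

  In a hyperbolic group centralizers of elements of infinite order grow linearly, so such an \<open>s\<close> forces
  quadratic growth and hence amenability. If the first L2-Betti number is positive, there is a nonzero
  \<open>\<ell>\<^sup>2\<close>-cocycle vanishing at \<open>s\<close>; its zero set is a malnormal subgroup closed under centralizers and roots,
  so it contains every \<open>g\<close>, because a power of \<open>g\<close> conjugates \<open>s\<close> into the centralizer of \<open>s\<close>.
\<close>

section \<open>Square-summable functions as a Hilbert space\<close>

text \<open>The operators that the proof needs are projections onto invariant closed subspaces, or
  corners of such projections; they do not arise as limits of group elements. Membership in
  L(\<Gamma>) must therefore be testable by commutation with right translations, so the weak closure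
  is first identified with the commutant \<open>right_comm\<close>. Membership in the maximal
  abelian algebra is tested in the same spirit, since that algebra equals its relative commutant.
  This gives \<open>p s\<close> and, because \<open>lam s\<close> turns \<open>a\<close> into
  \<open>sg s a\<close>, which agrees with \<open>a\<close> on the range of \<open>p s\<close>, also
  \<open>p s\<close> times \<open>lam s\<close>. On the cohomological side the obstacle is that the
  range of \<lambda>(s) - 1 is dense but need not contain the value b(s) of a given cocycle b. The
  equation becomes solvable once b is multiplied from the right by a suitable x in L(\<Gamma>). A
  dimension count shows that x can be taken so close to 1 that b x is still not a coboundary;
  without this closeness the resulting cocycle vanishing at s could be zero.\<close>

lemma ell2_iff:
  "\<xi> \<in> ell2 A \<longleftrightarrow> (\<forall>s. s \<notin> A \<longrightarrow> \<xi> s = 0) \<and> (\<lambda>s. (cmod (\<xi> s))\<^sup>2) summable_on A"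
  by (simp add: ell2_def)

lemma ell2_off: "\<xi> \<in> ell2 A \<Longrightarrow> s \<notin> A \<Longrightarrow> \<xi> s = 0"
  by (simp add: ell2_def)

lemma ell2_summable: "\<xi> \<in> ell2 A \<Longrightarrow> (\<lambda>s. (cmod (\<xi> s))\<^sup>2) summable_on A"
  by (simp add: ell2_def)

lemma ell2_zero [simp, intro]: "0 \<in> ell2 A"
  by (simp add: ell2_iff zero_fun_def)

lemma ell2_norm_nonneg [simp]: "0 \<le> ell2_norm A \<xi>"
  by (simp add: ell2_norm_def infsum_nonneg)

lemma ell2_norm_sq: "(ell2_norm A \<xi>)\<^sup>2 = (\<Sum>\<^sub>\<infinity>s\<in>A. (cmod (\<xi> s))\<^sup>2)"
  by (simp add: ell2_norm_def infsum_nonneg)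

lemma ell2_finite_sum_le:
  assumes "\<xi> \<in> ell2 A" "finite F" "F \<subseteq> A"
  shows "(\<Sum>s\<in>F. (cmod (\<xi> s))\<^sup>2) \<le> (ell2_norm A \<xi>)\<^sup>2"
  unfolding ell2_norm_sq
  by (rule finite_sum_le_infsum) (use assms in \<open>auto simp: ell2_iff\<close>)

lemma ell2_boundI:
  assumes off: "\<And>s. s \<notin> A \<Longrightarrow> \<xi> s = 0"
    and le: "\<And>F. finite F \<Longrightarrow> F \<subseteq> A \<Longrightarrow> (\<Sum>s\<in>F. (cmod (\<xi> s))\<^sup>2) \<le> K\<^sup>2" and "K \<ge> 0"
  shows "\<xi> \<in> ell2 A" "ell2_norm A \<xi> \<le> K"
proof -
  have s: "(\<lambda>s. (cmod (\<xi> s))\<^sup>2) summable_on A"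
    by (rule nonneg_bdd_above_summable_on) (use le in \<open>auto intro!: bdd_aboveI[of _ "K\<^sup>2"]\<close>)
  then show "\<xi> \<in> ell2 A" using off by (simp add: ell2_iff)
  have "(ell2_norm A \<xi>)\<^sup>2 \<le> K\<^sup>2"
    unfolding ell2_norm_sq by (rule infsum_le_finite_sums[OF s]) (use le in auto)
  then show "ell2_norm A \<xi> \<le> K"
    using \<open>K \<ge> 0\<close> power2_le_imp_le by blast
qed

lemma ell2_coord_le: "\<xi> \<in> ell2 A \<Longrightarrow> cmod (\<xi> t) \<le> ell2_norm A \<xi>"
  using ell2_finite_sum_le[of \<xi> A "{t}"] ell2_off[of \<xi> A t]
  by (cases "t \<in> A") (auto intro: power2_le_imp_le)

lemma ell2_scale [intro]:
  assumes "\<xi> \<in> ell2 A" shows "scale_vec c \<xi> \<in> ell2 A"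
  using assms by (auto simp: ell2_iff scale_vec_def norm_mult power_mult_distrib intro: summable_on_cmult_right)

lemma ell2_norm_scale: "ell2_norm A (scale_vec c \<xi>) = cmod c * ell2_norm A \<xi>"
  by (simp add: ell2_norm_def scale_vec_def norm_mult power_mult_distrib infsum_cmult_right'
      real_sqrt_mult)

lemma ell2_add [intro]:
  assumes "\<xi> \<in> ell2 A" "\<eta> \<in> ell2 A" shows "\<xi> + \<eta> \<in> ell2 A"
proof -
  have le: "(cmod (a + b))\<^sup>2 \<le> 2 * (cmod a)\<^sup>2 + 2 * (cmod b)\<^sup>2" for a b
  proof -
    have "(cmod (a + b))\<^sup>2 \<le> (cmod a + cmod b)\<^sup>2"
      by (intro power_mono norm_triangle_ineq) auto
    also have "\<dots> \<le> 2 * (cmod a)\<^sup>2 + 2 * (cmod b)\<^sup>2"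
      using sum_squares_bound[of "cmod a" "cmod b"] by (simp add: power2_sum)
    finally show ?thesis .
  qed
  have "(\<lambda>s. (cmod (\<xi> s + \<eta> s))\<^sup>2) summable_on A"
    by (rule summable_on_comparison_test[where f = "\<lambda>s. 2 * (cmod (\<xi> s))\<^sup>2 + 2 * (cmod (\<eta> s))\<^sup>2"])
      (use assms le in \<open>auto simp: ell2_iff intro!: summable_on_add summable_on_cmult_right\<close>)
  then show ?thesis using assms by (simp add: ell2_iff)
qed

lemma scale_vec_apply [simp]: "scale_vec c \<xi> s = c * \<xi> s"
  by (simp add: scale_vec_def)

lemma scale_vec_simps [simp]:
  "scale_vec 1 \<xi> = \<xi>" "scale_vec 0 \<xi> = 0" "scale_vec c 0 = 0"
  "scale_vec c (scale_vec d \<xi>) = scale_vec (c * d) \<xi>"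
  by (auto simp: fun_eq_iff)

lemma scale_vec_distrib:
  "scale_vec c (\<xi> + \<eta>) = scale_vec c \<xi> + scale_vec c \<eta>"
  "scale_vec c (\<xi> - \<eta>) = scale_vec c \<xi> - scale_vec c \<eta>"
  by (auto simp: fun_eq_iff algebra_simps)

lemma ell2_uminus_eq: "- \<xi> = scale_vec (- 1) \<xi>"
  by (auto simp: fun_eq_iff)

lemma ell2_diff_eq: "\<xi> - \<eta> = \<xi> + scale_vec (- 1) \<eta>"
  by (auto simp: fun_eq_iff)

lemma ell2_diff [intro]: "\<xi> \<in> ell2 A \<Longrightarrow> \<eta> \<in> ell2 A \<Longrightarrow> \<xi> - \<eta> \<in> ell2 A"
  unfolding ell2_diff_eq by (intro ell2_add ell2_scale)

lemma ell2_sum [intro]: "(\<And>i. i \<in> I \<Longrightarrow> f i \<in> ell2 A) \<Longrightarrow> (\<Sum>i\<in>I. f i) \<in> ell2 A"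
  by (induction I rule: infinite_finite_induct) auto

lemma delta_ell2 [intro]: "(t::'a) \<in> A \<Longrightarrow> delta t \<in> ell2 A"
proof (rule ell2_boundI(1)[where K = 1])
  fix F :: "'a set" assume "finite F"
  have "(\<Sum>s\<in>F. (cmod (delta t s))\<^sup>2) = (\<Sum>s\<in>F. if s = t then 1 else 0)"
    by (intro sum.cong) (auto simp: delta_def)
  then show "(\<Sum>s\<in>F. (cmod (delta t s))\<^sup>2) \<le> 1\<^sup>2" using \<open>finite F\<close> by simp
qed (auto simp: delta_def)

lemma finite_cauchy_schwarz:
  assumes "\<xi> \<in> ell2 A" "\<eta> \<in> ell2 A" "finite F" "F \<subseteq> A"
  shows "(\<Sum>s\<in>F. cmod (\<xi> s * cnj (\<eta> s))) \<le> ell2_norm A \<xi> * ell2_norm A \<eta>"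
proof -
  have "(\<Sum>s\<in>F. cmod (\<xi> s * cnj (\<eta> s))) = (\<Sum>s\<in>F. \<bar>cmod (\<xi> s)\<bar> * \<bar>cmod (\<eta> s)\<bar>)"
    by (simp add: norm_mult)
  also have "\<dots> \<le> L2_set (\<lambda>s. cmod (\<xi> s)) F * L2_set (\<lambda>s. cmod (\<eta> s)) F"
    by (rule L2_set_mult_ineq)
  also have "\<dots> \<le> ell2_norm A \<xi> * ell2_norm A \<eta>"
    unfolding L2_set_def
    by (intro mult_mono real_le_lsqrt ell2_finite_sum_le assms) (auto simp: sum_nonneg)
  finally show ?thesis .
qed

lemma ell2_inner_abs_summable:
  assumes "\<xi> \<in> ell2 A" "\<eta> \<in> ell2 A"
  shows "(\<lambda>s. cmod (\<xi> s * cnj (\<eta> s))) summable_on A"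
proof (rule nonneg_bdd_above_summable_on)
  show "bdd_above (sum (\<lambda>s. cmod (\<xi> s * cnj (\<eta> s))) ` {F. F \<subseteq> A \<and> finite F})"
    by (rule bdd_aboveI2) (use finite_cauchy_schwarz[OF assms] in blast)
qed simp

lemma ell2_inner_summable:
  assumes "\<xi> \<in> ell2 A" "\<eta> \<in> ell2 A"
  shows "(\<lambda>s. \<xi> s * cnj (\<eta> s)) summable_on A"
  by (rule Infinite_Sum.abs_summable_summable[OF ell2_inner_abs_summable[OF assms]])

lemma ell2_cauchy_schwarz:
  assumes "\<xi> \<in> ell2 A" "\<eta> \<in> ell2 A"
  shows "cmod (ell2_inner A \<xi> \<eta>) \<le> ell2_norm A \<xi> * ell2_norm A \<eta>"
proof -
  have "cmod (ell2_inner A \<xi> \<eta>) \<le> (\<Sum>\<^sub>\<infinity>s\<in>A. cmod (\<xi> s * cnj (\<eta> s)))"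
    unfolding ell2_inner_def by (intro norm_infsum_bound ell2_inner_abs_summable assms)
  also have "\<dots> \<le> ell2_norm A \<xi> * ell2_norm A \<eta>"
    by (intro infsum_le_finite_sums ell2_inner_abs_summable finite_cauchy_schwarz assms)
  finally show ?thesis .
qed

lemma ell2_inner_commute: "ell2_inner A \<eta> \<xi> = cnj (ell2_inner A \<xi> \<eta>)"
  unfolding ell2_inner_def infsum_cnj[symmetric] by (simp add: mult.commute)

lemma ell2_inner_zero [simp]: "ell2_inner A 0 \<eta> = 0" "ell2_inner A \<xi> 0 = 0"
  by (simp_all add: ell2_inner_def)

lemma ell2_inner_scale [simp]:
  "ell2_inner A (scale_vec c \<xi>) \<eta> = c * ell2_inner A \<xi> \<eta>"
  "ell2_inner A \<xi> (scale_vec c \<eta>) = cnj c * ell2_inner A \<xi> \<eta>"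
proof -
  show *: "ell2_inner A (scale_vec c \<xi>) \<eta> = c * ell2_inner A \<xi> \<eta>" for c \<xi> \<eta>
    by (simp add: ell2_inner_def infsum_cmult_right' mult.assoc)
  show "ell2_inner A \<xi> (scale_vec c \<eta>) = cnj c * ell2_inner A \<xi> \<eta>"
    by (subst ell2_inner_commute) (simp add: * ell2_inner_commute[of A \<eta> \<xi>])
qed

lemma ell2_inner_add:
  assumes "\<xi> \<in> ell2 A" "\<xi>' \<in> ell2 A" "\<eta> \<in> ell2 A"
  shows "ell2_inner A (\<xi> + \<xi>') \<eta> = ell2_inner A \<xi> \<eta> + ell2_inner A \<xi>' \<eta>"
    "ell2_inner A \<eta> (\<xi> + \<xi>') = ell2_inner A \<eta> \<xi> + ell2_inner A \<eta> \<xi>'"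
proof -
  show *: "ell2_inner A (\<xi> + \<xi>') \<eta> = ell2_inner A \<xi> \<eta> + ell2_inner A \<xi>' \<eta>"
    by (simp add: ell2_inner_def distrib_right infsum_add ell2_inner_summable assms)
  show "ell2_inner A \<eta> (\<xi> + \<xi>') = ell2_inner A \<eta> \<xi> + ell2_inner A \<eta> \<xi>'"
    by (subst (1 2 3) ell2_inner_commute) (simp add: *)
qed

lemma ell2_inner_diff:
  assumes "\<xi> \<in> ell2 A" "\<xi>' \<in> ell2 A" "\<eta> \<in> ell2 A"
  shows "ell2_inner A (\<xi> - \<xi>') \<eta> = ell2_inner A \<xi> \<eta> - ell2_inner A \<xi>' \<eta>"
    "ell2_inner A \<eta> (\<xi> - \<xi>') = ell2_inner A \<eta> \<xi> - ell2_inner A \<eta> \<xi>'"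
  using assms by (auto simp: ell2_diff_eq ell2_inner_add ell2_scale)

lemma ell2_inner_sum:
  assumes "\<And>i. i \<in> I \<Longrightarrow> f i \<in> ell2 A" "\<eta> \<in> ell2 A"
  shows "ell2_inner A (\<Sum>i\<in>I. f i) \<eta> = (\<Sum>i\<in>I. ell2_inner A (f i) \<eta>)"
    "ell2_inner A \<eta> (\<Sum>i\<in>I. f i) = (\<Sum>i\<in>I. ell2_inner A \<eta> (f i))"
  using assms by (induction I rule: infinite_finite_induct) (auto simp: ell2_inner_add ell2_sum)

lemma ell2_inner_self:
  assumes "\<xi> \<in> ell2 A"
  shows "ell2_inner A \<xi> \<xi> = of_real ((ell2_norm A \<xi>)\<^sup>2)"
proof -
  have True: "(\<lambda>s. (cmod (\<xi> s))\<^sup>2) summable_on A"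
    using assms by (rule ell2_summable)
  have "(\<Sum>\<^sub>\<infinity>s\<in>A. complex_of_real ((cmod (\<xi> s))\<^sup>2)) = of_real (\<Sum>\<^sub>\<infinity>s\<in>A. (cmod (\<xi> s))\<^sup>2)"
    by (rule infsumI, subst has_sum_of_real_iff) (use True in \<open>simp add: has_sum_infsum\<close>)
  then show ?thesis
    unfolding ell2_inner_def ell2_norm_sq by (simp only: complex_norm_square)
qed

lemma ell2_norm_zero [simp]: "ell2_norm A 0 = 0"
  by (simp add: ell2_norm_def)

lemma ell2_norm_eq_0: "\<xi> \<in> ell2 A \<Longrightarrow> ell2_norm A \<xi> = 0 \<longleftrightarrow> \<xi> = 0"
  using ell2_coord_le[of \<xi> A] by (auto simp: fun_eq_iff ell2_norm_def)

lemma ell2_inner_self_eq_0: "\<xi> \<in> ell2 A \<Longrightarrow> ell2_inner A \<xi> \<xi> = 0 \<longleftrightarrow> \<xi> = 0"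
  by (simp add: ell2_inner_self ell2_norm_eq_0)

lemma ell2_inner_delta:
  assumes "t \<in> A"
  shows "ell2_inner A \<xi> (delta t) = \<xi> t" "ell2_inner A (delta t) \<xi> = cnj (\<xi> t)"
proof -
  have "ell2_inner A \<xi> (delta t) = (\<Sum>\<^sub>\<infinity>s\<in>{t}. \<xi> s * cnj (delta t s))"
    unfolding ell2_inner_def by (rule infsum_cong_neutral) (use assms in \<open>auto simp: delta_def\<close>)
  then show "ell2_inner A \<xi> (delta t) = \<xi> t" by (simp add: delta_def)
  then show "ell2_inner A (delta t) \<xi> = cnj (\<xi> t)"
    by (subst ell2_inner_commute) simp
qed

lemma ell2_norm_delta [simp]: "t \<in> A \<Longrightarrow> ell2_norm A (delta t) = 1"
proof -
  assume t: "t \<in> A"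
  have "complex_of_real ((ell2_norm A (delta t))\<^sup>2) = of_real 1"
    using ell2_inner_self[OF delta_ell2[OF t]] ell2_inner_delta(1)[OF t, of "delta t"]
    by (simp add: delta_def)
  then have "(ell2_norm A (delta t))\<^sup>2 = 1" using of_real_eq_iff by blast
  then show ?thesis using ell2_norm_nonneg[of A "delta t"] by (simp add: power2_eq_1_iff)
qed

lemma ell2_norm_add_sq:
  assumes "\<xi> \<in> ell2 A" "\<eta> \<in> ell2 A"
  shows "(ell2_norm A (\<xi> + \<eta>))\<^sup>2 = (ell2_norm A \<xi>)\<^sup>2 + (ell2_norm A \<eta>)\<^sup>2 + 2 * Re (ell2_inner A \<xi> \<eta>)"
proof -
  have "complex_of_real ((ell2_norm A (\<xi> + \<eta>))\<^sup>2) =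
     of_real ((ell2_norm A \<xi>)\<^sup>2 + (ell2_norm A \<eta>)\<^sup>2) + (ell2_inner A \<xi> \<eta> + cnj (ell2_inner A \<xi> \<eta>))"
    using assms by (simp add: ell2_inner_self[symmetric] ell2_inner_add ell2_add
        flip: ell2_inner_commute[of A \<eta> \<xi>] of_real_power)
  also have "\<dots> = of_real ((ell2_norm A \<xi>)\<^sup>2 + (ell2_norm A \<eta>)\<^sup>2 + 2 * Re (ell2_inner A \<xi> \<eta>))"
    by (simp add: complex_add_cnj)
  finally show ?thesis using of_real_eq_iff by blast
qed

lemma ell2_norm_diff_sq:
  assumes "\<xi> \<in> ell2 A" "\<eta> \<in> ell2 A"
  shows "(ell2_norm A (\<xi> - \<eta>))\<^sup>2 = (ell2_norm A \<xi>)\<^sup>2 + (ell2_norm A \<eta>)\<^sup>2 - 2 * Re (ell2_inner A \<xi> \<eta>)"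
  using ell2_norm_add_sq[OF assms(1), of "scale_vec (-1) \<eta>"] assms(2)
  by (simp add: ell2_diff_eq ell2_scale ell2_norm_scale)

lemma ell2_pythagoras:
  assumes "\<xi> \<in> ell2 A" "\<eta> \<in> ell2 A" "ell2_inner A \<xi> \<eta> = 0"
  shows "(ell2_norm A (\<xi> + \<eta>))\<^sup>2 = (ell2_norm A \<xi>)\<^sup>2 + (ell2_norm A \<eta>)\<^sup>2"
  using ell2_norm_add_sq[OF assms(1,2)] assms(3) by simp

lemma ell2_norm_triangle:
  assumes "\<xi> \<in> ell2 A" "\<eta> \<in> ell2 A"
  shows "ell2_norm A (\<xi> + \<eta>) \<le> ell2_norm A \<xi> + ell2_norm A \<eta>"
proof (rule power2_le_imp_le)
  have "Re (ell2_inner A \<xi> \<eta>) \<le> ell2_norm A \<xi> * ell2_norm A \<eta>"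
    using ell2_cauchy_schwarz[OF assms] complex_Re_le_cmod order_trans by blast
  then show "(ell2_norm A (\<xi> + \<eta>))\<^sup>2 \<le> (ell2_norm A \<xi> + ell2_norm A \<eta>)\<^sup>2"
    by (simp add: ell2_norm_add_sq[OF assms] power2_sum)
qed simp

lemma ell2_norm_minus_commute: "ell2_norm A (\<xi> - \<eta>) = ell2_norm A (\<eta> - \<xi>)"
  by (simp add: ell2_norm_def norm_minus_commute)

lemma ell2_norm_triangle_diff:
  assumes "\<xi> \<in> ell2 A" "\<eta> \<in> ell2 A" "\<zeta> \<in> ell2 A"
  shows "ell2_norm A (\<xi> - \<zeta>) \<le> ell2_norm A (\<xi> - \<eta>) + ell2_norm A (\<eta> - \<zeta>)"
  using ell2_norm_triangle[of "\<xi> - \<eta>" A "\<eta> - \<zeta>"] assms by (simp add: ell2_diff)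

lemma ell2_norm_triangle_sub:
  assumes "\<xi> \<in> ell2 A" "\<eta> \<in> ell2 A"
  shows "ell2_norm A \<xi> \<le> ell2_norm A \<eta> + ell2_norm A (\<xi> - \<eta>)"
  using ell2_norm_triangle[of "\<eta>" A "\<xi> - \<eta>"] assms by (simp add: ell2_diff)

lemma ell2_norm_sum_le:
  assumes "\<And>i. i \<in> I \<Longrightarrow> f i \<in> ell2 A"
  shows "ell2_norm A (\<Sum>i\<in>I. f i) \<le> (\<Sum>i\<in>I. ell2_norm A (f i))"
  using assms
proof (induction I rule: infinite_finite_induct)
  case (insert i I)
  have "ell2_norm A (f i + sum f I) \<le> ell2_norm A (f i) + ell2_norm A (sum f I)"
    using insert.prems by (intro ell2_norm_triangle) auto
  also have "\<dots> \<le> ell2_norm A (f i) + (\<Sum>i\<in>I. ell2_norm A (f i))"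
    using insert.IH insert.prems by simp
  finally show ?case by (simp only: sum.insert[OF insert.hyps])
qed auto

text \<open>Coordinates are bounded by the norm, so a Cauchy sequence converges coordinatewise. On a
  finite set of coordinates the Cauchy bound passes to the limit, and a bound uniform in the finite
  set is a norm bound.\<close>

lemma ell2_complete:
  assumes X: "\<And>n. X n \<in> ell2 A"
    and cau: "\<And>\<epsilon>. \<epsilon> > 0 \<Longrightarrow> \<exists>N. \<forall>m\<ge>N. \<forall>n\<ge>N. ell2_norm A (X m - X n) < \<epsilon>"
  obtains \<xi> where "\<xi> \<in> ell2 A" "(\<lambda>n. ell2_norm A (X n - \<xi>)) \<longlonglongrightarrow> 0"
proof -
  have "Cauchy (\<lambda>n. X n t)" for t
  proof (rule CauchyI)
    fix e :: real assume "e > 0"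
    then obtain N where N: "\<forall>m\<ge>N. \<forall>n\<ge>N. ell2_norm A (X m - X n) < e" using cau by blast
    have "cmod (X m t - X n t) < e" if "m \<ge> N" "n \<ge> N" for m n
      using ell2_coord_le[OF ell2_diff[OF X[of m] X[of n]], of t] N that by fastforce
    then show "\<exists>M. \<forall>m\<ge>M. \<forall>n\<ge>M. cmod (X m t - X n t) < e" by blast
  qed
  then have "\<exists>l. (\<lambda>n. X n t) \<longlonglongrightarrow> l" for t
    using Cauchy_convergent convergent_def by blast
  then obtain \<xi> where lim: "\<And>t. (\<lambda>n. X n t) \<longlonglongrightarrow> \<xi> t" by metis
  have *: "X n - \<xi> \<in> ell2 A \<and> ell2_norm A (X n - \<xi>) \<le> e"
    if "e > 0" and N: "\<forall>m\<ge>N. \<forall>n\<ge>N. ell2_norm A (X m - X n) < e" and "n \<ge> N" for e N n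
  proof -
    have off: "(X n - \<xi>) s = 0" if "s \<notin> A" for s
      using that X lim[of s] LIMSEQ_unique[OF lim[of s], of 0] ell2_off[OF X that] by auto
    have le: "(\<Sum>s\<in>F. (cmod ((X n - \<xi>) s))\<^sup>2) \<le> e\<^sup>2" if "finite F" "F \<subseteq> A" for F
    proof (rule LIMSEQ_le_const2)
      show "(\<lambda>m. \<Sum>s\<in>F. (cmod ((X n - X m) s))\<^sup>2) \<longlonglongrightarrow> (\<Sum>s\<in>F. (cmod ((X n - \<xi>) s))\<^sup>2)"
        by (auto intro!: tendsto_intros lim)
      have "(\<Sum>s\<in>F. (cmod ((X n - X m) s))\<^sup>2) \<le> e\<^sup>2" if "m \<ge> N" for m
      proof -
        have "(\<Sum>s\<in>F. (cmod ((X n - X m) s))\<^sup>2) \<le> (ell2_norm A (X n - X m))\<^sup>2"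
          by (intro ell2_finite_sum_le \<open>finite F\<close> \<open>F \<subseteq> A\<close> ell2_diff X)
        also have "\<dots> \<le> e\<^sup>2"
          using N \<open>n \<ge> N\<close> that by (intro power_mono) (auto simp: less_imp_le)
        finally show ?thesis .
      qed
      then show "\<exists>M. \<forall>m\<ge>M. (\<Sum>s\<in>F. (cmod ((X n - X m) s))\<^sup>2) \<le> e\<^sup>2" by blast
    qed
    show ?thesis
      by (rule conjI; rule ell2_boundI[where K = e]) (use off le \<open>e > 0\<close> in \<open>simp_all del: minus_apply\<close>)
  qed
  obtain N where "\<forall>m\<ge>N. \<forall>n\<ge>N. ell2_norm A (X m - X n) < 1" using cau[of 1] by auto
  then have "X N - \<xi> \<in> ell2 A" using *[of 1 N N] by auto
  then have "X N - (X N - \<xi>) \<in> ell2 A" by (rule ell2_diff[OF X])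
  moreover have "X N - (X N - \<xi>) = \<xi>" by (simp add: fun_eq_iff)
  ultimately have "\<xi> \<in> ell2 A" by metis
  moreover have "(\<lambda>n. ell2_norm A (X n - \<xi>)) \<longlonglongrightarrow> 0"
  proof (rule LIMSEQ_I)
    fix r :: real assume "r > 0"
    then obtain N where N: "\<forall>m\<ge>N. \<forall>n\<ge>N. ell2_norm A (X m - X n) < r / 2" using cau[of "r / 2"] by auto
    have "norm (ell2_norm A (X n - \<xi>) - 0) < r" if "n \<ge> N" for n
      using *[of "r / 2" N n] N that \<open>r > 0\<close> by auto
    then show "\<exists>no. \<forall>n\<ge>no. norm (ell2_norm A (X n - \<xi>) - 0) < r" by blast
  qed
  ultimately show ?thesis using that by blast
qed

section \<open>Subspaces, orthogonal complements and closures\<close>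

definition l2_subspace :: "'a set \<Rightarrow> ('a \<Rightarrow> complex) set \<Rightarrow> bool" where
  "l2_subspace A V \<longleftrightarrow> V \<subseteq> ell2 A \<and> 0 \<in> V \<and> (\<forall>u\<in>V. \<forall>v\<in>V. u + v \<in> V) \<and> (\<forall>c. \<forall>v\<in>V. scale_vec c v \<in> V)"

text \<open>No closedness is built into \<open>l2_subspace\<close>. The double complement
  \<open>orth A (orth A V)\<close> takes the place of the norm closure, as
  \<open>approx_orth_orth\<close> and \<open>orth_orth_approx\<close> justify.\<close>

definition orth :: "'a set \<Rightarrow> ('a \<Rightarrow> complex) set \<Rightarrow> ('a \<Rightarrow> complex) set" where
  "orth A W = {\<xi> \<in> ell2 A. \<forall>w\<in>W. ell2_inner A \<xi> w = 0}"

lemma orth_subset: "orth A W \<subseteq> ell2 A" by (auto simp: orth_def)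

lemma orthD: "\<xi> \<in> orth A W \<Longrightarrow> w \<in> W \<Longrightarrow> ell2_inner A \<xi> w = 0" by (auto simp: orth_def)

lemma orthD': "\<xi> \<in> orth A W \<Longrightarrow> w \<in> W \<Longrightarrow> ell2_inner A w \<xi> = 0"
  by (subst ell2_inner_commute) (simp add: orthD)

lemma orth_ell2: "\<xi> \<in> orth A W \<Longrightarrow> \<xi> \<in> ell2 A" by (auto simp: orth_def)

lemma orth_orth_superset: "W \<subseteq> ell2 A \<Longrightarrow> W \<subseteq> orth A (orth A W)"
  using orthD' by (fastforce simp: orth_def[of A "orth A W"])

lemma subspace_orth: "W \<subseteq> ell2 A \<Longrightarrow> l2_subspace A (orth A W)"
  by (auto simp: l2_subspace_def orth_def ell2_inner_add subset_iff)

lemma l2_subspaceD: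
  assumes "l2_subspace A V"
  shows "v \<in> V \<Longrightarrow> v \<in> ell2 A" "0 \<in> V" "u \<in> V \<Longrightarrow> v \<in> V \<Longrightarrow> u + v \<in> V" "v \<in> V \<Longrightarrow> scale_vec c v \<in> V"
    "u \<in> V \<Longrightarrow> v \<in> V \<Longrightarrow> u - v \<in> V"
  using assms unfolding ell2_diff_eq by (auto simp: l2_subspace_def)

lemma ell2_parallelogram:
  assumes "\<xi> \<in> ell2 A" "\<eta> \<in> ell2 A"
  shows "(ell2_norm A (\<xi> + \<eta>))\<^sup>2 + (ell2_norm A (\<xi> - \<eta>))\<^sup>2 = 2 * (ell2_norm A \<xi>)\<^sup>2 + 2 * (ell2_norm A \<eta>)\<^sup>2"
  using ell2_norm_add_sq[OF assms] ell2_norm_diff_sq[OF assms] by simp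

text \<open>The projection theorem for a subspace that need not be closed: a minimizing sequence in
  \<open>V\<close> is Cauchy by the parallelogram law, and the nearest point \<open>u\<close> is its
  limit, which may lie outside \<open>V\<close>.\<close>

lemma ell2_closest_point:
  assumes V: "l2_subspace A V" and \<xi>: "\<xi> \<in> ell2 A"
  obtains u where "u \<in> ell2 A" "\<And>\<epsilon>. \<epsilon> > 0 \<Longrightarrow> \<exists>v\<in>V. ell2_norm A (u - v) < \<epsilon>"
    "\<xi> - u \<in> orth A V"
proof -
  define D where "D = (\<lambda>v. (ell2_norm A (\<xi> - v))\<^sup>2) ` V"
  define d where "d = Inf D"
  have Dne: "D \<noteq> {}" and Dbd: "bdd_below D"
    using l2_subspaceD(2)[OF V] unfolding D_def by (auto intro!: bdd_belowI[of _ 0])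
  have d_le: "d \<le> (ell2_norm A (\<xi> - v))\<^sup>2" if "v \<in> V" for v
    unfolding d_def by (rule cInf_lower[OF _ Dbd]) (use that in \<open>auto simp: D_def\<close>)
  have "\<exists>v\<in>V. (ell2_norm A (\<xi> - v))\<^sup>2 < d + 1 / real (Suc n)" for n
  proof -
    have "\<exists>x\<in>D. x < d + 1 / real (Suc n)"
      using cInf_lessD[OF Dne, of "d + 1 / real (Suc n)"] by (auto simp: d_def)
    then show ?thesis by (auto simp: D_def)
  qed
  then obtain v where v: "\<And>n. v n \<in> V" and vd: "\<And>n. (ell2_norm A (\<xi> - v n))\<^sup>2 < d + 1 / real (Suc n)"
    by metis
  have vl: "v n \<in> ell2 A" for n using v V l2_subspaceD(1) by blast
  \<comment> \<open>The midpoint of \<open>v m\<close> and \<open>v n\<close> lies in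
    \<open>V\<close>, so its squared distance to \<xi> is at least \<open>d\<close>; the
    parallelogram law turns this into a bound on the distance of the two points.\<close>
  have close: "(ell2_norm A (v m - v n))\<^sup>2 \<le> 2 / real (Suc m) + 2 / real (Suc n)" for m n
  proof -
    have "(ell2_norm A ((\<xi> - v n) + (\<xi> - v m)))\<^sup>2 + (ell2_norm A ((\<xi> - v n) - (\<xi> - v m)))\<^sup>2
       = 2 * (ell2_norm A (\<xi> - v n))\<^sup>2 + 2 * (ell2_norm A (\<xi> - v m))\<^sup>2"
      by (intro ell2_parallelogram ell2_diff \<xi> vl)
    moreover have "(\<xi> - v n) + (\<xi> - v m) = scale_vec 2 (\<xi> - scale_vec (1/2) (v n + v m))"
      by (auto simp: fun_eq_iff algebra_simps)
    moreover have "4 * d \<le> (ell2_norm A (scale_vec 2 (\<xi> - scale_vec (1/2) (v n + v m))))\<^sup>2"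
      using d_le[OF l2_subspaceD(4)[OF V l2_subspaceD(3)[OF V v v]], of "1/2" n m]
      by (simp add: ell2_norm_scale power_mult_distrib)
    moreover have "(\<xi> - v n) - (\<xi> - v m) = v m - v n" by simp
    ultimately show ?thesis using vd[of n] vd[of m] by simp
  qed
  have cau: "\<exists>N. \<forall>m\<ge>N. \<forall>n\<ge>N. ell2_norm A (v m - v n) < \<epsilon>" if "\<epsilon> > 0" for \<epsilon>
  proof -
    obtain N where N: "4 / \<epsilon>\<^sup>2 < real (Suc N)"
      using reals_Archimedean2[of "4 / \<epsilon>\<^sup>2"] by (metis lessI less_trans of_nat_less_iff)
    have "ell2_norm A (v m - v n) < \<epsilon>" if "m \<ge> N" "n \<ge> N" for m n
    proof (rule power2_less_imp_less)
      have "2 / real (Suc m) + 2 / real (Suc n) \<le> 2 / real (Suc N) + 2 / real (Suc N)"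
        using that by (intro add_mono divide_left_mono) auto
      also have "\<dots> = 4 / real (Suc N)" by simp
      also have "\<dots> < \<epsilon>\<^sup>2" using N \<open>\<epsilon> > 0\<close> by (simp add: field_simps)
      finally show "(ell2_norm A (v m - v n))\<^sup>2 < \<epsilon>\<^sup>2" using close[of m n] by linarith
    qed (use \<open>\<epsilon> > 0\<close> in auto)
    then show ?thesis by blast
  qed
  obtain u where u: "u \<in> ell2 A" and lim: "(\<lambda>n. ell2_norm A (v n - u)) \<longlonglongrightarrow> 0"
    using ell2_complete[of v A, OF vl cau] by blast
  have approx: "\<exists>w\<in>V. ell2_norm A (u - w) < \<epsilon>" if "\<epsilon> > 0" for \<epsilon>
  proof -
    obtain n where "norm (ell2_norm A (v n - u) - 0) < \<epsilon>"
      using LIMSEQ_D[OF lim \<open>\<epsilon> > 0\<close>] by blast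
    then show ?thesis using v by (auto simp: ell2_norm_minus_commute[of A u])
  qed
  have nu: "(ell2_norm A (\<xi> - u))\<^sup>2 \<le> d"
  proof (rule LIMSEQ_le_const)
    have "(\<lambda>n. (sqrt (d + 1 / real (Suc n)) + ell2_norm A (v n - u))\<^sup>2) \<longlonglongrightarrow> (sqrt (d + 0) + 0)\<^sup>2"
      by (intro tendsto_intros lim LIMSEQ_inverse_real_of_nat[unfolded inverse_eq_divide])
    moreover have "d \<ge> 0" unfolding d_def by (rule cInf_greatest[OF Dne]) (auto simp: D_def)
    ultimately show "(\<lambda>n. (sqrt (d + 1 / real (Suc n)) + ell2_norm A (v n - u))\<^sup>2) \<longlonglongrightarrow> d" by simp
    have "(ell2_norm A (\<xi> - u))\<^sup>2 \<le> (sqrt (d + 1 / real (Suc n)) + ell2_norm A (v n - u))\<^sup>2" for n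
    proof (rule power_mono)
      have "ell2_norm A (\<xi> - v n) \<le> sqrt (d + 1 / real (Suc n))"
        using vd[of n] by (intro real_le_rsqrt) auto
      then show "ell2_norm A (\<xi> - u) \<le> sqrt (d + 1 / real (Suc n)) + ell2_norm A (v n - u)"
        using ell2_norm_triangle_diff[OF \<xi> vl[of n] u] by linarith
    qed simp
    then show "\<exists>N. \<forall>n\<ge>N. (ell2_norm A (\<xi> - u))\<^sup>2 \<le> (sqrt (d + 1 / real (Suc n)) + ell2_norm A (v n - u))\<^sup>2"
      by blast
  qed
  \<comment> \<open>Minimality of \<open>d\<close> transfers from \<open>V\<close> to the points
    \<open>u + w\<close>, because \<open>u\<close> is a limit of points of \<open>V\<close>.\<close>
  have d_le': "d \<le> (ell2_norm A (\<xi> - (u + w)))\<^sup>2" if "w \<in> V" for w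
  proof -
    have wl: "w \<in> ell2 A" using that V l2_subspaceD(1) by blast
    have "sqrt d \<le> ell2_norm A (\<xi> - (u + w)) + \<epsilon>" if "\<epsilon> > 0" for \<epsilon>
    proof -
      obtain v' where v': "v' \<in> V" "ell2_norm A (u - v') < \<epsilon>" using approx \<open>\<epsilon> > 0\<close> by blast
      have "sqrt d \<le> ell2_norm A (\<xi> - (v' + w))"
        using d_le[OF l2_subspaceD(3)[OF V v'(1) \<open>w \<in> V\<close>]] by (intro real_le_lsqrt) auto
      also have "\<dots> \<le> ell2_norm A (\<xi> - (u + w)) + ell2_norm A ((u + w) - (v' + w))"
        using v' u wl \<xi> V l2_subspaceD(1) by (intro ell2_norm_triangle_diff) auto
      also have "(u + w) - (v' + w) = u - v'" by simp
      finally show ?thesis using v' by linarith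
    qed
    then have "sqrt d \<le> ell2_norm A (\<xi> - (u + w))" by (rule field_le_epsilon)
    moreover have "d \<ge> 0" unfolding d_def by (rule cInf_greatest[OF Dne]) (auto simp: D_def)
    ultimately show ?thesis by (simp add: sqrt_le_D)
  qed
  have "ell2_inner A (\<xi> - u) w = 0" if w: "w \<in> V" for w
  proof (rule ccontr)
    define z where "z = ell2_inner A (\<xi> - u) w"
    assume "ell2_inner A (\<xi> - u) w \<noteq> 0"
    then have z: "z \<noteq> 0" by (simp add: z_def)
    have wl: "w \<in> ell2 A" using that V l2_subspaceD(1) by blast
    \<comment> \<open>Moving from \<open>u\<close> by \<open>t * z\<close> in direction
      \<open>w\<close> lowers the squared distance by 2 t |z|^2 and raises it by a quadratic term.
      This \<open>t\<close> keeps the quadratic term below t |z|^2.\<close>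
    define t where "t = 1 / (1 + (ell2_norm A w)\<^sup>2)"
    have t: "t > 0" "t * (ell2_norm A w)\<^sup>2 < 1"
      by (auto simp: t_def field_simps add_pos_nonneg)
    have "d \<le> (ell2_norm A (\<xi> - (u + scale_vec (of_real t * z) w)))\<^sup>2"
      by (intro d_le' l2_subspaceD(4)[OF V] w)
    also have "\<xi> - (u + scale_vec (of_real t * z) w) = (\<xi> - u) - scale_vec (of_real t * z) w"
      by simp
    also have "(ell2_norm A \<dots>)\<^sup>2 = (ell2_norm A (\<xi> - u))\<^sup>2 + (cmod (of_real t * z) * ell2_norm A w)\<^sup>2
        - 2 * Re (cnj (of_real t * z) * z)"
      by (subst ell2_norm_diff_sq) (auto simp: z_def ell2_norm_scale \<xi> u wl ell2_diff ell2_scale)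
    also have "Re (cnj (of_real t * z) * z) = t * (cmod z)\<^sup>2"
    proof -
      have "cnj (of_real t * z) * z = of_real t * (z * cnj z)" by simp
      also have "z * cnj z = of_real ((cmod z)\<^sup>2)" by (simp add: complex_norm_square[symmetric])
      finally show ?thesis by (simp flip: of_real_mult of_real_power)
    qed
    also have "(cmod (of_real t * z) * ell2_norm A w)\<^sup>2 = t * (cmod z)\<^sup>2 * (t * (ell2_norm A w)\<^sup>2)"
      using t by (simp add: norm_mult power_mult_distrib power2_eq_square)
    also have "\<dots> < t * (cmod z)\<^sup>2 * 1"
      using t z by (intro mult_strict_left_mono) auto
    finally have "d < (ell2_norm A (\<xi> - u))\<^sup>2 + t * (cmod z)\<^sup>2 * 1 - 2 * (t * (cmod z)\<^sup>2)"
      by (simp only: ring_distribs)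
    then have "t * (cmod z)\<^sup>2 < 0" using nu by linarith
    then show False using t z by (simp add: mult_less_0_iff)
  qed
  then have "\<xi> - u \<in> orth A V" using \<xi> u by (auto simp: orth_def)
  with that u approx show ?thesis by blast
qed

lemma approx_orth_orth:
  assumes V: "V \<subseteq> ell2 A" and u: "u \<in> ell2 A"
    and approx: "\<And>\<epsilon>. \<epsilon> > 0 \<Longrightarrow> \<exists>v\<in>V. ell2_norm A (u - v) < \<epsilon>"
  shows "u \<in> orth A (orth A V)"
proof -
  have "ell2_inner A u w = 0" if w: "w \<in> orth A V" for w
  proof -
    have le: "cmod (ell2_inner A u w) \<le> \<epsilon> * ell2_norm A w" if "\<epsilon> > 0" for \<epsilon>
    proof -
      obtain v where v: "v \<in> V" "ell2_norm A (u - v) < \<epsilon>" using approx \<open>\<epsilon> > 0\<close> by blast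
      have "ell2_inner A u w = ell2_inner A (u - v) w"
        using v u w V by (simp add: ell2_inner_diff subsetD orth_ell2 orthD')
      also have "cmod \<dots> \<le> ell2_norm A (u - v) * ell2_norm A w"
        using v u w V by (intro ell2_cauchy_schwarz) (auto simp: orth_ell2)
      also have "\<dots> \<le> \<epsilon> * ell2_norm A w" using v by (intro mult_right_mono) auto
      finally show ?thesis .
    qed
    have "cmod (ell2_inner A u w) \<le> 0 + e" if "e > 0" for e
    proof -
      have "cmod (ell2_inner A u w) \<le> e / (ell2_norm A w + 1) * ell2_norm A w"
        by (rule le) (intro divide_pos_pos that add_nonneg_pos ell2_norm_nonneg zero_less_one)
      also have "\<dots> \<le> e"
        using that ell2_norm_nonneg[of A w] by (simp add: divide_le_eq distrib_left add_nonneg_pos)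
      finally show ?thesis by simp
    qed
    then have "cmod (ell2_inner A u w) \<le> 0" by (rule field_le_epsilon)
    then show ?thesis by simp
  qed
  then show ?thesis using u by (auto simp: orth_def)
qed

text \<open>The nearest point \<open>u'\<close> in the closure differs from \<open>u\<close> by a
  vector that lies in \<open>orth A V\<close> and is orthogonal to it as well, hence by
  zero.\<close>

lemma orth_orth_approx:
  assumes V: "l2_subspace A V" and u: "u \<in> orth A (orth A V)" and "\<epsilon> > 0"
  shows "\<exists>v\<in>V. ell2_norm A (u - v) < \<epsilon>"
proof -
  obtain u' where u': "u' \<in> ell2 A" "\<And>\<epsilon>. \<epsilon> > 0 \<Longrightarrow> \<exists>v\<in>V. ell2_norm A (u' - v) < \<epsilon>"
    and o: "u - u' \<in> orth A V"
    using ell2_closest_point[OF V orth_ell2[OF u]] by blast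
  have "u' \<in> orth A (orth A V)"
    using approx_orth_orth[OF _ u'] l2_subspaceD(1)[OF V] by blast
  then have "ell2_inner A (u - u') (u - u') = 0"
    using o u by (subst ell2_inner_diff(1)) (auto simp: orth_ell2 orthD)
  then have "u - u' = 0" using o ell2_inner_self_eq_0 orth_ell2 by blast
  then show ?thesis using u'(2) \<open>\<epsilon> > 0\<close> by auto
qed

section \<open>Finitely supported vectors\<close>

lemma sum_fun_apply: "(\<Sum>i\<in>I. f i) s = (\<Sum>i\<in>I. f i s)"
  by (induction I rule: infinite_finite_induct) auto

lemma ell2_finite_support:
  assumes "finite F" "F \<subseteq> A" "\<And>s. s \<notin> F \<Longrightarrow> v s = 0"
  shows "v \<in> ell2 A" "(ell2_norm A v)\<^sup>2 = (\<Sum>s\<in>F. (cmod (v s))\<^sup>2)"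
    "v = (\<Sum>t\<in>F. scale_vec (v t) (delta t))"
proof -
  show v: "v = (\<Sum>t\<in>F. scale_vec (v t) (delta t))"
  proof
    fix s
    have "(\<Sum>t\<in>F. scale_vec (v t) (delta t)) s = (\<Sum>t\<in>F. if s = t then v t else 0)"
      by (simp add: sum_fun_apply delta_def if_distrib cong: if_cong)
    then show "v s = (\<Sum>t\<in>F. scale_vec (v t) (delta t)) s" using assms by simp
  qed
  show "v \<in> ell2 A" by (subst v) (use assms in auto)
  show "(ell2_norm A v)\<^sup>2 = (\<Sum>s\<in>F. (cmod (v s))\<^sup>2)"
  proof -
    have "(\<Sum>\<^sub>\<infinity>s\<in>A. (cmod (v s))\<^sup>2) = (\<Sum>\<^sub>\<infinity>s\<in>F. (cmod (v s))\<^sup>2)"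
      by (rule infsum_cong_neutral) (use assms in auto)
    then show ?thesis using assms by (simp add: ell2_norm_sq)
  qed
qed

lemma ell2_eq_0I:
  assumes "\<xi> \<in> ell2 A" "\<And>t. t \<in> A \<Longrightarrow> ell2_inner A \<xi> (delta t) = 0"
  shows "\<xi> = 0"
proof
  fix t show "\<xi> t = 0 t"
    using assms ell2_off[OF assms(1), of t] by (cases "t \<in> A") (auto simp: ell2_inner_delta)
qed

text \<open>A vector orthogonal to all finitely supported ones is orthogonal to every
  \<open>delta t\<close>, hence zero; density then follows because the double complement is the
  closure.\<close>

lemma finite_support_dense:
  assumes "\<xi> \<in> ell2 A" "\<epsilon> > 0"
  obtains F v where "finite F" "F \<subseteq> A" "\<And>s. s \<notin> F \<Longrightarrow> v s = 0" "ell2_norm A (\<xi> - v) < \<epsilon>"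
proof -
  define V where "V = {v :: 'a \<Rightarrow> complex. \<exists>F. finite F \<and> F \<subseteq> A \<and> (\<forall>s. s \<notin> F \<longrightarrow> v s = 0)}"
  have V: "V \<subseteq> ell2 A" by (auto simp: V_def intro: ell2_finite_support(1))
  have "l2_subspace A V"
    unfolding l2_subspace_def
  proof (intro conjI ballI allI V)
    show "0 \<in> V" by (auto simp: V_def)
  next
    fix u v assume "u \<in> V" "v \<in> V"
    then obtain F G where "finite F" "F \<subseteq> A" "\<forall>s. s \<notin> F \<longrightarrow> u s = 0"
      "finite G" "G \<subseteq> A" "\<forall>s. s \<notin> G \<longrightarrow> v s = 0" by (auto simp: V_def)
    then show "u + v \<in> V" by (auto simp: V_def intro!: exI[of _ "F \<union> G"])
  next
    fix c v assume "v \<in> V"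
    then show "scale_vec c v \<in> V" unfolding V_def by auto
  qed
  moreover have "\<xi> \<in> orth A (orth A V)"
  proof -
    have "w = 0" if "w \<in> orth A V" for w
    proof (rule ell2_eq_0I)
      fix t assume "t \<in> A"
      then have "delta t \<in> V" by (auto simp: V_def delta_def intro!: exI[of _ "{t}"])
      then show "ell2_inner A w (delta t) = 0" using that orthD by blast
    qed (use that orth_ell2 in auto)
    then show ?thesis
      using assms ell2_inner_zero(2)[of A \<xi>] unfolding orth_def[of A "orth A V"] mem_Collect_eq by metis
  qed
  ultimately have "\<exists>v\<in>V. ell2_norm A (\<xi> - v) < \<epsilon>"
    using orth_orth_approx assms by blast
  then show ?thesis using that by (auto simp: V_def)
qed

section \<open>Bounded operators, adjoints and projections\<close>

text \<open>From here on vectors are treated as elements of the Hilbert space, and coordinates are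
  unfolded only where this is asked for.\<close>

lemmas vec_apply = plus_fun_apply minus_apply uminus_apply zero_fun_apply scale_vec_apply

declare vec_apply [simp del]

lemma bounded_opsD:
  assumes "T \<in> bounded_ops A"
  shows "\<xi> \<in> ell2 A \<Longrightarrow> T \<xi> \<in> ell2 A"
    "\<xi> \<in> ell2 A \<Longrightarrow> \<eta> \<in> ell2 A \<Longrightarrow> T (\<xi> + \<eta>) = T \<xi> + T \<eta>"
    "\<xi> \<in> ell2 A \<Longrightarrow> T (scale_vec c \<xi>) = scale_vec c (T \<xi>)"
    "T \<in> extensional (ell2 A)"
  using assms by (auto simp: bounded_ops_def PiE_def)

lemma bounded_ops_zero: "T \<in> bounded_ops A \<Longrightarrow> T 0 = 0"
  using bounded_opsD(3)[of T A 0 0] by simp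

lemma bounded_ops_diff:
  "T \<in> bounded_ops A \<Longrightarrow> \<xi> \<in> ell2 A \<Longrightarrow> \<eta> \<in> ell2 A \<Longrightarrow> T (\<xi> - \<eta>) = T \<xi> - T \<eta>"
  unfolding ell2_diff_eq by (subst bounded_opsD(2)) (auto simp: bounded_opsD(3))

lemma bounded_ops_sum:
  assumes T: "T \<in> bounded_ops A" and f: "\<And>i. i \<in> I \<Longrightarrow> f i \<in> ell2 A"
  shows "T (\<Sum>i\<in>I. f i) = (\<Sum>i\<in>I. T (f i))"
  using f
proof (induction I rule: infinite_finite_induct)
  case (insert i I)
  then have "T (f i + sum f I) = T (f i) + T (sum f I)"
    by (intro bounded_opsD[OF T]) auto
  with insert show ?case by simp
qed (use bounded_ops_zero[OF T] in simp_all)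

lemma bounded_ops_bound:
  assumes "T \<in> bounded_ops A"
  shows "\<exists>K\<ge>0. \<forall>\<xi>\<in>ell2 A. ell2_norm A (T \<xi>) \<le> K * ell2_norm A \<xi>"
proof -
  obtain K where K: "\<forall>\<xi>\<in>ell2 A. ell2_norm A (T \<xi>) \<le> K * ell2_norm A \<xi>"
    using assms unfolding bounded_ops_def by blast
  have "ell2_norm A (T \<xi>) \<le> max K 0 * ell2_norm A \<xi>" if "\<xi> \<in> ell2 A" for \<xi>
    using K that mult_right_mono[of K "max K 0" "ell2_norm A \<xi>"] by fastforce
  then show ?thesis by (intro exI[of _ "max K 0"]) simp
qed

lemma bounded_opsI:
  assumes "\<And>\<xi>. \<xi> \<in> ell2 A \<Longrightarrow> f \<xi> \<in> ell2 A"
    "\<And>\<xi> \<eta>. \<xi> \<in> ell2 A \<Longrightarrow> \<eta> \<in> ell2 A \<Longrightarrow> f (\<xi> + \<eta>) = f \<xi> + f \<eta>"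
    "\<And>c \<xi>. \<xi> \<in> ell2 A \<Longrightarrow> f (scale_vec c \<xi>) = scale_vec c (f \<xi>)"
    "\<And>\<xi>. \<xi> \<in> ell2 A \<Longrightarrow> ell2_norm A (f \<xi>) \<le> K * ell2_norm A \<xi>"
  shows "(\<lambda>\<xi>\<in>ell2 A. f \<xi>) \<in> bounded_ops A"
  unfolding bounded_ops_def using assms by (auto simp: ell2_add ell2_scale intro!: exI[of _ K])

lemma bounded_ops_eqI:
  assumes "S \<in> bounded_ops A" "T \<in> bounded_ops A" "\<And>\<xi>. \<xi> \<in> ell2 A \<Longrightarrow> S \<xi> = T \<xi>"
  shows "S = T"
  using extensionalityI[OF bounded_opsD(4)[OF assms(1)] bounded_opsD(4)[OF assms(2)]] assms(3) by blast

lemma op_apply [simp]: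
  "\<xi> \<in> ell2 A \<Longrightarrow> op_id A \<xi> = \<xi>"
  "\<xi> \<in> ell2 A \<Longrightarrow> op_add A S T \<xi> = S \<xi> + T \<xi>"
  "\<xi> \<in> ell2 A \<Longrightarrow> op_scale A c T \<xi> = scale_vec c (T \<xi>)"
  "\<xi> \<in> ell2 A \<Longrightarrow> op_mult A S T \<xi> = S (T \<xi>)"
  by (auto simp: op_id_def op_add_def op_scale_def op_mult_def compose_def)

lemma op_id_bounded [intro]: "op_id A \<in> bounded_ops A"
  unfolding op_id_def by (rule bounded_opsI[where K = 1]) auto

lemma op_add_bounded [intro]:
  assumes S: "S \<in> bounded_ops A" and T: "T \<in> bounded_ops A"
  shows "op_add A S T \<in> bounded_ops A"
proof -
  obtain K where K: "K \<ge> 0" "\<And>\<xi>. \<xi> \<in> ell2 A \<Longrightarrow> ell2_norm A (S \<xi>) \<le> K * ell2_norm A \<xi>"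
    using bounded_ops_bound[OF S] by blast
  obtain L where L: "L \<ge> 0" "\<And>\<xi>. \<xi> \<in> ell2 A \<Longrightarrow> ell2_norm A (T \<xi>) \<le> L * ell2_norm A \<xi>"
    using bounded_ops_bound[OF T] by blast
  show ?thesis
    unfolding op_add_def
  proof (rule bounded_opsI[where K = "K + L"])
    fix \<xi> assume \<xi>: "\<xi> \<in> ell2 A"
    have "ell2_norm A (S \<xi> + T \<xi>) \<le> ell2_norm A (S \<xi>) + ell2_norm A (T \<xi>)"
      using \<xi> by (intro ell2_norm_triangle bounded_opsD(1)[OF S] bounded_opsD(1)[OF T])
    then show "ell2_norm A (S \<xi> + T \<xi>) \<le> (K + L) * ell2_norm A \<xi>"
      using K(2)[OF \<xi>] L(2)[OF \<xi>] by (simp only: distrib_right)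
  qed (auto simp: bounded_opsD[OF S] bounded_opsD[OF T] scale_vec_distrib add_ac)
qed

lemma op_scale_bounded [intro]:
  assumes T: "T \<in> bounded_ops A" shows "op_scale A c T \<in> bounded_ops A"
proof -
  obtain K where K: "K \<ge> 0" "\<And>\<xi>. \<xi> \<in> ell2 A \<Longrightarrow> ell2_norm A (T \<xi>) \<le> K * ell2_norm A \<xi>"
    using bounded_ops_bound[OF T] by blast
  show ?thesis
    unfolding op_scale_def
    by (rule bounded_opsI[where K = "cmod c * K"])
      (auto simp: bounded_opsD[OF T] scale_vec_distrib ell2_norm_scale ell2_scale mult.assoc
        mult.commute[of c] intro!: mult_left_mono K(2))
qed

lemma op_mult_bounded [intro]:
  assumes S: "S \<in> bounded_ops A" and T: "T \<in> bounded_ops A"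
  shows "op_mult A S T \<in> bounded_ops A"
proof -
  obtain K where K: "K \<ge> 0" "\<And>\<xi>. \<xi> \<in> ell2 A \<Longrightarrow> ell2_norm A (S \<xi>) \<le> K * ell2_norm A \<xi>"
    using bounded_ops_bound[OF S] by blast
  obtain L where L: "L \<ge> 0" "\<And>\<xi>. \<xi> \<in> ell2 A \<Longrightarrow> ell2_norm A (T \<xi>) \<le> L * ell2_norm A \<xi>"
    using bounded_ops_bound[OF T] by blast
  show ?thesis
    unfolding op_mult_def compose_def
  proof (rule bounded_opsI[where K = "K * L"])
    fix \<xi> assume \<xi>: "\<xi> \<in> ell2 A"
    have "ell2_norm A (S (T \<xi>)) \<le> K * ell2_norm A (T \<xi>)" using K \<xi> bounded_opsD(1)[OF T] by blast
    also have "\<dots> \<le> K * (L * ell2_norm A \<xi>)" using K L(2)[OF \<xi>] by (intro mult_left_mono)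
    finally show "ell2_norm A (S (T \<xi>)) \<le> K * L * ell2_norm A \<xi>" by (simp add: mult.assoc)
  qed (auto simp: bounded_opsD[OF S] bounded_opsD[OF T])
qed

text \<open>The adjoint is written down by its coordinates, the inner products of \<eta> with
  \<open>T (delta t)\<close>. That they are square-summable comes from testing \<open>T\<close> on a
  truncation of the candidate itself.\<close>

lemma bounded_ops_adjoint_exists:
  assumes T: "T \<in> bounded_ops A"
  obtains S where "S \<in> bounded_ops A"
    "\<And>\<xi> \<eta>. \<xi> \<in> ell2 A \<Longrightarrow> \<eta> \<in> ell2 A \<Longrightarrow> ell2_inner A (T \<xi>) \<eta> = ell2_inner A \<xi> (S \<eta>)"
proof -
  obtain K where K: "K \<ge> 0" "\<And>\<xi>. \<xi> \<in> ell2 A \<Longrightarrow> ell2_norm A (T \<xi>) \<le> K * ell2_norm A \<xi>"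
    using bounded_ops_bound[OF T] by blast
  define S where "S = (\<lambda>\<eta> t. if t \<in> A then ell2_inner A \<eta> (T (delta t)) else 0)"
  have sum_le: "(\<Sum>t\<in>F. (cmod (S \<eta> t))\<^sup>2) \<le> (K * ell2_norm A \<eta>)\<^sup>2"
    if \<eta>: "\<eta> \<in> ell2 A" and F: "finite F" "F \<subseteq> A" for \<eta> F
  proof -
    define q where "q = (\<Sum>t\<in>F. (cmod (S \<eta> t))\<^sup>2)"
    \<comment> \<open>For this truncation the inner product of \<eta> with \<open>T \<zeta>\<close>
      is exactly the squared norm of \<zeta>, so Cauchy-Schwarz bounds that norm independently of
      \<open>F\<close>.\<close>
    define \<zeta> where "\<zeta> = (\<lambda>t. if t \<in> F then S \<eta> t else 0)"
    note \<zeta> = ell2_finite_support[OF F, of \<zeta>]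
    have "q \<ge> 0" by (simp add: q_def sum_nonneg)
    have n: "(ell2_norm A \<zeta>)\<^sup>2 = q" using \<zeta>(2) by (simp add: \<zeta>_def q_def)
    have "T \<zeta> = (\<Sum>t\<in>F. scale_vec (\<zeta> t) (T (delta t)))"
    proof -
      have "T \<zeta> = T (\<Sum>t\<in>F. scale_vec (\<zeta> t) (delta t))"
        by (subst \<zeta>(3)[symmetric]) (simp_all add: \<zeta>_def)
      also have "\<dots> = (\<Sum>t\<in>F. T (scale_vec (\<zeta> t) (delta t)))"
        using F by (intro bounded_ops_sum[OF T]) auto
      also have "\<dots> = (\<Sum>t\<in>F. scale_vec (\<zeta> t) (T (delta t)))"
        using F by (intro sum.cong bounded_opsD(3)[OF T]) auto
      finally show ?thesis .
    qed
    then have "ell2_inner A \<eta> (T \<zeta>) = (\<Sum>t\<in>F. cnj (\<zeta> t) * ell2_inner A \<eta> (T (delta t)))"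
      using F \<eta> by (simp add: ell2_inner_sum ell2_scale bounded_opsD[OF T] delta_ell2 subset_iff)
    also have "\<dots> = (\<Sum>t\<in>F. of_real ((cmod (S \<eta> t))\<^sup>2))"
    proof (intro sum.cong refl)
      fix t assume "t \<in> F"
      then have "\<zeta> t = S \<eta> t" "ell2_inner A \<eta> (T (delta t)) = S \<eta> t"
        using F by (auto simp: \<zeta>_def S_def)
      then show "cnj (\<zeta> t) * ell2_inner A \<eta> (T (delta t)) = of_real ((cmod (S \<eta> t))\<^sup>2)"
        by (simp only: complex_norm_square mult.commute)
    qed
    finally have "cmod (ell2_inner A \<eta> (T \<zeta>)) = q"
      using \<open>q \<ge> 0\<close> by (simp add: q_def flip: of_real_sum of_real_power)
    moreover have "cmod (ell2_inner A \<eta> (T \<zeta>)) \<le> ell2_norm A \<eta> * (K * ell2_norm A \<zeta>)"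
      using ell2_cauchy_schwarz[OF \<eta> bounded_opsD(1)[OF T \<zeta>(1)]] K(2)[OF \<zeta>(1)]
        mult_left_mono[OF K(2)[OF \<zeta>(1)] ell2_norm_nonneg[of A \<eta>]] by (auto simp: \<zeta>_def)
    ultimately have "(ell2_norm A \<zeta>)\<^sup>2 \<le> (K * ell2_norm A \<eta>) * ell2_norm A \<zeta>"
      by (simp add: n mult_ac)
    then have "ell2_norm A \<zeta> \<le> K * ell2_norm A \<eta>"
      using K(1) ell2_norm_nonneg[of A \<zeta>] unfolding power2_eq_square
      by (cases "ell2_norm A \<zeta> = 0") (auto simp: mult_le_cancel_right)
    then show ?thesis
      using n ell2_norm_nonneg[of A \<zeta>] power_mono[of "ell2_norm A \<zeta>" "K * ell2_norm A \<eta>" 2]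
      by (simp add: q_def)
  qed
  have S: "S \<eta> \<in> ell2 A" "ell2_norm A (S \<eta>) \<le> K * ell2_norm A \<eta>" if "\<eta> \<in> ell2 A" for \<eta>
    by (rule ell2_boundI[where K = "K * ell2_norm A \<eta>"]; use sum_le[OF that] K(1) in \<open>simp add: S_def\<close>)+
  have rel: "ell2_inner A (T \<xi>) \<eta> = ell2_inner A \<xi> (S \<eta>)" if \<xi>: "\<xi> \<in> ell2 A" and \<eta>: "\<eta> \<in> ell2 A" for \<xi> \<eta>
  proof -
    have fin: "ell2_inner A (T v) \<eta> = ell2_inner A v (S \<eta>)"
      if F: "finite F" "F \<subseteq> A" "\<And>s. s \<notin> F \<Longrightarrow> v s = 0" for F v
    proof -
      note v = ell2_finite_support[OF F]
      have "T v = T (\<Sum>t\<in>F. scale_vec (v t) (delta t))" by (rule arg_cong[OF v(3)])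
      also have "\<dots> = (\<Sum>t\<in>F. T (scale_vec (v t) (delta t)))"
        using F by (intro bounded_ops_sum[OF T]) auto
      also have "\<dots> = (\<Sum>t\<in>F. scale_vec (v t) (T (delta t)))"
        using F by (intro sum.cong bounded_opsD(3)[OF T]) auto
      finally have "ell2_inner A (T v) \<eta> = (\<Sum>t\<in>F. v t * ell2_inner A (T (delta t)) \<eta>)"
        using F \<eta> by (simp add: ell2_inner_sum ell2_scale bounded_opsD[OF T] delta_ell2 subset_iff)
      also have "\<dots> = (\<Sum>t\<in>F. ell2_inner A (scale_vec (v t) (delta t)) (S \<eta>))"
        using F by (intro sum.cong)
          (auto simp: ell2_inner_delta S_def subset_iff ell2_inner_commute[of A _ \<eta>])
      also have "\<dots> = ell2_inner A (\<Sum>t\<in>F. scale_vec (v t) (delta t)) (S \<eta>)"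
        using F S(1)[OF \<eta>] by (subst ell2_inner_sum(1)) auto
      also have "(\<Sum>t\<in>F. scale_vec (v t) (delta t)) = v" by (rule v(3)[symmetric])
      finally show ?thesis .
    qed
    \<comment> \<open>After subtracting a finitely supported \<open>v\<close>, each of the two inner
      products is at most \<open>K\<close> times the norms of \<open>\<xi> - v\<close> and \<eta>;
      hence the factor 2.\<close>
    define M where "M = 2 * K * ell2_norm A \<eta>"
    have le: "cmod (ell2_inner A (T \<xi>) \<eta> - ell2_inner A \<xi> (S \<eta>)) \<le> M * \<epsilon>" if "\<epsilon> > 0" for \<epsilon>
    proof -
      obtain F v where F: "finite F" "F \<subseteq> A" "\<And>s. s \<notin> F \<Longrightarrow> v s = 0" and e: "ell2_norm A (\<xi> - v) < \<epsilon>"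
        using finite_support_dense[OF \<xi> \<open>\<epsilon> > 0\<close>] by blast
      have v: "v \<in> ell2 A" using ell2_finite_support(1)[OF F] .
      have d: "\<xi> - v \<in> ell2 A" using \<xi> v by (rule ell2_diff)
      have "ell2_inner A (T \<xi>) \<eta> - ell2_inner A \<xi> (S \<eta>)
          = ell2_inner A (T (\<xi> - v)) \<eta> - ell2_inner A (\<xi> - v) (S \<eta>)"
        using fin[OF F] \<xi> v \<eta> S(1)[OF \<eta>]
        by (simp add: bounded_ops_diff[OF T] ell2_inner_diff bounded_opsD[OF T])
      also have "cmod \<dots> \<le> cmod (ell2_inner A (T (\<xi> - v)) \<eta>) + cmod (ell2_inner A (\<xi> - v) (S \<eta>))"
        by (rule norm_triangle_ineq4)
      also have "\<dots> \<le> K * ell2_norm A (\<xi> - v) * ell2_norm A \<eta> + ell2_norm A (\<xi> - v) * (K * ell2_norm A \<eta>)"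
        by (intro add_mono order_trans[OF ell2_cauchy_schwarz] mult_mono K S d \<eta> bounded_opsD[OF T]
            ell2_norm_nonneg order_refl mult_nonneg_nonneg)
      also have "\<dots> = M * ell2_norm A (\<xi> - v)" by (simp add: M_def)
      also have "\<dots> \<le> M * \<epsilon>" using e K(1) by (intro mult_left_mono) (auto simp: M_def)
      finally show ?thesis .
    qed
    have "M \<ge> 0" using K(1) by (simp add: M_def)
    have "cmod (ell2_inner A (T \<xi>) \<eta> - ell2_inner A \<xi> (S \<eta>)) \<le> 0 + e" if "e > 0" for e
    proof -
      have "cmod (ell2_inner A (T \<xi>) \<eta> - ell2_inner A \<xi> (S \<eta>)) \<le> M * (e / (M + 1))"
        by (rule le) (use that \<open>M \<ge> 0\<close> in \<open>simp add: add_nonneg_pos\<close>)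
      also have "\<dots> \<le> e" using that \<open>M \<ge> 0\<close> by (simp add: divide_le_eq distrib_left add_nonneg_pos mult.commute)
      finally show ?thesis by simp
    qed
    then have "cmod (ell2_inner A (T \<xi>) \<eta> - ell2_inner A \<xi> (S \<eta>)) \<le> 0" by (rule field_le_epsilon)
    then show ?thesis by simp
  qed
  show ?thesis
  proof (rule that[of "\<lambda>\<eta>\<in>ell2 A. S \<eta>"])
    show "(\<lambda>\<eta>\<in>ell2 A. S \<eta>) \<in> bounded_ops A"
    proof (rule bounded_opsI[where K = K])
      fix \<xi> \<eta> assume "\<xi> \<in> ell2 A" "\<eta> \<in> ell2 A"
      then show "S (\<xi> + \<eta>) = S \<xi> + S \<eta>"
        by (auto simp: S_def fun_eq_iff vec_apply ell2_inner_add bounded_opsD[OF T] delta_ell2)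
    next
      fix c \<xi> assume "\<xi> \<in> ell2 A"
      then show "S (scale_vec c \<xi>) = scale_vec c (S \<xi>)"
        by (auto simp: S_def fun_eq_iff vec_apply)
    qed (use S in auto)
  qed (use rel in auto)
qed

lemma ell2_inner_ext:
  assumes "\<xi> \<in> ell2 A" "\<eta> \<in> ell2 A" "\<And>\<zeta>. \<zeta> \<in> ell2 A \<Longrightarrow> ell2_inner A \<zeta> \<xi> = ell2_inner A \<zeta> \<eta>"
  shows "\<xi> = \<eta>"
proof -
  have "ell2_inner A (\<xi> - \<eta>) (\<xi> - \<eta>) = 0"
    using assms by (subst ell2_inner_diff(2)) (auto intro: ell2_diff)
  then show ?thesis using assms ell2_inner_self_eq_0[of "\<xi> - \<eta>" A] by (auto intro: ell2_diff)
qed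

lemma adjoint_op_eqI:
  assumes S: "S \<in> bounded_ops A"
    and rel: "\<And>\<xi> \<eta>. \<xi> \<in> ell2 A \<Longrightarrow> \<eta> \<in> ell2 A \<Longrightarrow> ell2_inner A (T \<xi>) \<eta> = ell2_inner A \<xi> (S \<eta>)"
  shows "adjoint_op A T = S"
  unfolding adjoint_op_def
proof (rule the_equality)
  fix S' assume S': "S' \<in> bounded_ops A \<and>
    (\<forall>\<xi>\<in>ell2 A. \<forall>\<eta>\<in>ell2 A. ell2_inner A (T \<xi>) \<eta> = ell2_inner A \<xi> (S' \<eta>))"
  show "S' = S"
  proof (rule bounded_ops_eqI[of _ A])
    fix \<eta> assume "\<eta> \<in> ell2 A"
    with S S' rel show "S' \<eta> = S \<eta>"
      by (intro ell2_inner_ext[of _ A] bounded_opsD(1)[of S A] bounded_opsD(1)[of S' A]) auto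
  qed (use S S' in auto)
qed (use assms in auto)

lemma adjoint_op:
  assumes "T \<in> bounded_ops A"
  shows adjoint_op_bounded: "adjoint_op A T \<in> bounded_ops A"
    and adjoint_op_inner: "\<And>\<xi> \<eta>. \<xi> \<in> ell2 A \<Longrightarrow> \<eta> \<in> ell2 A \<Longrightarrow>
      ell2_inner A (T \<xi>) \<eta> = ell2_inner A \<xi> (adjoint_op A T \<eta>)"
proof -
  obtain S where S: "S \<in> bounded_ops A"
    "\<And>\<xi> \<eta>. \<xi> \<in> ell2 A \<Longrightarrow> \<eta> \<in> ell2 A \<Longrightarrow> ell2_inner A (T \<xi>) \<eta> = ell2_inner A \<xi> (S \<eta>)"
    using bounded_ops_adjoint_exists[OF assms] by blast
  have eq: "adjoint_op A T = S" using S by (rule adjoint_op_eqI)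
  show "adjoint_op A T \<in> bounded_ops A"
    "\<And>\<xi> \<eta>. \<xi> \<in> ell2 A \<Longrightarrow> \<eta> \<in> ell2 A \<Longrightarrow> ell2_inner A (T \<xi>) \<eta> = ell2_inner A \<xi> (adjoint_op A T \<eta>)"
    using S by (simp_all add: eq)
qed

lemma adjoint_op_inner':
  assumes "T \<in> bounded_ops A" "\<xi> \<in> ell2 A" "\<eta> \<in> ell2 A"
  shows "ell2_inner A (adjoint_op A T \<xi>) \<eta> = ell2_inner A \<xi> (T \<eta>)"
  by (subst (1 2) ell2_inner_commute) (simp add: adjoint_op_inner[OF assms(1)] assms)

lemma adjoint_op_adjoint [simp]: "T \<in> bounded_ops A \<Longrightarrow> adjoint_op A (adjoint_op A T) = T"
  by (rule adjoint_op_eqI) (auto simp: adjoint_op_inner'[of T])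

lemma adjoint_op_add:
  assumes "S \<in> bounded_ops A" "T \<in> bounded_ops A"
  shows "adjoint_op A (op_add A S T) = op_add A (adjoint_op A S) (adjoint_op A T)"
  by (rule adjoint_op_eqI)
    (auto simp: ell2_inner_add adjoint_op_inner[OF assms(1)] adjoint_op_inner[OF assms(2)]
      bounded_opsD[OF assms(1)] bounded_opsD[OF assms(2)] bounded_opsD[OF adjoint_op_bounded[OF assms(1)]]
      bounded_opsD[OF adjoint_op_bounded[OF assms(2)]] intro!: adjoint_op_bounded assms)

lemma adjoint_op_scale:
  assumes "T \<in> bounded_ops A"
  shows "adjoint_op A (op_scale A c T) = op_scale A (cnj c) (adjoint_op A T)"
  by (rule adjoint_op_eqI)
    (auto simp: adjoint_op_inner[OF assms] intro!: adjoint_op_bounded assms)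

text \<open>Equal matrix coefficients make the adjoints agree on every \<open>delta u\<close>, and
  the coordinate of \<open>S \<xi>\<close> at \<open>u\<close> is the inner product of \<xi> with
  the adjoint at \<open>delta u\<close>.\<close>

lemma bounded_ops_eq_delta:
  assumes S: "S \<in> bounded_ops A" and T: "T \<in> bounded_ops A"
    and eq: "\<And>t u. t \<in> A \<Longrightarrow> u \<in> A \<Longrightarrow> S (delta t) u = T (delta t) u"
  shows "S = T"
proof (rule bounded_ops_eqI[OF S T])
  have adj: "adjoint_op A S (delta u) = adjoint_op A T (delta u)" if u: "u \<in> A" for u
  proof
    fix t
    show "adjoint_op A S (delta u) t = adjoint_op A T (delta u) t"
    proof (cases "t \<in> A")
      case True
      have *: "adjoint_op A R (delta u) t = cnj (R (delta t) u)" if R: "R \<in> bounded_ops A" for R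
        using adjoint_op_inner'[OF R delta_ell2[OF u] delta_ell2[OF True]] True u
        by (simp add: ell2_inner_delta)
      show ?thesis using *[OF S] *[OF T] eq[OF True u] by simp
    next
      case False
      then show ?thesis
        using ell2_off[OF bounded_opsD(1)[OF adjoint_op_bounded[OF S] delta_ell2[OF u]]]
          ell2_off[OF bounded_opsD(1)[OF adjoint_op_bounded[OF T] delta_ell2[OF u]]] by simp
    qed
  qed
  fix \<xi> assume \<xi>: "\<xi> \<in> ell2 A"
  show "S \<xi> = T \<xi>"
  proof
    fix u
    show "S \<xi> u = T \<xi> u"
    proof (cases "u \<in> A")
      case True
      have *: "R \<xi> u = ell2_inner A \<xi> (adjoint_op A R (delta u))" if R: "R \<in> bounded_ops A" for R
        using adjoint_op_inner[OF R \<xi> delta_ell2[OF True]] True by (simp add: ell2_inner_delta)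
      show ?thesis using *[OF S] *[OF T] adj[OF True] by simp
    next
      case False
      then show ?thesis using ell2_off[OF bounded_opsD(1)[OF S \<xi>]] ell2_off[OF bounded_opsD(1)[OF T \<xi>]] by simp
    qed
  qed
qed

text \<open>The projection onto \<open>orth A W\<close>, not onto \<open>W\<close>: a complement is
  closed for every \<open>W\<close>. The projection onto the closure of a subspace \<open>V\<close>
  is therefore \<open>proj_op A (orth A V)\<close>.\<close>

definition proj_op :: "'a set \<Rightarrow> ('a \<Rightarrow> complex) set \<Rightarrow> 'a oper" where
  "proj_op A W = (\<lambda>\<xi>\<in>ell2 A. THE u. u \<in> orth A W \<and> \<xi> - u \<in> orth A (orth A W))"

lemma orth_antimono: "W \<subseteq> W' \<Longrightarrow> orth A W' \<subseteq> orth A W"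
  by (auto simp: orth_def)

lemma orth3: "W \<subseteq> ell2 A \<Longrightarrow> orth A (orth A (orth A W)) = orth A W"
  by (intro equalityI orth_antimono orth_orth_superset orth_subset)

lemma orth_inter_0: "u \<in> orth A W \<Longrightarrow> u \<in> orth A (orth A W) \<Longrightarrow> u = 0"
  using ell2_inner_self_eq_0[of u A] orthD[of u A "orth A W" u] orth_ell2 by blast

lemma proj_op:
  assumes W: "W \<subseteq> ell2 A" and \<xi>: "\<xi> \<in> ell2 A"
  shows proj_op_in: "proj_op A W \<xi> \<in> orth A W"
    and proj_op_compl: "\<xi> - proj_op A W \<xi> \<in> orth A (orth A W)"
    and proj_op_eqI: "\<And>u. u \<in> orth A W \<Longrightarrow> \<xi> - u \<in> orth A (orth A W) \<Longrightarrow> proj_op A W \<xi> = u"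
proof -
  obtain u where u: "u \<in> ell2 A" "\<And>\<epsilon>. \<epsilon> > 0 \<Longrightarrow> \<exists>v\<in>orth A W. ell2_norm A (u - v) < \<epsilon>"
    and o: "\<xi> - u \<in> orth A (orth A W)"
    using ell2_closest_point[OF subspace_orth[OF W] \<xi>] by blast
  have u': "u \<in> orth A W"
    using approx_orth_orth[OF orth_subset u] by (simp add: orth3[OF W])
  have uniq: "v = u" if v: "v \<in> orth A W" "\<xi> - v \<in> orth A (orth A W)" for v
  proof -
    have "(\<xi> - u) - (\<xi> - v) \<in> orth A (orth A W)"
      by (rule l2_subspaceD(5)[OF subspace_orth[OF orth_subset] o v(2)])
    moreover have "(\<xi> - u) - (\<xi> - v) = v - u" by (simp add: fun_eq_iff vec_apply)
    moreover have "v - u \<in> orth A W" by (rule l2_subspaceD(5)[OF subspace_orth[OF W] v(1) u'])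
    ultimately have "v - u = 0" using orth_inter_0 by metis
    then show ?thesis by simp
  qed
  have eq: "proj_op A W \<xi> = u"
    unfolding proj_op_def restrict_apply' [OF \<xi>]
    by (rule the_equality) (use u' o uniq in blast)+
  show "proj_op A W \<xi> \<in> orth A W" "\<xi> - proj_op A W \<xi> \<in> orth A (orth A W)"
    "\<And>u. u \<in> orth A W \<Longrightarrow> \<xi> - u \<in> orth A (orth A W) \<Longrightarrow> proj_op A W \<xi> = u"
    unfolding eq using u' o uniq by blast+
qed

context
  fixes A :: "'a set" and W
  assumes W: "W \<subseteq> ell2 A"
begin

lemma proj_op_ell2: "\<xi> \<in> ell2 A \<Longrightarrow> proj_op A W \<xi> \<in> ell2 A"
  using proj_op_in[OF W] orth_ell2 by blast

lemma proj_op_fix: "\<xi> \<in> orth A W \<Longrightarrow> proj_op A W \<xi> = \<xi>"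
  by (rule proj_op_eqI[OF W])
    (auto simp: orth_ell2 l2_subspaceD(2)[OF subspace_orth[OF orth_subset]])

lemma proj_op_self_adjoint:
  assumes "\<xi> \<in> ell2 A" "\<eta> \<in> ell2 A"
  shows "ell2_inner A (proj_op A W \<xi>) \<eta> = ell2_inner A \<xi> (proj_op A W \<eta>)"
proof -
  have "ell2_inner A (proj_op A W \<xi>) (\<eta> - proj_op A W \<eta>) = 0"
    using orthD'[OF proj_op_compl[OF W assms(2)] proj_op_in[OF W assms(1)]] .
  moreover have "ell2_inner A (\<xi> - proj_op A W \<xi>) (proj_op A W \<eta>) = 0"
    using orthD[OF proj_op_compl[OF W assms(1)] proj_op_in[OF W assms(2)]] .
  ultimately show ?thesis using assms by (simp add: ell2_inner_diff proj_op_ell2)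
qed

lemma proj_op_inner_self:
  assumes "\<xi> \<in> ell2 A"
  shows "ell2_inner A (proj_op A W \<xi>) \<xi> = of_real ((ell2_norm A (proj_op A W \<xi>))\<^sup>2)"
  using proj_op_self_adjoint[of "proj_op A W \<xi>" \<xi>] proj_op_fix[OF proj_op_in[OF W assms]] assms
  by (simp only: proj_op_ell2 flip: ell2_inner_self)

lemma proj_op_norm_le:
  assumes "\<xi> \<in> ell2 A"
  shows "ell2_norm A (proj_op A W \<xi>) \<le> ell2_norm A \<xi>"
proof (rule power2_le_imp_le)
  have "(ell2_norm A (proj_op A W \<xi> + (\<xi> - proj_op A W \<xi>)))\<^sup>2
      = (ell2_norm A (proj_op A W \<xi>))\<^sup>2 + (ell2_norm A (\<xi> - proj_op A W \<xi>))\<^sup>2"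
    using proj_op_in[OF W assms] proj_op_compl[OF W assms]
    by (intro ell2_pythagoras) (auto simp: orth_ell2 orthD')
  then show "(ell2_norm A (proj_op A W \<xi>))\<^sup>2 \<le> (ell2_norm A \<xi>)\<^sup>2" by simp
qed simp

lemma proj_op_bounded: "proj_op A W \<in> bounded_ops A"
proof -
  have "(\<lambda>\<xi>\<in>ell2 A. proj_op A W \<xi>) \<in> bounded_ops A"
  proof (rule bounded_opsI[where K = 1])
    fix \<xi> \<eta> assume *: "\<xi> \<in> ell2 A" "\<eta> \<in> ell2 A"
    have "\<xi> + \<eta> - (proj_op A W \<xi> + proj_op A W \<eta>) = (\<xi> - proj_op A W \<xi>) + (\<eta> - proj_op A W \<eta>)"
      by (simp add: fun_eq_iff vec_apply)
    also have "\<dots> \<in> orth A (orth A W)"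
      by (intro l2_subspaceD(3)[OF subspace_orth[OF orth_subset]] proj_op_compl[OF W] *)
    finally show "proj_op A W (\<xi> + \<eta>) = proj_op A W \<xi> + proj_op A W \<eta>"
      using * by (intro proj_op_eqI[OF W] l2_subspaceD(3)[OF subspace_orth[OF W]] proj_op_in[OF W] ell2_add)
  next
    fix c \<xi> assume *: "\<xi> \<in> ell2 A"
    have "scale_vec c \<xi> - scale_vec c (proj_op A W \<xi>) = scale_vec c (\<xi> - proj_op A W \<xi>)"
      by (simp add: scale_vec_distrib)
    also have "\<dots> \<in> orth A (orth A W)"
      by (intro l2_subspaceD(4)[OF subspace_orth[OF orth_subset]] proj_op_compl[OF W] *)
    finally show "proj_op A W (scale_vec c \<xi>) = scale_vec c (proj_op A W \<xi>)"
      using * by (intro proj_op_eqI[OF W] l2_subspaceD(4)[OF subspace_orth[OF W]] proj_op_in[OF W] ell2_scale)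
  qed (auto simp: proj_op_ell2 proj_op_norm_le)
  moreover have "(\<lambda>\<xi>\<in>ell2 A. proj_op A W \<xi>) = proj_op A W"
    by (simp add: proj_op_def restrict_def fun_eq_iff)
  ultimately show ?thesis by simp
qed

text \<open>If the range is invariant under \<open>T\<close> and under a formal adjoint
  \<open>T'\<close>, then \<open>T\<close> preserves the complement of the range too and respects
  the decomposition. \<open>T\<close> is a bare map, so that translations, which are not
  extensional, are covered.\<close>

lemma proj_op_commute:
  assumes T: "\<And>\<xi>. \<xi> \<in> ell2 A \<Longrightarrow> T \<xi> \<in> ell2 A"
    "\<And>\<xi> \<eta>. \<xi> \<in> ell2 A \<Longrightarrow> \<eta> \<in> ell2 A \<Longrightarrow> T (\<xi> - \<eta>) = T \<xi> - T \<eta>"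
    and adj: "\<And>\<xi> \<eta>. \<xi> \<in> ell2 A \<Longrightarrow> \<eta> \<in> ell2 A \<Longrightarrow> ell2_inner A (T \<xi>) \<eta> = ell2_inner A \<xi> (T' \<eta>)"
    and V: "\<And>v. v \<in> orth A W \<Longrightarrow> T v \<in> orth A W" "\<And>v. v \<in> orth A W \<Longrightarrow> T' v \<in> orth A W"
    and \<xi>: "\<xi> \<in> ell2 A"
  shows "proj_op A W (T \<xi>) = T (proj_op A W \<xi>)"
proof (rule proj_op_eqI[OF W T(1)[OF \<xi>]])
  show "T (proj_op A W \<xi>) \<in> orth A W" using V(1) proj_op_in[OF W \<xi>] .
  have c: "\<xi> - proj_op A W \<xi> \<in> orth A (orth A W)" using proj_op_compl[OF W \<xi>] .
  have "T \<xi> - T (proj_op A W \<xi>) = T (\<xi> - proj_op A W \<xi>)"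
    using T(2)[OF \<xi> proj_op_ell2[OF \<xi>]] by simp
  also have "\<dots> \<in> orth A (orth A W)"
    unfolding orth_def[of A "orth A W"]
    using T(1) adj orth_ell2[OF c] orthD[OF c V(2)] by (auto simp: orth_ell2)
  finally show "T \<xi> - T (proj_op A W \<xi>) \<in> orth A (orth A W)" .
qed

end

section \<open>Permutation operators and amplifications\<close>

definition permute :: "'a set \<Rightarrow> ('a \<Rightarrow> 'a) \<Rightarrow> ('a \<Rightarrow> complex) \<Rightarrow> ('a \<Rightarrow> complex)" where
  "permute A \<pi> \<xi> = (\<lambda>t. if t \<in> A then \<xi> (\<pi> t) else 0)"

lemma permute_apply [simp]: "t \<in> A \<Longrightarrow> permute A \<pi> \<xi> t = \<xi> (\<pi> t)"
  by (simp add: permute_def)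

lemma permute_linear:
  "permute A \<pi> (\<xi> + \<eta>) = permute A \<pi> \<xi> + permute A \<pi> \<eta>"
  "permute A \<pi> (\<xi> - \<eta>) = permute A \<pi> \<xi> - permute A \<pi> \<eta>"
  "permute A \<pi> (scale_vec c \<xi>) = scale_vec c (permute A \<pi> \<xi>)"
  "permute A \<pi> 0 = 0"
  by (auto simp: permute_def fun_eq_iff vec_apply)

lemma permute_permute:
  assumes "\<And>t. t \<in> A \<Longrightarrow> \<pi> t \<in> A"
  shows "permute A \<pi> (permute A \<sigma> \<xi>) = permute A (\<lambda>t. \<sigma> (\<pi> t)) \<xi>"
  using assms by (auto simp: permute_def)

lemma permute_cong: "(\<And>t. t \<in> A \<Longrightarrow> \<pi> t = \<sigma> t) \<Longrightarrow> permute A \<pi> = permute A \<sigma>"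
  by (auto simp: permute_def fun_eq_iff)

lemma permute_id: "\<xi> \<in> ell2 A \<Longrightarrow> permute A (\<lambda>t. t) \<xi> = \<xi>"
  by (auto simp: permute_def fun_eq_iff ell2_off)

context
  fixes A :: "'a set" and \<pi>
  assumes bij: "bij_betw \<pi> A A"
begin

lemma permute_ell2:
  assumes "\<xi> \<in> ell2 A" shows "permute A \<pi> \<xi> \<in> ell2 A"
proof -
  have "(\<lambda>s. (cmod (\<xi> (\<pi> s)))\<^sup>2) summable_on A"
    using summable_on_reindex_bij_betw[OF bij, of "\<lambda>s. (cmod (\<xi> s))\<^sup>2"] ell2_summable[OF assms] by simp
  then have "(\<lambda>s. (cmod (permute A \<pi> \<xi> s))\<^sup>2) summable_on A"
    by (rule summable_on_cong[THEN iffD1, rotated]) simp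
  then show ?thesis by (simp add: ell2_iff permute_def)
qed

lemma permute_inner: "ell2_inner A (permute A \<pi> \<xi>) (permute A \<pi> \<eta>) = ell2_inner A \<xi> \<eta>"
proof -
  have "ell2_inner A (permute A \<pi> \<xi>) (permute A \<pi> \<eta>) = (\<Sum>\<^sub>\<infinity>s\<in>A. \<xi> (\<pi> s) * cnj (\<eta> (\<pi> s)))"
    unfolding ell2_inner_def by (intro infsum_cong) simp
  then show ?thesis
    using infsum_reindex_bij_betw[OF bij, of "\<lambda>s. \<xi> s * cnj (\<eta> s)"] by (simp add: ell2_inner_def)
qed

lemma permute_norm: "ell2_norm A (permute A \<pi> \<xi>) = ell2_norm A \<xi>"
proof -
  have "(\<Sum>\<^sub>\<infinity>s\<in>A. (cmod (permute A \<pi> \<xi> s))\<^sup>2) = (\<Sum>\<^sub>\<infinity>s\<in>A. (cmod (\<xi> (\<pi> s)))\<^sup>2)"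
    by (intro infsum_cong) simp
  then show ?thesis
    using infsum_reindex_bij_betw[OF bij, of "\<lambda>s. (cmod (\<xi> s))\<^sup>2"] by (simp add: ell2_norm_def)
qed

end

text \<open>Finite direct sums of copies of \<open>ell2 A\<close> are realised as
  \<open>ell2 (I \<times> A)\<close>, so that every Hilbert space lemma applies to them
  unchanged.\<close>

definition family :: "'i set \<Rightarrow> ('i \<Rightarrow> 'a \<Rightarrow> complex) \<Rightarrow> ('i \<times> 'a \<Rightarrow> complex)" where
  "family I v = (\<lambda>(i, t). if i \<in> I then v i t else 0)"

definition component :: "('i \<times> 'a \<Rightarrow> complex) \<Rightarrow> 'i \<Rightarrow> 'a \<Rightarrow> complex" where
  "component u i = (\<lambda>t. u (i, t))"

lemma family_apply [simp]: "i \<in> I \<Longrightarrow> family I v (i, t) = v i t"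
  by (simp add: family_def)

lemma component_family [simp]: "i \<in> I \<Longrightarrow> component (family I v) i = v i"
  by (simp add: component_def)

lemma component_linear:
  "component (u + w) i = component u i + component w i"
  "component (u - w) i = component u i - component w i"
  "component (scale_vec c u) i = scale_vec c (component u i)"
  by (auto simp: component_def fun_eq_iff vec_apply)

lemma family_linear:
  "family I (\<lambda>i. v i + w i) = family I v + family I w"
  "family I (\<lambda>i. v i - w i) = family I v - family I w"
  "family I (\<lambda>i. scale_vec c (v i)) = scale_vec c (family I v)"
  by (auto simp: family_def fun_eq_iff vec_apply)

lemma family_cong: "(\<And>i. i \<in> I \<Longrightarrow> v i = w i) \<Longrightarrow> family I v = family I w"
  by (auto simp: family_def fun_eq_iff)

lemma component_ell2:
  assumes "u \<in> ell2 (I \<times> A)" shows "component u i \<in> ell2 A"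
proof (rule ell2_boundI(1)[where K = "ell2_norm (I \<times> A) u"])
  fix F assume F: "finite F" "F \<subseteq> A"
  show "(\<Sum>s\<in>F. (cmod (component u i s))\<^sup>2) \<le> (ell2_norm (I \<times> A) u)\<^sup>2"
  proof (cases "i \<in> I")
    case True
    have "(\<Sum>s\<in>F. (cmod (component u i s))\<^sup>2) = (\<Sum>p\<in>Pair i ` F. (cmod (u p))\<^sup>2)"
      by (subst sum.reindex) (auto simp: inj_on_def component_def)
    also have "\<dots> \<le> (ell2_norm (I \<times> A) u)\<^sup>2"
      using assms F True by (intro ell2_finite_sum_le) auto
    finally show ?thesis .
  qed (use ell2_off[OF assms] in \<open>simp add: component_def\<close>)
qed (use ell2_off[OF assms] in \<open>auto simp: component_def\<close>)

context
  fixes I :: "'i set"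
  assumes I: "finite I"
begin

lemma family_ell2:
  assumes v: "\<And>i. i \<in> I \<Longrightarrow> v i \<in> ell2 A"
  shows "family I v \<in> ell2 (I \<times> A)"
proof (rule ell2_boundI(1)[where K = "sqrt (\<Sum>i\<in>I. (ell2_norm A (v i))\<^sup>2)"])
  fix F assume F: "finite F" "F \<subseteq> I \<times> A"
  have "(\<Sum>p\<in>F. (cmod (family I v p))\<^sup>2) \<le> (\<Sum>p\<in>I \<times> snd ` F. (cmod (family I v p))\<^sup>2)"
    using F I by (intro sum_mono2) (auto simp: image_iff, metis snd_conv)
  also have "\<dots> = (\<Sum>i\<in>I. \<Sum>t\<in>snd ` F. (cmod (v i t))\<^sup>2)"
    by (subst sum.cartesian_product) (auto intro!: sum.cong)
  also have "\<dots> \<le> (\<Sum>i\<in>I. (ell2_norm A (v i))\<^sup>2)"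
    using F v by (intro sum_mono ell2_finite_sum_le) auto
  finally show "(\<Sum>p\<in>F. (cmod (family I v p))\<^sup>2) \<le> (sqrt (\<Sum>i\<in>I. (ell2_norm A (v i))\<^sup>2))\<^sup>2"
    by (simp add: sum_nonneg)
next
  fix p assume "p \<notin> I \<times> A"
  then show "family I v p = 0" using ell2_off[OF v] by (cases p) (auto simp: family_def)
qed (simp add: sum_nonneg)

lemma ell2_inner_components:
  assumes "u \<in> ell2 (I \<times> A)" "w \<in> ell2 (I \<times> A)"
  shows "ell2_inner (I \<times> A) u w = (\<Sum>i\<in>I. ell2_inner A (component u i) (component w i))"
proof -
  have "(\<lambda>(i, t). u (i, t) * cnj (w (i, t))) summable_on (I \<times> A)"
    using ell2_inner_summable[OF assms] by (simp add: case_prod_unfold)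
  then have "infsum (\<lambda>(i, t). u (i, t) * cnj (w (i, t))) (I \<times> A)
     = (\<Sum>\<^sub>\<infinity>i\<in>I. \<Sum>\<^sub>\<infinity>t\<in>A. u (i, t) * cnj (w (i, t)))"
    by (intro infsum_Sigma'_banach[symmetric])
  then show ?thesis using I by (simp add: ell2_inner_def component_def case_prod_unfold)
qed

lemma ell2_norm_components:
  assumes "u \<in> ell2 (I \<times> A)"
  shows "(ell2_norm (I \<times> A) u)\<^sup>2 = (\<Sum>i\<in>I. (ell2_norm A (component u i))\<^sup>2)"
proof -
  have "complex_of_real ((ell2_norm (I \<times> A) u)\<^sup>2) = (\<Sum>i\<in>I. of_real ((ell2_norm A (component u i))\<^sup>2))"
    using ell2_inner_components[OF assms assms] ell2_inner_self[OF assms]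
      ell2_inner_self[OF component_ell2[OF assms]] by simp
  then show ?thesis by (metis of_real_eq_iff of_real_sum)
qed

text \<open>The operator 1 tensor \<open>T\<close>, the device by which one operator is tested on
  several vectors at once.\<close>

definition amplify :: "'a set \<Rightarrow> 'a oper \<Rightarrow> ('i \<times> 'a) oper" where
  "amplify A T = (\<lambda>u\<in>ell2 (I \<times> A). family I (\<lambda>i. T (component u i)))"

lemma amplify_bounded:
  assumes T: "T \<in> bounded_ops A"
  shows "amplify A T \<in> bounded_ops (I \<times> A)"
proof -
  obtain K where K: "K \<ge> 0" "\<And>\<xi>. \<xi> \<in> ell2 A \<Longrightarrow> ell2_norm A (T \<xi>) \<le> K * ell2_norm A \<xi>"
    using bounded_ops_bound[OF T] by blast
  show ?thesis
    unfolding amplify_def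
  proof (rule bounded_opsI[where K = K])
    fix u assume u: "u \<in> ell2 (I \<times> A)"
    show f: "family I (\<lambda>i. T (component u i)) \<in> ell2 (I \<times> A)"
      using u by (intro family_ell2 bounded_opsD(1)[OF T] component_ell2)
    show "ell2_norm (I \<times> A) (family I (\<lambda>i. T (component u i))) \<le> K * ell2_norm (I \<times> A) u"
    proof (rule power2_le_imp_le)
      have "(ell2_norm (I \<times> A) (family I (\<lambda>i. T (component u i))))\<^sup>2 = (\<Sum>i\<in>I. (ell2_norm A (T (component u i)))\<^sup>2)"
        by (simp add: ell2_norm_components[OF f])
      also have "\<dots> \<le> (\<Sum>i\<in>I. (K * ell2_norm A (component u i))\<^sup>2)"
        using u by (intro sum_mono power_mono K component_ell2) auto
      also have "\<dots> = (K * ell2_norm (I \<times> A) u)\<^sup>2"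
        by (simp add: power_mult_distrib ell2_norm_components[OF u] sum_distrib_left)
      finally show "(ell2_norm (I \<times> A) (family I (\<lambda>i. T (component u i))))\<^sup>2 \<le> (K * ell2_norm (I \<times> A) u)\<^sup>2" .
    qed (use K in simp)
  next
    fix u w assume "u \<in> ell2 (I \<times> A)" "w \<in> ell2 (I \<times> A)"
    then show "family I (\<lambda>i. T (component (u + w) i)) = family I (\<lambda>i. T (component u i)) + family I (\<lambda>i. T (component w i))"
      by (simp add: component_linear bounded_opsD(2)[OF T] component_ell2 family_linear)
  next
    fix c u assume "u \<in> ell2 (I \<times> A)"
    then show "family I (\<lambda>i. T (component (scale_vec c u) i)) = scale_vec c (family I (\<lambda>i. T (component u i)))"
      by (simp add: component_linear bounded_opsD(3)[OF T] component_ell2 family_linear)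
  qed
qed

lemma amplify_component:
  "u \<in> ell2 (I \<times> A) \<Longrightarrow> i \<in> I \<Longrightarrow> component (amplify A T u) i = T (component u i)"
  by (simp add: amplify_def)

end

lemma component_delta:
  "component (delta (i, t)) j = (if j = i then delta t else 0)"
  by (auto simp: component_def delta_def fun_eq_iff vec_apply)


section \<open>The weak operator topology\<close>

text \<open>A basic neighbourhood of the product topology restricts finitely many matrix
  coefficients. Later arguments use the weak operator topology only in this form.\<close>

lemma wot_closure_iff:
  assumes S: "S \<subseteq> bounded_ops A"
  shows "T \<in> wot A closure_of S \<longleftrightarrow> T \<in> bounded_ops A \<and>
    (\<forall>P \<epsilon>. finite P \<and> P \<subseteq> ell2 A \<times> ell2 A \<and> \<epsilon> > 0 \<longrightarrow>
      (\<exists>R\<in>S. \<forall>(\<xi>, \<eta>)\<in>P. cmod (ell2_inner A (T \<xi>) \<eta> - ell2_inner A (R \<xi>) \<eta>) < \<epsilon>))"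
    (is "_ \<longleftrightarrow> _ \<and> ?approx")
proof -
  define Q where "Q = ell2 A \<times> ell2 A"
  define f where "f = (\<lambda>T::'a oper. \<lambda>(\<xi>, \<eta>)\<in>Q. ell2_inner A (T \<xi>) \<eta>)"
  have fapp: "f R (\<xi>, \<eta>) = ell2_inner A (R \<xi>) \<eta>" if "(\<xi>, \<eta>) \<in> Q" for R \<xi> \<eta>
    using that by (simp add: f_def)
  have wot: "wot A = pullback_topology (bounded_ops A) f (product_topology (\<lambda>_. euclidean) Q)"
    by (simp add: wot_def f_def Q_def)
  have top: "topspace (wot A) = bounded_ops A"
    by (auto simp: wot topspace_pullback_topology f_def)
  show ?thesis
  proof
    assume T: "T \<in> wot A closure_of S"
    then have Tb: "T \<in> bounded_ops A" using closure_of_subset_topspace[of "wot A" S] top by auto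
    have cl: "\<exists>y. y \<in> S \<and> y \<in> O'" if "T \<in> O'" "openin (wot A) O'" for O'
      using T that by (simp add: in_closure_of)
    have ?approx
    proof (intro allI impI)
      fix P :: "(('a \<Rightarrow> complex) \<times> ('a \<Rightarrow> complex)) set" and \<epsilon> :: real
      assume P: "finite P \<and> P \<subseteq> ell2 A \<times> ell2 A \<and> \<epsilon> > 0"
      define B where "B p = (if p \<in> P then ball (f T p) \<epsilon> else UNIV)" for p
      have "{p \<in> Q. B p \<noteq> UNIV} \<subseteq> P" by (auto simp: B_def)
      then have "finite {p \<in> Q. B p \<noteq> UNIV}" using P finite_subset by blast
      then have "openin (product_topology (\<lambda>_. euclidean) Q) (PiE Q B)"
        by (auto simp: openin_PiE_gen B_def)
      then have "openin (wot A) (f -` PiE Q B \<inter> bounded_ops A)"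
        unfolding wot openin_pullback_topology by (intro exI[of _ "PiE Q B"]) simp
      moreover have "T \<in> f -` PiE Q B \<inter> bounded_ops A"
        using Tb P by (auto simp: f_def B_def)
      ultimately obtain R where R: "R \<in> S" "R \<in> f -` PiE Q B"
        using cl[of "f -` PiE Q B \<inter> bounded_ops A"] by auto
      have "cmod (ell2_inner A (T \<xi>) \<eta> - ell2_inner A (R \<xi>) \<eta>) < \<epsilon>" if "(\<xi>, \<eta>) \<in> P" for \<xi> \<eta>
      proof -
        have q: "(\<xi>, \<eta>) \<in> Q" using that P by (auto simp: Q_def)
        then have "f R (\<xi>, \<eta>) \<in> B (\<xi>, \<eta>)" using R by (auto simp: PiE_iff)
        then show ?thesis using that fapp[OF q] by (simp add: B_def dist_norm)
      qed
      then show "\<exists>R\<in>S. \<forall>(\<xi>, \<eta>)\<in>P. cmod (ell2_inner A (T \<xi>) \<eta> - ell2_inner A (R \<xi>) \<eta>) < \<epsilon>"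
        using R by blast
    qed
    with Tb show "T \<in> bounded_ops A \<and> ?approx" by blast
  next
    assume *: "T \<in> bounded_ops A \<and> ?approx"
    show "T \<in> wot A closure_of S"
      unfolding in_closure_of top
    proof (intro conjI allI impI)
      fix O' assume O': "T \<in> O' \<and> openin (wot A) O'"
      then have "\<exists>V. openin (product_topology (\<lambda>_. euclidean) Q) V \<and> O' = f -` V \<inter> bounded_ops A"
        by (simp add: wot openin_pullback_topology)
      then obtain V where V: "openin (product_topology (\<lambda>_. euclidean) Q) V" "O' = f -` V \<inter> bounded_ops A"
        by auto
      have "f T \<in> V" using O' V(2) by auto
      then have "\<exists>U. finite {p \<in> Q. U p \<noteq> topspace euclidean} \<and> (\<forall>p\<in>Q. openin euclidean (U p)) \<and>
          f T \<in> PiE Q U \<and> PiE Q U \<subseteq> V"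
        using V(1)[unfolded openin_product_topology_alt] by simp
      then obtain U where U: "finite {p \<in> Q. U p \<noteq> topspace euclidean}" "\<forall>p\<in>Q. openin euclidean (U p)"
        "f T \<in> PiE Q U" "PiE Q U \<subseteq> V"
        by auto
      define P where "P = {p \<in> Q. U p \<noteq> UNIV}"
      have fin: "finite P" using U(1) by (simp add: P_def)
      have "\<exists>e>0. ball (f T p) e \<subseteq> U p" if "p \<in> P" for p
        using U(2,3) that by (auto simp: P_def PiE_iff open_contains_ball)
      then obtain e where e: "\<And>p. p \<in> P \<Longrightarrow> e p > 0" "\<And>p. p \<in> P \<Longrightarrow> ball (f T p) (e p) \<subseteq> U p"
        by metis
      \<comment> \<open>Inserting 1 keeps the minimum meaningful when no coordinate is
        restricted.\<close>
      define \<epsilon> where "\<epsilon> = Min (insert 1 (e ` P))"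
      have "\<epsilon> > 0" using e fin by (simp add: \<epsilon>_def)
      have \<epsilon>_le: "\<epsilon> \<le> e p" if "p \<in> P" for p using that fin by (simp add: \<epsilon>_def)
      have "P \<subseteq> ell2 A \<times> ell2 A" by (auto simp: P_def Q_def)
      then obtain R where R: "R \<in> S" "\<forall>(\<xi>, \<eta>)\<in>P. cmod (ell2_inner A (T \<xi>) \<eta> - ell2_inner A (R \<xi>) \<eta>) < \<epsilon>"
        using conjunct2[OF *, rule_format, of P \<epsilon>] fin \<open>\<epsilon> > 0\<close> by auto
      have "f R p \<in> U p" if "p \<in> Q" for p
      proof (cases "p \<in> P")
        case True
        obtain \<xi> \<eta> where p: "p = (\<xi>, \<eta>)" by (cases p)
        have "dist (f T p) (f R p) < e p"
          using R(2) True \<epsilon>_le[OF True] fapp \<open>p \<in> Q\<close> by (auto simp: p dist_norm)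
        then show ?thesis using e(2)[OF True] by (auto simp: subset_iff)
      qed (use that in \<open>auto simp: P_def\<close>)
      then have "f R \<in> PiE Q U" by (auto simp: PiE_iff f_def)
      then have "R \<in> O'" using R(1) S V(2) U(4) by auto
      with R(1) show "\<exists>y. y \<in> S \<and> y \<in> O'" by auto
    qed (use * in simp)
  qed
qed

section \<open>The group von Neumann algebra as a commutant\<close>

lemma delta_apply: "delta t s = (if s = t then 1 else 0)"
  by (simp add: delta_def)

context group
begin

abbreviation L2 where "L2 \<equiv> ell2 (carrier G)"
abbreviation ip where "ip \<equiv> ell2_inner (carrier G)"
abbreviation nrm where "nrm \<equiv> ell2_norm (carrier G)"
abbreviation lam where "lam \<equiv> left_reg G"

text \<open>The right regular representation: \<open>delta t\<close> is sent to
  \<open>delta (t \<otimes> inv s)\<close>, which makes \<open>rtr\<close> multiplicative in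
  \<open>s\<close> and lets it commute with \<open>lam\<close>.\<close>

definition rtr :: "'a \<Rightarrow> ('a \<Rightarrow> complex) \<Rightarrow> ('a \<Rightarrow> complex)" where
  "rtr s = permute (carrier G) (\<lambda>t. t \<otimes> s)"

lemma bij_left: "s \<in> carrier G \<Longrightarrow> bij_betw (\<lambda>t. s \<otimes> t) (carrier G) (carrier G)"
  by (rule bij_betwI[where g = "\<lambda>t. inv s \<otimes> t"]) (auto simp: m_assoc[symmetric])

lemma bij_right: "s \<in> carrier G \<Longrightarrow> bij_betw (\<lambda>t. t \<otimes> s) (carrier G) (carrier G)"
  by (rule bij_betwI[where g = "\<lambda>t. t \<otimes> inv s"]) (auto simp: m_assoc)

lemma bij_inv: "bij_betw (\<lambda>t. inv t) (carrier G) (carrier G)"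
  by (rule bij_betwI[where g = "\<lambda>t. inv t"]) auto

lemma lam_eq: "\<xi> \<in> L2 \<Longrightarrow> lam s \<xi> = permute (carrier G) (\<lambda>t. inv s \<otimes> t) \<xi>"
  by (simp add: left_reg_def permute_def)

lemma lam_apply: "\<xi> \<in> L2 \<Longrightarrow> t \<in> carrier G \<Longrightarrow> lam s \<xi> t = \<xi> (inv s \<otimes> t)"
  by (simp add: left_reg_def)

lemma rtr_apply: "t \<in> carrier G \<Longrightarrow> rtr s \<xi> t = \<xi> (t \<otimes> s)"
  by (simp add: rtr_def)

lemma rtr_linear:
  "rtr s (\<xi> + \<eta>) = rtr s \<xi> + rtr s \<eta>"
  "rtr s (\<xi> - \<eta>) = rtr s \<xi> - rtr s \<eta>"
  "rtr s (scale_vec c \<xi>) = scale_vec c (rtr s \<xi>)"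
  by (auto simp: rtr_def permute_linear)

lemma rtr_sum: "rtr s (\<Sum>i\<in>I. f i) = (\<Sum>i\<in>I. rtr s (f i))"
  by (induction I rule: infinite_finite_induct) (auto simp: rtr_linear rtr_def permute_linear)

lemma L2_eqI:
  assumes "\<xi> \<in> L2" "\<eta> \<in> L2" "\<And>t. t \<in> carrier G \<Longrightarrow> \<xi> t = \<eta> t"
  shows "\<xi> = \<eta>"
  using assms ell2_off[OF assms(1)] ell2_off[OF assms(2)] by (metis ext)

lemma lam_ell2: "s \<in> carrier G \<Longrightarrow> \<xi> \<in> L2 \<Longrightarrow> lam s \<xi> \<in> L2"
  by (simp add: lam_eq permute_ell2 bij_left)

lemma lam_bounded:
  assumes "s \<in> carrier G" shows "lam s \<in> bounded_ops (carrier G)"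
proof -
  have "(\<lambda>\<xi>\<in>L2. permute (carrier G) (\<lambda>t. inv s \<otimes> t) \<xi>) \<in> bounded_ops (carrier G)"
    by (rule bounded_opsI[where K = 1])
      (use assms in \<open>auto simp: permute_linear permute_ell2 permute_norm bij_left\<close>)
  moreover have "lam s = (\<lambda>\<xi>\<in>L2. permute (carrier G) (\<lambda>t. inv s \<otimes> t) \<xi>)"
    by (auto simp: left_reg_def permute_def restrict_def)
  ultimately show ?thesis by simp
qed

lemma lam_mult:
  assumes "s \<in> carrier G" "t \<in> carrier G" "\<xi> \<in> L2"
  shows "lam s (lam t \<xi>) = lam (s \<otimes> t) \<xi>"
  by (rule L2_eqI) (use assms in \<open>auto simp: lam_apply lam_ell2 inv_mult_group m_assoc\<close>)

lemma lam_one: "\<xi> \<in> L2 \<Longrightarrow> lam \<one> \<xi> = \<xi>"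
  by (rule L2_eqI) (auto simp: lam_apply lam_ell2)

lemma lam_inv:
  assumes "s \<in> carrier G" "\<xi> \<in> L2"
  shows "lam (inv s) (lam s \<xi>) = \<xi>" "lam s (lam (inv s) \<xi>) = \<xi>"
  using assms by (simp_all add: lam_mult lam_one)

lemma lam_inner: "s \<in> carrier G \<Longrightarrow> \<xi> \<in> L2 \<Longrightarrow> \<eta> \<in> L2 \<Longrightarrow> ip (lam s \<xi>) (lam s \<eta>) = ip \<xi> \<eta>"
  by (simp add: lam_eq permute_inner bij_left)

lemma lam_norm: "s \<in> carrier G \<Longrightarrow> \<xi> \<in> L2 \<Longrightarrow> nrm (lam s \<xi>) = nrm \<xi>"
  by (simp add: lam_eq permute_norm bij_left)

lemma lam_adj:
  assumes "s \<in> carrier G" "\<xi> \<in> L2" "\<eta> \<in> L2"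
  shows "ip (lam s \<xi>) \<eta> = ip \<xi> (lam (inv s) \<eta>)"
  using lam_inner[OF assms(1,2), of "lam (inv s) \<eta>"] assms by (simp add: lam_inv lam_ell2)

lemma lam_adjoint: "s \<in> carrier G \<Longrightarrow> adjoint_op (carrier G) (lam s) = lam (inv s)"
  by (rule adjoint_op_eqI) (auto simp: lam_bounded lam_adj)

lemma lam_delta: "s \<in> carrier G \<Longrightarrow> t \<in> carrier G \<Longrightarrow> lam s (delta t) = delta (s \<otimes> t)"
  by (rule L2_eqI) (auto simp: lam_apply lam_ell2 delta_ell2 delta_apply m_assoc[symmetric])

lemma rtr_ell2: "s \<in> carrier G \<Longrightarrow> \<xi> \<in> L2 \<Longrightarrow> rtr s \<xi> \<in> L2"
  by (simp add: rtr_def permute_ell2 bij_right)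

lemma rtr_mult:
  assumes "s \<in> carrier G" "t \<in> carrier G" "\<xi> \<in> L2"
  shows "rtr s (rtr t \<xi>) = rtr (s \<otimes> t) \<xi>"
  by (rule L2_eqI) (use assms in \<open>auto simp: rtr_apply rtr_ell2 m_assoc\<close>)

lemma rtr_one: "\<xi> \<in> L2 \<Longrightarrow> rtr \<one> \<xi> = \<xi>"
  by (rule L2_eqI) (auto simp: rtr_apply rtr_ell2)

lemma rtr_inner: "s \<in> carrier G \<Longrightarrow> ip (rtr s \<xi>) (rtr s \<eta>) = ip \<xi> \<eta>"
  by (simp add: rtr_def permute_inner bij_right)

lemma rtr_norm: "s \<in> carrier G \<Longrightarrow> nrm (rtr s \<xi>) = nrm \<xi>"
  by (simp add: rtr_def permute_norm bij_right)

lemma rtr_adj: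
  assumes "s \<in> carrier G" "\<xi> \<in> L2" "\<eta> \<in> L2"
  shows "ip (rtr s \<xi>) \<eta> = ip \<xi> (rtr (inv s) \<eta>)"
  using rtr_inner[OF assms(1), of \<xi> "rtr (inv s) \<eta>"] assms by (simp add: rtr_mult rtr_one)

lemma rtr_delta: "s \<in> carrier G \<Longrightarrow> t \<in> carrier G \<Longrightarrow> rtr s (delta t) = delta (t \<otimes> inv s)"
  by (rule L2_eqI) (auto simp: rtr_apply rtr_ell2 delta_ell2 delta_apply m_assoc)

lemma lam_rtr:
  assumes "s \<in> carrier G" "t \<in> carrier G" "\<xi> \<in> L2"
  shows "lam s (rtr t \<xi>) = rtr t (lam s \<xi>)"
  by (rule L2_eqI) (use assms in \<open>auto simp: rtr_apply rtr_ell2 lam_apply lam_ell2 m_assoc\<close>)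

text \<open>The commutant of the right regular representation, the working form of L(\<Gamma>):
  membership is an algebraic condition, whereas \<open>group_vna\<close> asks for approximation. The
  two agree by \<open>group_vna_eq\<close>.\<close>

definition right_comm :: "'a oper set" where
  "right_comm = {T \<in> bounded_ops (carrier G). \<forall>s\<in>carrier G. \<forall>\<xi>\<in>L2. T (rtr s \<xi>) = rtr s (T \<xi>)}"

lemma right_commD:
  assumes "T \<in> right_comm"
  shows "T \<in> bounded_ops (carrier G)"
    "s \<in> carrier G \<Longrightarrow> \<xi> \<in> L2 \<Longrightarrow> T (rtr s \<xi>) = rtr s (T \<xi>)"
    "\<xi> \<in> L2 \<Longrightarrow> T \<xi> \<in> L2"
  using assms bounded_opsD(1)[of T] by (auto simp: right_comm_def)

lemma right_commI:
  "T \<in> bounded_ops (carrier G) \<Longrightarrow>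
   (\<And>s \<xi>. s \<in> carrier G \<Longrightarrow> \<xi> \<in> L2 \<Longrightarrow> T (rtr s \<xi>) = rtr s (T \<xi>)) \<Longrightarrow> T \<in> right_comm"
  by (auto simp: right_comm_def)

lemma right_comm_lam: "s \<in> carrier G \<Longrightarrow> lam s \<in> right_comm"
  by (auto intro!: right_commI lam_bounded simp: lam_rtr)

lemma right_comm_id: "op_id (carrier G) \<in> right_comm"
  by (auto intro!: right_commI simp: rtr_ell2)

lemma right_comm_mult:
  assumes S: "S \<in> right_comm" and T: "T \<in> right_comm"
  shows "op_mult (carrier G) S T \<in> right_comm"
  by (rule right_commI)
    (auto simp: right_commD[OF S] right_commD[OF T] rtr_ell2 intro!: op_mult_bounded)

lemma right_comm_add:
  assumes S: "S \<in> right_comm" and T: "T \<in> right_comm"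
  shows "op_add (carrier G) S T \<in> right_comm"
  by (rule right_commI)
    (auto simp: right_commD[OF S] right_commD[OF T] rtr_ell2 rtr_linear intro!: op_add_bounded)

lemma right_comm_scale:
  assumes T: "T \<in> right_comm"
  shows "op_scale (carrier G) c T \<in> right_comm"
  by (rule right_commI)
    (auto simp: right_commD[OF T] rtr_ell2 rtr_linear intro!: op_scale_bounded)

lemma right_comm_adjoint:
  assumes T: "T \<in> right_comm"
  shows "adjoint_op (carrier G) T \<in> right_comm"
proof (rule right_commI)
  note Tb = right_commD(1)[OF T]
  note Ta = bounded_opsD(1)[OF adjoint_op_bounded[OF Tb]]
  show "adjoint_op (carrier G) T \<in> bounded_ops (carrier G)" using Tb by (rule adjoint_op_bounded)
  fix s \<xi> assume *: "s \<in> carrier G" "\<xi> \<in> L2"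
  show "adjoint_op (carrier G) T (rtr s \<xi>) = rtr s (adjoint_op (carrier G) T \<xi>)"
  proof (rule ell2_inner_ext)
    fix \<zeta> assume \<zeta>: "\<zeta> \<in> L2"
    have "ip \<zeta> (adjoint_op (carrier G) T (rtr s \<xi>)) = ip (T \<zeta>) (rtr s \<xi>)"
      using * \<zeta> by (simp add: adjoint_op_inner[OF Tb] rtr_ell2)
    also have "\<dots> = ip (rtr (inv s) (T \<zeta>)) \<xi>"
      using * \<zeta> by (simp add: rtr_adj right_commD(3)[OF T])
    also have "\<dots> = ip (T (rtr (inv s) \<zeta>)) \<xi>" using * \<zeta> by (simp add: right_commD[OF T])
    also have "\<dots> = ip (rtr (inv s) \<zeta>) (adjoint_op (carrier G) T \<xi>)"
      using * \<zeta> by (simp add: adjoint_op_inner[OF Tb] rtr_ell2)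
    also have "\<dots> = ip \<zeta> (rtr s (adjoint_op (carrier G) T \<xi>))"
      using * \<zeta> Ta by (simp add: rtr_adj)
    finally show "ip \<zeta> (adjoint_op (carrier G) T (rtr s \<xi>)) = ip \<zeta> (rtr s (adjoint_op (carrier G) T \<xi>))" .
  qed (use * Ta in \<open>auto intro: rtr_ell2\<close>)
qed

lemma right_comm_coeff:
  assumes T: "T \<in> right_comm" and "t \<in> carrier G" "u \<in> carrier G"
  shows "T (delta t) u = T (delta \<one>) (u \<otimes> inv t)"
proof -
  have "delta t = rtr (inv t) (delta \<one>)" using assms by (simp add: rtr_delta)
  then have "T (delta t) = rtr (inv t) (T (delta \<one>))"
    using assms by (simp add: right_commD(2)[OF T] delta_ell2)
  then show ?thesis using assms by (simp add: rtr_apply)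
qed

text \<open>Commuting with right translations makes \<open>T\<close> the left convolution by
  \<open>T (delta \<one>)\<close>. The sum converges because it is the inner product of \<xi> with
  the adjoint at \<open>delta u\<close>.\<close>

lemma right_comm_conv:
  assumes T: "T \<in> right_comm" and \<xi>: "\<xi> \<in> L2" and u: "u \<in> carrier G"
  shows "T \<xi> u = (\<Sum>\<^sub>\<infinity>v\<in>carrier G. \<xi> v * T (delta \<one>) (u \<otimes> inv v))"
proof -
  note Tb = right_commD(1)[OF T]
  have "T \<xi> u = ip \<xi> (adjoint_op (carrier G) T (delta u))"
    using adjoint_op_inner[OF Tb \<xi> delta_ell2[OF u]] u by (simp add: ell2_inner_delta)
  also have "\<dots> = (\<Sum>\<^sub>\<infinity>v\<in>carrier G. \<xi> v * T (delta \<one>) (u \<otimes> inv v))"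
    unfolding ell2_inner_def
  proof (intro infsum_cong)
    fix v assume v: "v \<in> carrier G"
    have "adjoint_op (carrier G) T (delta u) v = cnj (T (delta v) u)"
      using adjoint_op_inner'[OF Tb delta_ell2[OF u] delta_ell2[OF v]] u v by (simp add: ell2_inner_delta)
    then show "\<xi> v * cnj (adjoint_op (carrier G) T (delta u) v) = \<xi> v * T (delta \<one>) (u \<otimes> inv v)"
      using right_comm_coeff[OF T v u] by simp
  qed
  finally show ?thesis .
qed

lemma right_comm_eqI:
  assumes S: "S \<in> right_comm" and T: "T \<in> right_comm" and eq: "S (delta \<one>) = T (delta \<one>)"
  shows "S = T"
  by (rule bounded_ops_eqI[OF right_commD(1)[OF S] right_commD(1)[OF T]], rule L2_eqI)
    (auto simp: right_commD(3)[OF S] right_commD(3)[OF T] right_comm_conv[OF S] right_comm_conv[OF T] eq)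

text \<open>The value of \<open>T (delta \<one>)\<close> at \<open>\<one>\<close> is the trace of
  \<open>T\<close>. In the convolution formula the two orders of multiplication differ by replacing
  \<open>v\<close> with \<open>inv v\<close>.\<close>

lemma trace_commute:
  assumes S: "S \<in> right_comm" and T: "T \<in> right_comm"
  shows "S (T (delta \<one>)) \<one> = T (S (delta \<one>)) \<one>"
proof -
  have d: "delta \<one> \<in> L2" by (simp add: delta_ell2)
  have "S (T (delta \<one>)) \<one> = (\<Sum>\<^sub>\<infinity>v\<in>carrier G. T (delta \<one>) v * S (delta \<one>) (inv v))"
    by (subst right_comm_conv[OF S right_commD(3)[OF T d]]) (auto intro!: infsum_cong)
  also have "\<dots> = (\<Sum>\<^sub>\<infinity>v\<in>carrier G. T (delta \<one>) (inv v) * S (delta \<one>) (inv (inv v)))"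
    using infsum_reindex_bij_betw[OF bij_inv, of "\<lambda>v. T (delta \<one>) v * S (delta \<one>) (inv v)"] by simp
  also have "\<dots> = T (S (delta \<one>)) \<one>"
    by (subst right_comm_conv[OF T right_commD(3)[OF S d]]) (auto intro!: infsum_cong)
  finally show ?thesis .
qed

lemma left_reg_spanI:
  "finite F \<Longrightarrow> F \<subseteq> carrier G \<Longrightarrow> (\<lambda>\<xi>\<in>L2. \<Sum>s\<in>F. scale_vec (c s) (lam s \<xi>)) \<in> left_reg_span G"
  by (auto simp: left_reg_span_def)

lemma left_reg_span_right_comm: "left_reg_span G \<subseteq> right_comm"
proof
  fix R assume "R \<in> left_reg_span G"
  then obtain F c where F: "finite F" "F \<subseteq> carrier G"
    and R: "R = (\<lambda>\<xi>\<in>L2. \<Sum>s\<in>F. scale_vec (c s) (lam s \<xi>))"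
    by (auto simp: left_reg_span_def)
  have l: "lam s \<in> right_comm" if "s \<in> F" for s using that F right_comm_lam by auto
  show "R \<in> right_comm"
  proof (rule right_commI)
    show "R \<in> bounded_ops (carrier G)"
      unfolding R
    proof (rule bounded_opsI[where K = "\<Sum>s\<in>F. cmod (c s)"])
      fix \<xi> assume \<xi>: "\<xi> \<in> L2"
      have "nrm (\<Sum>s\<in>F. scale_vec (c s) (lam s \<xi>)) \<le> (\<Sum>s\<in>F. nrm (scale_vec (c s) (lam s \<xi>)))"
        using F \<xi> by (intro ell2_norm_sum_le ell2_scale lam_ell2) auto
      also have "\<dots> = (\<Sum>s\<in>F. cmod (c s) * nrm \<xi>)"
        using F \<xi> by (intro sum.cong) (auto simp: ell2_norm_scale lam_norm subset_iff)
      finally show "nrm (\<Sum>s\<in>F. scale_vec (c s) (lam s \<xi>)) \<le> (\<Sum>s\<in>F. cmod (c s)) * nrm \<xi>"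
        by (simp add: sum_distrib_right)
    next
      fix \<xi> assume "\<xi> \<in> L2"
      then show "(\<Sum>s\<in>F. scale_vec (c s) (lam s \<xi>)) \<in> L2"
        using F by (intro ell2_sum ell2_scale lam_ell2) auto
    next
      fix \<xi> \<eta> assume "\<xi> \<in> L2" "\<eta> \<in> L2"
      then show "(\<Sum>s\<in>F. scale_vec (c s) (lam s (\<xi> + \<eta>)))
          = (\<Sum>s\<in>F. scale_vec (c s) (lam s \<xi>)) + (\<Sum>s\<in>F. scale_vec (c s) (lam s \<eta>))"
        unfolding sum.distrib[symmetric]
        by (intro sum.cong refl)
          (simp add: bounded_opsD(2)[OF right_commD(1)[OF l]] scale_vec_distrib)
    next
      fix d \<xi> assume "\<xi> \<in> L2"
      then show "(\<Sum>s\<in>F. scale_vec (c s) (lam s (scale_vec d \<xi>))) = scale_vec d (\<Sum>s\<in>F. scale_vec (c s) (lam s \<xi>))"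
        by (simp add: fun_eq_iff vec_apply sum_fun_apply sum_distrib_left
            bounded_opsD(3)[OF right_commD(1)[OF l]] mult_ac)
    qed
    fix s \<xi> assume s: "s \<in> carrier G" "\<xi> \<in> L2"
    have "(\<Sum>t\<in>F. scale_vec (c t) (lam t (rtr s \<xi>))) = (\<Sum>t\<in>F. rtr s (scale_vec (c t) (lam t \<xi>)))"
      using F s by (intro sum.cong) (auto simp: lam_rtr rtr_linear subset_iff)
    then show "R (rtr s \<xi>) = rtr s (R \<xi>)" using s by (simp add: R rtr_ell2 rtr_sum)
  qed
qed

lemma left_reg_span_bounded: "left_reg_span G \<subseteq> bounded_ops (carrier G)"
  using left_reg_span_right_comm right_commD(1) by blast

text \<open>Commutation with \<open>rtr s\<close> is a weakly closed condition: for given \<xi> and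
  \<eta> it equates two matrix coefficients of the operator, and one approximant can match both at
  once.\<close>

lemma group_vna_subset: "group_vna G \<subseteq> right_comm"
proof
  fix T assume "T \<in> group_vna G"
  then have Tb: "T \<in> bounded_ops (carrier G)"
    and app: "\<And>P \<epsilon>. finite P \<Longrightarrow> P \<subseteq> L2 \<times> L2 \<Longrightarrow> \<epsilon> > (0::real) \<Longrightarrow>
      \<exists>R\<in>left_reg_span G. \<forall>(\<xi>, \<eta>)\<in>P. cmod (ip (T \<xi>) \<eta> - ip (R \<xi>) \<eta>) < \<epsilon>"
    unfolding group_vna_def wot_closure_iff[OF left_reg_span_bounded] by blast+
  note T = bounded_opsD(1)[OF Tb]
  show "T \<in> right_comm"
  proof (rule right_commI[OF Tb])
    fix s \<xi> assume s: "s \<in> carrier G" and \<xi>: "\<xi> \<in> L2"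
    show "T (rtr s \<xi>) = rtr s (T \<xi>)"
    proof (rule ell2_inner_ext)
      fix \<eta> assume \<eta>: "\<eta> \<in> L2"
      have "cmod (ip (T (rtr s \<xi>)) \<eta> - ip (rtr s (T \<xi>)) \<eta>) \<le> 0 + e" if e: "e > 0" for e
      proof -
        obtain R where R: "R \<in> left_reg_span G"
          "\<forall>(\<xi>', \<eta>')\<in>{(rtr s \<xi>, \<eta>), (\<xi>, rtr (inv s) \<eta>)}. cmod (ip (T \<xi>') \<eta>' - ip (R \<xi>') \<eta>') < e / 2"
          using app[of "{(rtr s \<xi>, \<eta>), (\<xi>, rtr (inv s) \<eta>)}" "e / 2"] s \<xi> \<eta> e by (auto simp: rtr_ell2)
        have Rc: "R \<in> right_comm" using R(1) left_reg_span_right_comm by blast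
        have "ip (R (rtr s \<xi>)) \<eta> = ip (R \<xi>) (rtr (inv s) \<eta>)"
          using s \<xi> \<eta> by (simp add: right_commD[OF Rc] rtr_adj)
        moreover have "ip (rtr s (T \<xi>)) \<eta> = ip (T \<xi>) (rtr (inv s) \<eta>)"
          using s \<xi> \<eta> T by (simp add: rtr_adj)
        ultimately have "ip (T (rtr s \<xi>)) \<eta> - ip (rtr s (T \<xi>)) \<eta> =
            (ip (T (rtr s \<xi>)) \<eta> - ip (R (rtr s \<xi>)) \<eta>) - (ip (T \<xi>) (rtr (inv s) \<eta>) - ip (R \<xi>) (rtr (inv s) \<eta>))"
          by simp
        also have "cmod \<dots> \<le> e / 2 + e / 2"
          by (rule order_trans[OF norm_triangle_ineq4], rule add_mono) (use R(2) in auto)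
        finally show ?thesis by simp
      qed
      then have "cmod (ip (T (rtr s \<xi>)) \<eta> - ip (rtr s (T \<xi>)) \<eta>) \<le> 0" by (rule field_le_epsilon)
      then have "ip (T (rtr s \<xi>)) \<eta> = ip (rtr s (T \<xi>)) \<eta>" by simp
      then show "ip \<eta> (T (rtr s \<xi>)) = ip \<eta> (rtr s (T \<xi>))"
        by (subst (1 2) ell2_inner_commute) simp
    qed (use s \<xi> T in \<open>auto intro: rtr_ell2\<close>)
  qed
qed

section \<open>Approximation by finite combinations of left translations\<close>

lemma left_reg_span_lam: "s \<in> carrier G \<Longrightarrow> \<exists>R\<in>left_reg_span G. \<forall>\<xi>\<in>L2. R \<xi> = lam s \<xi>"
  using left_reg_spanI[of "{s}" "\<lambda>_. 1"] by (intro bexI) auto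

lemma left_reg_span_add:
  assumes "R \<in> left_reg_span G" "S \<in> left_reg_span G"
  shows "\<exists>Q\<in>left_reg_span G. \<forall>\<xi>\<in>L2. Q \<xi> = R \<xi> + S \<xi>"
proof -
  obtain F c where F: "finite F" "F \<subseteq> carrier G"
    and R: "R = (\<lambda>\<xi>\<in>L2. \<Sum>s\<in>F. scale_vec (c s) (lam s \<xi>))"
    using assms by (auto simp: left_reg_span_def)
  obtain E d where E: "finite E" "E \<subseteq> carrier G"
    and S: "S = (\<lambda>\<xi>\<in>L2. \<Sum>s\<in>E. scale_vec (d s) (lam s \<xi>))"
    using assms by (auto simp: left_reg_span_def)
  define c' where "c' s = (if s \<in> F then c s else 0)" for s
  define d' where "d' s = (if s \<in> E then d s else 0)" for s
  have "(\<Sum>s\<in>F \<union> E. scale_vec (c' s + d' s) (lam s \<xi>)) =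
      (\<Sum>s\<in>F. scale_vec (c s) (lam s \<xi>)) + (\<Sum>s\<in>E. scale_vec (d s) (lam s \<xi>))" for \<xi>
  proof -
    have "(\<Sum>s\<in>F \<union> E. scale_vec (c' s + d' s) (lam s \<xi>)) =
        (\<Sum>s\<in>F \<union> E. scale_vec (c' s) (lam s \<xi>)) + (\<Sum>s\<in>F \<union> E. scale_vec (d' s) (lam s \<xi>))"
      unfolding sum.distrib[symmetric] by (intro sum.cong) (auto simp: fun_eq_iff vec_apply algebra_simps)
    also have "(\<Sum>s\<in>F \<union> E. scale_vec (c' s) (lam s \<xi>)) = (\<Sum>s\<in>F. scale_vec (c s) (lam s \<xi>))"
      using F E by (intro sum.mono_neutral_cong_right) (auto simp: c'_def)
    also have "(\<Sum>s\<in>F \<union> E. scale_vec (d' s) (lam s \<xi>)) = (\<Sum>s\<in>E. scale_vec (d s) (lam s \<xi>))"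
      using F E by (intro sum.mono_neutral_cong_right) (auto simp: d'_def)
    finally show ?thesis .
  qed
  then show ?thesis
    using left_reg_spanI[of "F \<union> E" "\<lambda>s. c' s + d' s"] F E by (intro bexI) (auto simp: R S)
qed

lemma left_reg_span_scale:
  assumes "R \<in> left_reg_span G"
  shows "\<exists>Q\<in>left_reg_span G. \<forall>\<xi>\<in>L2. Q \<xi> = scale_vec a (R \<xi>)"
proof -
  obtain F c where F: "finite F" "F \<subseteq> carrier G"
    and R: "R = (\<lambda>\<xi>\<in>L2. \<Sum>s\<in>F. scale_vec (c s) (lam s \<xi>))"
    using assms by (auto simp: left_reg_span_def)
  have "(\<Sum>s\<in>F. scale_vec (a * c s) (lam s \<xi>)) = scale_vec a (\<Sum>s\<in>F. scale_vec (c s) (lam s \<xi>))" for \<xi>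
    by (simp add: fun_eq_iff vec_apply sum_fun_apply sum_distrib_left mult.assoc)
  then show ?thesis
    using left_reg_spanI[OF F, of "\<lambda>s. a * c s"] by (intro bexI) (auto simp: R)
qed

lemma left_reg_span_translate:
  assumes "R \<in> left_reg_span G" "s \<in> carrier G"
  shows "\<exists>Q\<in>left_reg_span G. \<forall>\<xi>\<in>L2. Q \<xi> = lam s (R \<xi>)"
proof -
  obtain F c where F: "finite F" "F \<subseteq> carrier G"
    and R: "R = (\<lambda>\<xi>\<in>L2. \<Sum>s\<in>F. scale_vec (c s) (lam s \<xi>))"
    using assms by (auto simp: left_reg_span_def)
  have inj: "inj_on (\<lambda>t. s \<otimes> t) F" using F assms(2) by (auto intro!: inj_onI simp: subset_iff)
  have "(\<Sum>t\<in>(\<lambda>t. s \<otimes> t) ` F. scale_vec (c (inv s \<otimes> t)) (lam t \<xi>)) = lam s (\<Sum>t\<in>F. scale_vec (c t) (lam t \<xi>))"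
    if \<xi>: "\<xi> \<in> L2" for \<xi>
  proof -
    have "lam s (\<Sum>t\<in>F. scale_vec (c t) (lam t \<xi>)) = (\<Sum>t\<in>F. lam s (scale_vec (c t) (lam t \<xi>)))"
      using F \<xi> by (intro bounded_ops_sum[OF lam_bounded[OF assms(2)]] ell2_scale lam_ell2) auto
    also have "\<dots> = (\<Sum>t\<in>F. scale_vec (c t) (lam (s \<otimes> t) \<xi>))"
      using F \<xi> assms(2)
      by (intro sum.cong refl) (simp add: bounded_opsD(3)[OF lam_bounded] lam_ell2 lam_mult subset_iff)
    also have "\<dots> = (\<Sum>t\<in>(\<lambda>t. s \<otimes> t) ` F. scale_vec (c (inv s \<otimes> t)) (lam t \<xi>))"
      using F assms(2) by (subst sum.reindex[OF inj]) (auto intro!: sum.cong simp: m_assoc[symmetric] subset_iff)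
    finally show ?thesis by simp
  qed
  then show ?thesis
    using F assms(2) left_reg_spanI[of "(\<lambda>t. s \<otimes> t) ` F" "\<lambda>t. c (inv s \<otimes> t)"]
    by (intro bexI[where x = "\<lambda>\<xi>\<in>L2. \<Sum>t\<in>(\<lambda>t. s \<otimes> t) ` F. scale_vec (c (inv s \<otimes> t)) (lam t \<xi>)"])
      (auto simp: R)
qed

text \<open>The hypothesis \<open>P_lam\<close> makes \<open>P\<close> a matrix of right
  convolutions, while \<open>T\<close> is a left convolution. Left and right convolutions commute by
  associativity; the proof compares the matrix coefficients of the two composites.\<close>

lemma amplified_commutation:
  assumes T: "T \<in> right_comm" and I: "finite I"
    and P: "P \<in> bounded_ops (I \<times> carrier G)"
    and P_self: "\<And>u w. u \<in> ell2 (I \<times> carrier G) \<Longrightarrow> w \<in> ell2 (I \<times> carrier G) \<Longrightarrow>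
      ell2_inner (I \<times> carrier G) (P u) w = ell2_inner (I \<times> carrier G) u (P w)"
    and P_lam: "\<And>s i. s \<in> carrier G \<Longrightarrow> i \<in> I \<Longrightarrow>
      P (delta (i, s)) = permute (I \<times> carrier G) (\<lambda>(j, t). (j, inv s \<otimes> t)) (P (delta (i, \<one>)))"
    and u: "u \<in> ell2 (I \<times> carrier G)"
  shows "amplify I (carrier G) T (P u) = P (amplify I (carrier G) T u)"
proof -
  define B where "B = I \<times> carrier G"
  define f where "f = T (delta \<one>)"
  define p where "p i j v = P (delta (i, \<one>)) (j, v)" for i j v
  note Tb = right_commD(1)[OF T]
  note ab = amplify_bounded[OF I Tb, folded B_def]
  note P' = P[folded B_def] and self = P_self[folded B_def]
  have Pd: "P (delta (i, s)) (j, v) = p i j (inv s \<otimes> v)"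
    if "i \<in> I" "j \<in> I" "s \<in> carrier G" "v \<in> carrier G" for i j s v
    using P_lam[of s i] that by (simp add: p_def)
  have d: "delta (i, s) \<in> ell2 B" if "i \<in> I" "s \<in> carrier G" for i s
    using that by (intro delta_ell2) (simp add: B_def)
  have Pdc: "component (P (delta (i, s))) j \<in> L2" if "i \<in> I" "s \<in> carrier G" for i s j
    using bounded_opsD(1)[OF P' d[OF that]] unfolding B_def by (rule component_ell2)
  have "op_mult B (amplify I (carrier G) T) P = op_mult B P (amplify I (carrier G) T)"
  proof (rule bounded_ops_eq_delta[OF op_mult_bounded[OF ab P'] op_mult_bounded[OF P' ab]])
    fix x y assume x: "x \<in> B" and y: "y \<in> B"
    obtain i t where x': "x = (i, t)" and i: "i \<in> I" "t \<in> carrier G" using x by (auto simp: B_def)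
    obtain j w where y': "y = (j, w)" and j: "j \<in> I" "w \<in> carrier G" using y by (auto simp: B_def)
    have "op_mult B (amplify I (carrier G) T) P (delta x) y = T (component (P (delta (i, t))) j) w"
      using d[OF i] amplify_component[OF I, of "P (delta (i, t))" "carrier G" j T]
        bounded_opsD(1)[OF P' d[OF i]] j
      by (simp add: x' y' B_def component_def fun_eq_iff)
    also have "\<dots> = (\<Sum>\<^sub>\<infinity>v\<in>carrier G. component (P (delta (i, t))) j v * f (w \<otimes> inv v))"
      unfolding f_def by (rule right_comm_conv[OF T Pdc[OF i] j(2)])
    also have "\<dots> = (\<Sum>\<^sub>\<infinity>v\<in>carrier G. p i j (inv t \<otimes> v) * f (w \<otimes> inv v))"
      using i j by (intro infsum_cong) (simp add: component_def Pd)
    also have "\<dots> = (\<Sum>\<^sub>\<infinity>v\<in>carrier G. f (v \<otimes> inv t) * p i j (inv v \<otimes> w))"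
    proof -
      \<comment> \<open>This substitution turns the argument \<open>w \<otimes> inv v\<close> of
        \<open>f\<close> into \<open>v \<otimes> inv t\<close> and the argument
        \<open>inv t \<otimes> v\<close> of \<open>p i j\<close> into
        \<open>inv v \<otimes> w\<close>, which exchanges the order of the two convolutions.\<close>
      have bij: "bij_betw (\<lambda>v. w \<otimes> inv v \<otimes> t) (carrier G) (carrier G)"
        by (rule bij_betwI[where g = "\<lambda>v. t \<otimes> inv v \<otimes> w"])
          (use i j in \<open>auto simp: inv_mult_group m_assoc\<close>, use i j in \<open>auto simp: m_assoc[symmetric]\<close>)
      have "(\<Sum>\<^sub>\<infinity>v\<in>carrier G. f (v \<otimes> inv t) * p i j (inv v \<otimes> w))
        = (\<Sum>\<^sub>\<infinity>v\<in>carrier G. f (w \<otimes> inv v \<otimes> t \<otimes> inv t) * p i j (inv (w \<otimes> inv v \<otimes> t) \<otimes> w))"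
        by (rule infsum_reindex_bij_betw[OF bij, symmetric])
      also have "\<dots> = (\<Sum>\<^sub>\<infinity>v\<in>carrier G. p i j (inv t \<otimes> v) * f (w \<otimes> inv v))"
      proof (intro infsum_cong)
        fix v assume v: "v \<in> carrier G"
        have "w \<otimes> inv v \<otimes> t \<otimes> inv t = w \<otimes> inv v"
          using i j v by (simp add: m_assoc)
        moreover have "inv (w \<otimes> inv v \<otimes> t) \<otimes> w = inv t \<otimes> v"
          using i j v by (simp add: inv_mult_group m_assoc)
        ultimately show "f (w \<otimes> inv v \<otimes> t \<otimes> inv t) * p i j (inv (w \<otimes> inv v \<otimes> t) \<otimes> w)
            = p i j (inv t \<otimes> v) * f (w \<otimes> inv v)"
          by (simp only: mult.commute)
      qed
      finally show ?thesis by (rule sym)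
    qed
    \<comment> \<open>Self-adjointness expresses the entry of \<open>P\<close> through the single
      vector \<open>P (delta (j, w))\<close>, so that the sum becomes an inner product.\<close>
    also have "\<dots> = (\<Sum>\<^sub>\<infinity>v\<in>carrier G. T (delta t) v * cnj (P (delta (j, w)) (i, v)))"
    proof (intro infsum_cong)
      fix v assume v: "v \<in> carrier G"
      have "P (delta (j, w)) (i, v) = ell2_inner B (P (delta (j, w))) (delta (i, v))"
        using i v by (simp add: ell2_inner_delta B_def)
      also have "\<dots> = cnj (P (delta (i, v)) (j, w))"
        using self[OF d[OF j] d[OF i(1) v]] j by (simp add: ell2_inner_delta B_def)
      finally have "cnj (P (delta (j, w)) (i, v)) = p i j (inv v \<otimes> w)"
        using Pd[OF i(1) j(1) v j(2)] by simp
      moreover have "T (delta t) v = f (v \<otimes> inv t)"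
        unfolding f_def by (rule right_comm_coeff[OF T i(2) v])
      ultimately show "f (v \<otimes> inv t) * p i j (inv v \<otimes> w) = T (delta t) v * cnj (P (delta (j, w)) (i, v))"
        by simp
    qed
    also have "\<dots> = ip (T (delta t)) (component (P (delta (j, w))) i)"
      by (simp add: ell2_inner_def component_def)
    also have "\<dots> = (\<Sum>k\<in>I. ip (component (amplify I (carrier G) T (delta (i, t))) k) (component (P (delta (j, w))) k))"
    proof -
      have "(\<Sum>k\<in>I. ip (component (amplify I (carrier G) T (delta (i, t))) k) (component (P (delta (j, w))) k))
        = (\<Sum>k\<in>I. if k = i then ip (T (delta t)) (component (P (delta (j, w))) i) else 0)"
        using d[OF i] unfolding B_def
        by (intro sum.cong refl)
          (simp add: amplify_component[OF I] component_delta bounded_ops_zero[OF Tb])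
      then show ?thesis using i I by simp
    qed
    also have "\<dots> = ell2_inner B (amplify I (carrier G) T (delta (i, t))) (P (delta (j, w)))"
      using ell2_inner_components[OF I, of "amplify I (carrier G) T (delta (i, t))" "carrier G" "P (delta (j, w))"]
        bounded_opsD(1)[OF ab d[OF i]] bounded_opsD(1)[OF P' d[OF j]]
      by (simp add: B_def)
    also have "\<dots> = ell2_inner B (P (amplify I (carrier G) T (delta (i, t)))) (delta (j, w))"
      using self[OF bounded_opsD(1)[OF ab d[OF i]] d[OF j]] by simp
    also have "\<dots> = op_mult B P (amplify I (carrier G) T) (delta x) y"
      using d[OF i] y by (simp add: ell2_inner_delta x' y')
    finally show "op_mult B (amplify I (carrier G) T) P (delta x) y = op_mult B P (amplify I (carrier G) T) (delta x) y" .
  qed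
  then have "op_mult B (amplify I (carrier G) T) P u = op_mult B P (amplify I (carrier G) T) u" by simp
  then show ?thesis using u by (simp add: B_def)
qed

lemma orth_translate:
  assumes V: "V \<subseteq> ell2 B"
    and l: "\<And>u. u \<in> ell2 B \<Longrightarrow> l u \<in> ell2 B"
    and adj: "\<And>u w. u \<in> ell2 B \<Longrightarrow> w \<in> ell2 B \<Longrightarrow> ell2_inner B (l u) w = ell2_inner B u (l' w)"
    and inv: "\<And>v. v \<in> V \<Longrightarrow> l' v \<in> V"
    and u: "u \<in> orth B V"
  shows "l u \<in> orth B V"
  using assms by (auto simp: orth_def subset_iff)

text \<open>Von Neumann's density argument. The families \<open>R (\<xi> i)\<close>, with
  \<open>R\<close> in the span, form a translation-invariant subspace of the direct sum, and the
  projection onto its closure commutes with the amplified \<open>T\<close>. As the family \<xi>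
  itself lies in the subspace, its image under \<open>T\<close> lies in the closure.\<close>

lemma right_comm_approx:
  assumes T: "T \<in> right_comm" and I: "finite I" and \<xi>: "\<And>i. i \<in> I \<Longrightarrow> \<xi> i \<in> L2" and "\<epsilon> > 0"
  shows "\<exists>R\<in>left_reg_span G. \<forall>i\<in>I. nrm (T (\<xi> i) - R (\<xi> i)) < \<epsilon>"
proof -
  define B where "B = I \<times> carrier G"
  define \<Xi> where "\<Xi> = family I \<xi>"
  have \<Xi>: "\<Xi> \<in> ell2 B" unfolding \<Xi>_def B_def by (rule family_ell2[OF I \<xi>])
  define fam where "fam R = family I (\<lambda>i. R (\<xi> i))" for R :: "'a oper"
  define V where "V = fam ` left_reg_span G"
  define l where "l s = permute B (\<lambda>(j, t). (j, inv s \<otimes> t))" for s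
  have bij: "bij_betw (\<lambda>(j, t). (j, inv s \<otimes> t)) B B" if "s \<in> carrier G" for s
    by (rule bij_betwI[where g = "\<lambda>(j, t). (j, s \<otimes> t)"])
      (use that in \<open>auto simp: B_def m_assoc[symmetric]\<close>)
  have l_ell2: "l s u \<in> ell2 B" if "s \<in> carrier G" "u \<in> ell2 B" for s u
    unfolding l_def using bij[OF that(1)] that(2) by (rule permute_ell2)
  have l_inv: "l s (l (inv s) u) = u" if "s \<in> carrier G" "u \<in> ell2 B" for s u
  proof -
    have "l s (l (inv s) u) = permute B (\<lambda>p. (\<lambda>(j, t). (j, inv (inv s) \<otimes> t)) ((\<lambda>(j, t). (j, inv s \<otimes> t)) p)) u"
      unfolding l_def using that by (intro permute_permute) (auto simp: B_def)
    also have "\<dots> = permute B (\<lambda>p. p) u"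
      using that by (intro fun_cong[OF permute_cong]) (auto simp: B_def m_assoc[symmetric])
    finally show ?thesis using that by (simp add: permute_id)
  qed
  have l_adj: "ell2_inner B (l s u) w = ell2_inner B u (l (inv s) w)"
    if "s \<in> carrier G" "u \<in> ell2 B" "w \<in> ell2 B" for s u w
  proof -
    have "ell2_inner B (l s u) (l s (l (inv s) w)) = ell2_inner B u (l (inv s) w)"
      unfolding l_def by (rule permute_inner[OF bij[OF that(1)]])
    then show ?thesis using l_inv[OF that(1,3)] by simp
  qed
  have fam_ell2: "fam R \<in> ell2 B" if "R \<in> left_reg_span G" for R
    unfolding fam_def B_def
    using that left_reg_span_bounded \<xi> by (intro family_ell2[OF I] bounded_opsD(1)[of R]) auto
  have V: "V \<subseteq> ell2 B" using fam_ell2 by (auto simp: V_def)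
  have fam_cong: "fam Q = family I w" if "\<And>i. i \<in> I \<Longrightarrow> Q (\<xi> i) = w i" for Q w
    unfolding fam_def using that by (rule family_cong)
  have sub: "l2_subspace B V"
    unfolding l2_subspace_def
  proof (intro conjI ballI allI V)
    obtain R where R: "R \<in> left_reg_span G" using left_reg_span_lam[OF one_closed] by blast
    obtain Q where Q: "Q \<in> left_reg_span G" "\<forall>\<xi>\<in>L2. Q \<xi> = scale_vec 0 (R \<xi>)"
      using left_reg_span_scale[OF R] by blast
    have "fam Q = family I (\<lambda>i. 0)" using Q \<xi> by (intro fam_cong) simp
    also have "\<dots> = 0" by (auto simp: family_def fun_eq_iff vec_apply)
    finally show "0 \<in> V" using imageI[OF Q(1), of fam] by (simp add: V_def)
  next
    fix u v assume "u \<in> V" "v \<in> V"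
    then obtain R S where R: "R \<in> left_reg_span G" "u = fam R" and S: "S \<in> left_reg_span G" "v = fam S"
      by (auto simp: V_def)
    obtain Q where Q: "Q \<in> left_reg_span G" "\<forall>\<xi>\<in>L2. Q \<xi> = R \<xi> + S \<xi>"
      using left_reg_span_add[OF R(1) S(1)] by blast
    have "fam Q = family I (\<lambda>i. R (\<xi> i) + S (\<xi> i))" using Q \<xi> by (intro fam_cong) simp
    then have "fam Q = u + v" by (simp add: family_linear R S fam_def)
    then show "u + v \<in> V" using imageI[OF Q(1), of fam] by (simp add: V_def)
  next
    fix c v assume "v \<in> V"
    then obtain R where R: "R \<in> left_reg_span G" "v = fam R" by (auto simp: V_def)
    obtain Q where Q: "Q \<in> left_reg_span G" "\<forall>\<xi>\<in>L2. Q \<xi> = scale_vec c (R \<xi>)"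
      using left_reg_span_scale[OF R(1)] by blast
    have "fam Q = family I (\<lambda>i. scale_vec c (R (\<xi> i)))" using Q \<xi> by (intro fam_cong) simp
    then have "fam Q = scale_vec c v" by (simp add: family_linear R fam_def)
    then show "scale_vec c v \<in> V" using imageI[OF Q(1), of fam] by (simp add: V_def)
  qed
  have lV: "l s v \<in> V" if s: "s \<in> carrier G" and v: "v \<in> V" for s v
  proof -
    obtain R where R: "R \<in> left_reg_span G" "v = fam R" using v by (auto simp: V_def)
    obtain Q where Q: "Q \<in> left_reg_span G" "\<forall>\<xi>\<in>L2. Q \<xi> = lam s (R \<xi>)"
      using left_reg_span_translate[OF R(1) s] by blast
    have R': "R (\<xi> i) \<in> L2" if "i \<in> I" for i
      using bounded_opsD(1)[of R "carrier G"] left_reg_span_bounded R(1) \<xi>[OF that] by auto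
    have "fam Q = family I (\<lambda>i. lam s (R (\<xi> i)))" using Q \<xi> by (intro fam_cong) simp
    also have "\<dots> = l s (fam R)"
      using s R' by (auto simp: l_def permute_def family_def fam_def B_def fun_eq_iff left_reg_def)
    finally show ?thesis using imageI[OF Q(1), of fam] R(2) by (simp add: V_def)
  qed
  define P where "P = proj_op B (orth B V)"
  note W = orth_subset[of B V]
  have Pb: "P \<in> bounded_ops B" unfolding P_def by (rule proj_op_bounded[OF W])
  have lO: "l s u \<in> orth B V" if "s \<in> carrier G" "u \<in> orth B V" for s u
    by (rule orth_translate[OF V _ _ _ that(2), of "l s" "l (inv s)"])
      (use that(1) l_ell2 l_adj lV in auto)
  have lO2: "l s u \<in> orth B (orth B V)" if "s \<in> carrier G" "u \<in> orth B (orth B V)" for s u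
    by (rule orth_translate[OF W _ _ _ that(2), of "l s" "l (inv s)"])
      (use that(1) l_ell2 l_adj lO in auto)
  have Pl: "P (l s u) = l s (P u)" if "s \<in> carrier G" "u \<in> ell2 B" for s u
    unfolding P_def
  proof (rule proj_op_commute[OF W, of "l s" "l (inv s)"])
    show "l s (\<xi> - \<eta>) = l s \<xi> - l s \<eta>" for \<xi> \<eta> by (simp add: l_def permute_linear)
  qed (use that l_ell2 l_adj lO2 in auto)
  have Pdelta: "P (delta (i, s)) = l s (P (delta (i, \<one>)))" if "s \<in> carrier G" "i \<in> I" for s i
  proof -
    have "delta (i, s) = l s (delta (i, \<one>))"
      using that by (auto simp: l_def permute_def delta_def B_def fun_eq_iff inv_solve_left' split: if_splits)
    then show ?thesis using Pl[OF that(1), of "delta (i, \<one>)"] that by (simp add: delta_ell2 B_def)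
  qed
  have "amplify I (carrier G) T (P \<Xi>) = P (amplify I (carrier G) T \<Xi>)"
  proof (rule amplified_commutation[OF T I, folded B_def])
    show "ell2_inner B (P u) w = ell2_inner B u (P w)" if "u \<in> ell2 B" "w \<in> ell2 B" for u w
      unfolding P_def using that by (rule proj_op_self_adjoint[OF W])
    show "P (delta (i, s)) = permute B (\<lambda>(j, t). (j, inv s \<otimes> t)) (P (delta (i, \<one>)))"
      if "s \<in> carrier G" "i \<in> I" for s i
      using Pdelta[OF that] by (simp only: l_def)
  qed (rule Pb \<Xi>)+
  moreover have "P \<Xi> = \<Xi>"
  proof -
    obtain R where R: "R \<in> left_reg_span G" "\<forall>\<xi>\<in>L2. R \<xi> = lam \<one> \<xi>"
      using left_reg_span_lam[OF one_closed] by blast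
    have "fam R = \<Xi>" unfolding \<Xi>_def using R \<xi> by (intro fam_cong) (simp add: lam_one)
    then have "\<Xi> \<in> V" using imageI[OF R(1), of fam] by (simp add: V_def)
    then have "\<Xi> \<in> orth B (orth B V)" using orth_orth_superset[OF V] by auto
    then show ?thesis unfolding P_def by (rule proj_op_fix[OF W])
  qed
  ultimately have "amplify I (carrier G) T \<Xi> = P (amplify I (carrier G) T \<Xi>)" by simp
  moreover have a: "amplify I (carrier G) T \<Xi> \<in> ell2 B"
    using bounded_opsD(1)[OF amplify_bounded[OF I right_commD(1)[OF T]]] \<Xi> by (simp add: B_def)
  ultimately have "amplify I (carrier G) T \<Xi> \<in> orth B (orth B V)"
    using proj_op_in[OF W a] by (simp add: P_def)
  then obtain v where v: "v \<in> V" "ell2_norm B (amplify I (carrier G) T \<Xi> - v) < \<epsilon>"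
    using orth_orth_approx[OF sub _ \<open>\<epsilon> > 0\<close>] by blast
  then obtain R where R: "R \<in> left_reg_span G" "v = fam R" by (auto simp: V_def)
  have "nrm (T (\<xi> i) - R (\<xi> i)) < \<epsilon>" if i: "i \<in> I" for i
  proof -
    let ?d = "amplify I (carrier G) T \<Xi> - v"
    have dB: "?d \<in> ell2 (I \<times> carrier G)" using a v(1) V by (auto simp: B_def[symmetric])
    have "component ?d i = T (\<xi> i) - R (\<xi> i)"
      using i \<Xi> I by (simp add: component_linear amplify_component[OF I] B_def R(2) fam_def \<Xi>_def)
    moreover have "(nrm (component ?d i))\<^sup>2 \<le> (ell2_norm (I \<times> carrier G) ?d)\<^sup>2"
      unfolding ell2_norm_components[OF I dB] using i I by (intro member_le_sum) auto
    then have "nrm (component ?d i) \<le> ell2_norm B ?d"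
      unfolding B_def by (rule power2_le_imp_le) simp
    ultimately show ?thesis using v(2) by simp
  qed
  then show ?thesis using R(1) by blast
qed

theorem group_vna_eq: "group_vna G = right_comm"
proof
  show "right_comm \<subseteq> group_vna G"
  proof
    fix T assume T: "T \<in> right_comm"
    note Tb = right_commD(1)[OF T]
    show "T \<in> group_vna G"
      unfolding group_vna_def wot_closure_iff[OF left_reg_span_bounded]
    proof (intro conjI allI impI Tb)
      fix P and \<epsilon> :: real assume P: "finite P \<and> P \<subseteq> L2 \<times> L2 \<and> \<epsilon> > 0"
      \<comment> \<open>The summand 1 makes \<open>M\<close> positive and strictly larger than the
        norm of every second vector occurring in \<open>P\<close>.\<close>
      define M where "M = 1 + (\<Sum>p\<in>P. nrm (snd p))"
      have M: "M > 0" by (simp add: M_def add_pos_nonneg sum_nonneg)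
      have snd_le: "nrm (snd p) < M" if "p \<in> P" for p
      proof -
        have "nrm (snd p) \<le> (\<Sum>p\<in>P. nrm (snd p))" using P that by (intro member_le_sum) auto
        then show ?thesis by (simp add: M_def)
      qed
      have "\<exists>R\<in>left_reg_span G. \<forall>p\<in>P. nrm (T (fst p) - R (fst p)) < \<epsilon> / M"
        by (rule right_comm_approx[OF T]) (use P M in auto)
      then obtain R where R: "R \<in> left_reg_span G" "\<And>p. p \<in> P \<Longrightarrow> nrm (T (fst p) - R (fst p)) < \<epsilon> / M"
        by blast
      have Rb: "R \<in> bounded_ops (carrier G)" using R(1) left_reg_span_bounded by blast
      have "cmod (ip (T \<xi>) \<eta> - ip (R \<xi>) \<eta>) < \<epsilon>" if p: "(\<xi>, \<eta>) \<in> P" for \<xi> \<eta>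
      proof -
        have \<xi>: "\<xi> \<in> L2" and \<eta>: "\<eta> \<in> L2" using p P by auto
        note t = bounded_opsD(1)[OF Tb \<xi>] bounded_opsD(1)[OF Rb \<xi>]
        have "ip (T \<xi>) \<eta> - ip (R \<xi>) \<eta> = ip (T \<xi> - R \<xi>) \<eta>" using t \<eta> by (simp add: ell2_inner_diff)
        also have "cmod \<dots> \<le> nrm (T \<xi> - R \<xi>) * nrm \<eta>"
          using t \<eta> by (intro ell2_cauchy_schwarz ell2_diff)
        also have "\<dots> \<le> nrm (T \<xi> - R \<xi>) * M"
          using snd_le[OF p] by (intro mult_left_mono) auto
        also have "\<dots> < \<epsilon>" using R(2)[OF p] M by (simp add: field_simps)
        finally show ?thesis .
      qed
      then show "\<exists>R\<in>left_reg_span G. \<forall>(\<xi>, \<eta>)\<in>P. cmod (ip (T \<xi>) \<eta> - ip (R \<xi>) \<eta>) < \<epsilon>"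
        using R(1) by blast
    qed
  qed
qed (rule group_vna_subset)

end

section \<open>Invariant maximal abelian subalgebras\<close>

text \<open>For \<open>k = inv g \<otimes> h\<close> this says, after conjugation by
  \<open>g\<close>, that the conjugates of \<open>s\<close> by \<open>g\<close> and by
  \<open>h\<close> commute.\<close>

definition commute_conj :: "('a, 'm) monoid_scheme \<Rightarrow> 'a \<Rightarrow> 'a \<Rightarrow> bool" where
  "commute_conj G s k \<longleftrightarrow> s \<otimes>\<^bsub>G\<^esub> (k \<otimes>\<^bsub>G\<^esub> s \<otimes>\<^bsub>G\<^esub> inv\<^bsub>G\<^esub> k) = (k \<otimes>\<^bsub>G\<^esub> s \<otimes>\<^bsub>G\<^esub> inv\<^bsub>G\<^esub> k) \<otimes>\<^bsub>G\<^esub> s"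

text \<open>The bound counts conjugators, not conjugates: if \<open>g\<close> and \<open>h\<close>
  give the same conjugate of \<open>s\<close>, they already form a commuting pair.\<close>

definition conj_recurrent :: "('a, 'm) monoid_scheme \<Rightarrow> 'a \<Rightarrow> nat \<Rightarrow> bool" where
  "conj_recurrent G s n \<longleftrightarrow> (\<forall>I. finite I \<and> I \<subseteq> carrier G \<and> n < card I \<longrightarrow>
     (\<exists>g\<in>I. \<exists>h\<in>I. g \<noteq> h \<and> commute_conj G s (inv\<^bsub>G\<^esub> g \<otimes>\<^bsub>G\<^esub> h)))"

context group
begin

lemma inv_cancel:
  "x \<in> carrier G \<Longrightarrow> y \<in> carrier G \<Longrightarrow> inv x \<otimes> (x \<otimes> y) = y"
  "x \<in> carrier G \<Longrightarrow> y \<in> carrier G \<Longrightarrow> x \<otimes> (inv x \<otimes> y) = y"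
  by (simp_all add: m_assoc[symmetric])

lemma torsion_free_inj:
  assumes tf: "torsion_free G" and g: "g \<in> carrier G" "g \<noteq> \<one>"
  shows "inj (\<lambda>k::nat. g [^] k)"
proof -
  have ne: "g [^] i \<noteq> g [^] j" if "i < j" for i j :: nat
  proof
    assume eq: "g [^] i = g [^] j"
    have "g [^] i \<otimes> g [^] (j - i) = g [^] j" using g that by (simp add: nat_pow_mult)
    then have "g [^] i \<otimes> g [^] (j - i) = g [^] i \<otimes> \<one>" using eq g by simp
    then have "g [^] (j - i) = \<one>" using g by simp
    then show False using tf g that unfolding torsion_free_def by (metis zero_less_diff)
  qed
  show ?thesis
    by (rule injI) (metis ne linorder_neqE_nat)
qed

text \<open>A fixed vector is constant on the orbits of left multiplication by \<open>g\<close>.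
  These are infinite by torsion-freeness, so square-summability forces the constant to be 0.\<close>

lemma lam_fixed_eq_0:
  assumes tf: "torsion_free G" and g: "g \<in> carrier G" "g \<noteq> \<one>"
    and \<zeta>: "\<zeta> \<in> L2" and fixed: "lam g \<zeta> = \<zeta>"
  shows "\<zeta> = 0"
proof (rule ell2_eq_0I[OF \<zeta>])
  fix t assume t: "t \<in> carrier G"
  have step: "\<zeta> (g \<otimes> u) = \<zeta> u" if u: "u \<in> carrier G" for u
  proof -
    have "\<zeta> (g \<otimes> u) = lam g \<zeta> (g \<otimes> u)" by (simp only: fixed)
    also have "\<dots> = \<zeta> u" using g u \<zeta> by (simp add: lam_apply inv_cancel)
    finally show ?thesis .
  qed
  have pow: "\<zeta> (g [^] k \<otimes> t) = \<zeta> t" for k :: nat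
  proof (induction k)
    case (Suc k)
    have "g [^] Suc k \<otimes> t = g \<otimes> (g [^] k \<otimes> t)"
      unfolding nat_pow_Suc2[OF g(1)] using g t by (simp add: m_assoc)
    then show ?case using Suc step[of "g [^] k \<otimes> t"] g t by simp
  qed (use t in simp)
  have inj: "inj_on (\<lambda>k::nat. g [^] k \<otimes> t) {..<n}" for n
    using injD[OF torsion_free_inj[OF tf g]] g t by (auto intro!: inj_onI)
  have le: "real n * (cmod (\<zeta> t))\<^sup>2 \<le> (nrm \<zeta>)\<^sup>2" for n
  proof -
    have "real n * (cmod (\<zeta> t))\<^sup>2 = (\<Sum>k<n. (cmod (\<zeta> (g [^] k \<otimes> t)))\<^sup>2)" by (simp add: pow)
    also have "\<dots> = (\<Sum>u\<in>(\<lambda>k::nat. g [^] k \<otimes> t) ` {..<n}. (cmod (\<zeta> u))\<^sup>2)"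
      by (simp add: sum.reindex[OF inj])
    also have "\<dots> \<le> (nrm \<zeta>)\<^sup>2" using g t by (intro ell2_finite_sum_le[OF \<zeta>]) auto
    finally show ?thesis .
  qed
  have "\<zeta> t = 0"
  proof (rule ccontr)
    assume "\<zeta> t \<noteq> 0"
    then have p: "(cmod (\<zeta> t))\<^sup>2 > 0" by simp
    obtain n where "(nrm \<zeta>)\<^sup>2 / (cmod (\<zeta> t))\<^sup>2 < real n" using reals_Archimedean2 by blast
    then have "(nrm \<zeta>)\<^sup>2 < real n * (cmod (\<zeta> t))\<^sup>2" using p by (simp add: field_simps)
    then show False using le[of n] by simp
  qed
  then show "ip \<zeta> (delta t) = 0" using t by (simp add: ell2_inner_delta)
qed

text \<open>The commutant is taken inside \<open>right_comm\<close>, that is, relative to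
  L(\<Gamma>).\<close>

definition commutant :: "'a oper set \<Rightarrow> 'a oper set" where
  "commutant S = {x \<in> right_comm. \<forall>a\<in>S. \<forall>\<xi>\<in>L2. x (a \<xi>) = a (x \<xi>)}"

lemma commutantD:
  assumes "x \<in> commutant S" shows "x \<in> right_comm" "a \<in> S \<Longrightarrow> \<xi> \<in> L2 \<Longrightarrow> x (a \<xi>) = a (x \<xi>)"
  using assms by (auto simp: commutant_def)

lemma commutant_subset: "commutant S \<subseteq> right_comm" by (auto simp: commutant_def)

lemma commutant_antimono: "S \<subseteq> S' \<Longrightarrow> commutant S' \<subseteq> commutant S" by (auto simp: commutant_def)

lemma commutant_adjoint:
  assumes S: "S \<subseteq> right_comm" and star: "\<And>a. a \<in> S \<Longrightarrow> adjoint_op (carrier G) a \<in> S" and x: "x \<in> commutant S"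
  shows "adjoint_op (carrier G) x \<in> commutant S"
proof -
  note xr = commutantD(1)[OF x]
  note xb = right_commD(1)[OF xr] and xa = right_commD(3)[OF right_comm_adjoint[OF xr]]
  have "adjoint_op (carrier G) x (a \<xi>) = a (adjoint_op (carrier G) x \<xi>)" if a: "a \<in> S" and \<xi>: "\<xi> \<in> L2" for a \<xi>
  proof -
    have ar: "a \<in> right_comm" using a S by auto
    note ab = right_commD(1)[OF ar] and a' = right_commD(3)[OF ar] and aa = right_commD(3)[OF right_comm_adjoint[OF ar]]
    show ?thesis
    proof (rule ell2_inner_ext)
      fix \<zeta> assume \<zeta>: "\<zeta> \<in> L2"
      have "ip \<zeta> (adjoint_op (carrier G) x (a \<xi>)) = ip (x \<zeta>) (a \<xi>)"
        using \<zeta> a'[OF \<xi>] by (simp add: adjoint_op_inner[OF xb])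
      also have "\<dots> = ip (adjoint_op (carrier G) a (x \<zeta>)) \<xi>"
        using \<zeta> \<xi> right_commD(3)[OF xr] by (simp add: adjoint_op_inner'[OF ab])
      also have "adjoint_op (carrier G) a (x \<zeta>) = x (adjoint_op (carrier G) a \<zeta>)"
        using commutantD(2)[OF x star[OF a] \<zeta>] by simp
      also have "ip \<dots> \<xi> = ip (adjoint_op (carrier G) a \<zeta>) (adjoint_op (carrier G) x \<xi>)"
        using \<zeta> \<xi> aa by (simp add: adjoint_op_inner[OF xb])
      also have "\<dots> = ip \<zeta> (a (adjoint_op (carrier G) x \<xi>))"
        using \<zeta> \<xi> xa by (simp add: adjoint_op_inner'[OF ab])
      finally show "ip \<zeta> (adjoint_op (carrier G) x (a \<xi>)) = ip \<zeta> (a (adjoint_op (carrier G) x \<xi>))" .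
    qed (use xa a' \<xi> in auto)
  qed
  then show ?thesis using right_comm_adjoint[OF xr] by (auto simp: commutant_def)
qed

lemma commutant_star_subalgebra:
  assumes S: "S \<subseteq> right_comm" and star: "\<And>a. a \<in> S \<Longrightarrow> adjoint_op (carrier G) a \<in> S"
  shows "star_subalgebra (carrier G) (commutant S)"
  unfolding star_subalgebra_def
proof (intro conjI ballI allI)
  have l: "a \<xi> \<in> L2" "a (\<xi> + \<eta>) = a \<xi> + a \<eta>" "a (scale_vec c \<xi>) = scale_vec c (a \<xi>)"
    if "a \<in> S" "\<xi> \<in> L2" "\<eta> \<in> L2" for a \<xi> \<eta> c
    using bounded_opsD[of a "carrier G"] right_commD(1)[of a] S that by auto
  show "commutant S \<subseteq> bounded_ops (carrier G)" using right_commD(1) by (auto simp: commutant_def)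
  have "op_id (carrier G) \<in> commutant S" using l by (auto simp: commutant_def right_comm_id)
  then show "commutant S \<noteq> {}" by auto
  fix x y assume x: "x \<in> commutant S" and y: "y \<in> commutant S"
  note xl = right_commD(3)[OF commutantD(1)[OF x]] and yl = right_commD(3)[OF commutantD(1)[OF y]]
  show "op_add (carrier G) x y \<in> commutant S"
    unfolding commutant_def
    using l xl yl commutantD(2)[OF x] commutantD(2)[OF y] right_comm_add[OF commutantD(1)[OF x] commutantD(1)[OF y]] by auto
  show "op_mult (carrier G) x y \<in> commutant S"
    unfolding commutant_def
    using l xl yl commutantD(2)[OF x] commutantD(2)[OF y] right_comm_mult[OF commutantD(1)[OF x] commutantD(1)[OF y]] by auto
  show "adjoint_op (carrier G) x \<in> commutant S" by (rule commutant_adjoint[OF S star x])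
  show "op_scale (carrier G) c x \<in> commutant S" for c
    unfolding commutant_def
    using l xl commutantD(2)[OF x] right_comm_scale[OF commutantD(1)[OF x]] by auto
qed

end

locale invariant_masa = group +
  fixes N
  assumes masa: "maximal_abelian (carrier G) (group_vna G) N"
    and normalized: "left_reg G ` carrier G \<subseteq> normalizer_ops (carrier G) (group_vna G) N"
begin

lemma N_star: "star_subalgebra (carrier G) N" using masa by (simp add: maximal_abelian_def)

lemma N_right_comm: "a \<in> N \<Longrightarrow> a \<in> right_comm"
  using masa by (auto simp: maximal_abelian_def group_vna_eq)

lemma N_adj: "a \<in> N \<Longrightarrow> adjoint_op (carrier G) a \<in> N"
  using N_star by (simp add: star_subalgebra_def)

lemma N_ell2: "a \<in> N \<Longrightarrow> \<xi> \<in> L2 \<Longrightarrow> a \<xi> \<in> L2"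
  using right_commD(3)[OF N_right_comm] .

lemma N_bounded: "a \<in> N \<Longrightarrow> a \<in> bounded_ops (carrier G)"
  using right_commD(1)[OF N_right_comm] .

lemma N_commute:
  assumes "a \<in> N" "b \<in> N" "\<xi> \<in> L2" shows "a (b \<xi>) = b (a \<xi>)"
proof -
  have "op_mult (carrier G) a b = op_mult (carrier G) b a"
    using masa assms by (auto simp: maximal_abelian_def abelian_ops_def)
  then have "op_mult (carrier G) a b \<xi> = op_mult (carrier G) b a \<xi>" by simp
  then show ?thesis using assms by simp
qed

text \<open>Adjoining \<open>h\<close> to \<open>N\<close> keeps the set commutative and closed
  under adjoints, so its relative bicommutant is an abelian star subalgebra. By maximality it equals
  \<open>N\<close>, and it contains \<open>h\<close>.\<close>

lemma self_adjoint_commutant: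
  assumes h: "h \<in> commutant N" and sa: "adjoint_op (carrier G) h = h"
  shows "h \<in> N"
proof -
  define S where "S = insert h N"
  have S: "S \<subseteq> right_comm" using N_right_comm commutantD(1)[OF h] by (auto simp: S_def)
  have star: "adjoint_op (carrier G) a \<in> S" if "a \<in> S" for a using that N_adj sa by (auto simp: S_def)
  have ab: "S \<subseteq> commutant S"
  proof
    fix x assume x: "x \<in> S"
    have "x (a \<xi>) = a (x \<xi>)" if a: "a \<in> S" and \<xi>: "\<xi> \<in> L2" for a \<xi>
    proof (cases "x = h")
      case True
      then show ?thesis using a \<xi> commutantD(2)[OF h, of a \<xi>] by (cases "a = h") (auto simp: S_def)
    next
      case False
      then have x: "x \<in> N" using x by (simp add: S_def)
      show ?thesis
      proof (cases "a = h")
        case True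
        then show ?thesis using commutantD(2)[OF h x \<xi>] by simp
      next
        case False
        then show ?thesis using a N_commute[OF x _ \<xi>] by (simp add: S_def)
      qed
    qed
    then show "x \<in> commutant S" using x S by (auto simp: commutant_def)
  qed
  \<comment> \<open>A commuting set lies in its commutant; taking commutants once more puts the
    bicommutant inside the commutant, which makes it abelian.\<close>
  have sub: "commutant (commutant S) \<subseteq> commutant S" by (rule commutant_antimono[OF ab])
  have "star_subalgebra (carrier G) (commutant (commutant S))"
    by (rule commutant_star_subalgebra[OF commutant_subset commutant_adjoint[OF S star]])
  moreover have "abelian_ops (carrier G) (commutant (commutant S))"
    unfolding abelian_ops_def
  proof (intro ballI)
    fix x y assume x: "x \<in> commutant (commutant S)" and y: "y \<in> commutant (commutant S)"
    have y': "y \<in> commutant S" using sub y by auto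
    note xb = right_commD(1)[OF commutantD(1)[OF x]] and yb = right_commD(1)[OF commutantD(1)[OF y]]
    show "op_mult (carrier G) x y = op_mult (carrier G) y x"
      by (rule bounded_ops_eqI[OF op_mult_bounded[OF xb yb] op_mult_bounded[OF yb xb]])
        (simp add: commutantD(2)[OF x y'])
  qed
  moreover have SS: "S \<subseteq> commutant (commutant S)"
    unfolding commutant_def[of "commutant S"] using S commutantD(2)[of _ S] by auto
  then have "N \<subseteq> commutant (commutant S)" by (auto simp: S_def)
  moreover have "commutant (commutant S) \<subseteq> group_vna G" unfolding group_vna_eq by (rule commutant_subset)
  ultimately have "commutant (commutant S) = N" using masa unfolding maximal_abelian_def by blast
  then show ?thesis using SS by (auto simp: S_def)
qed

text \<open>A maximal abelian subalgebra is its own relative commutant: the self-adjoint case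
  extends to every \<open>x\<close> by splitting off real and imaginary parts.\<close>

lemma commutant_in_N:
  assumes x: "x \<in> commutant N" shows "x \<in> N"
proof -
  let ?A = "carrier G"
  have st: "star_subalgebra ?A (commutant N)"
    by (rule commutant_star_subalgebra) (auto simp: N_right_comm N_adj)
  have herm: "op_add ?A y (adjoint_op ?A y) \<in> N" if y: "y \<in> commutant N" for y
  proof (rule self_adjoint_commutant)
    show "op_add ?A y (adjoint_op ?A y) \<in> commutant N" using st y by (simp add: star_subalgebra_def)
    have yb: "y \<in> bounded_ops ?A" using right_commD(1)[OF commutantD(1)[OF y]] .
    show "adjoint_op ?A (op_add ?A y (adjoint_op ?A y)) = op_add ?A y (adjoint_op ?A y)"
      using yb adjoint_op_bounded[OF yb]
      by (auto simp: adjoint_op_add intro!: bounded_ops_eqI[of _ ?A] op_add_bounded)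
  qed
  have xb: "x \<in> bounded_ops ?A" using right_commD(1)[OF commutantD(1)[OF x]] .
  \<comment> \<open>The sum of \<open>?y\<close> and its adjoint is i times the difference of
    \<open>x\<close> and its adjoint. The factor \<open>- \<i> / 2\<close> makes it half that
    difference, which completes half the sum to \<open>x\<close>.\<close>
  let ?y = "op_scale ?A \<i> x"
  have "?y \<in> commutant N" using st x by (simp add: star_subalgebra_def)
  then have in_N: "op_add ?A (op_scale ?A (1/2) (op_add ?A x (adjoint_op ?A x)))
      (op_scale ?A (- \<i> / 2) (op_add ?A ?y (adjoint_op ?A ?y))) \<in> N" (is "?z \<in> N")
    using herm[OF x] herm[of ?y] N_star by (simp add: star_subalgebra_def)
  have "?z = x"
  proof (rule bounded_ops_eqI[OF N_bounded[OF in_N] xb])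
    fix \<xi> assume \<xi>: "\<xi> \<in> L2"
    then show "?z \<xi> = x \<xi>"
      by (simp add: adjoint_op_scale[OF xb]) (auto simp: fun_eq_iff vec_apply algebra_simps)
  qed
  then show ?thesis using in_N by simp
qed

section \<open>Conjugation of \<open>N\<close> by group elements and the projections
  \<open>p s\<close>\<close>

definition sg :: "'a \<Rightarrow> 'a oper \<Rightarrow> 'a oper" where
  "sg s a = op_mult (carrier G) (op_mult (carrier G) (lam s) a) (lam (inv s))"

lemma sg_apply:
  "s \<in> carrier G \<Longrightarrow> \<xi> \<in> L2 \<Longrightarrow> sg s a \<xi> = lam s (a (lam (inv s) \<xi>))"
  by (simp add: sg_def lam_ell2)

lemma sg_in_N:
  assumes s: "s \<in> carrier G" and a: "a \<in> N" shows "sg s a \<in> N"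
proof -
  have "left_reg G s \<in> normalizer_ops (carrier G) (group_vna G) N" using normalized s by auto
  then have "(\<lambda>x. op_mult (carrier G) (op_mult (carrier G) (lam s) x) (adjoint_op (carrier G) (lam s))) ` N = N"
    by (simp add: normalizer_ops_def)
  then show ?thesis using a s by (force simp: sg_def lam_adjoint)
qed

lemma lam_N: "s \<in> carrier G \<Longrightarrow> a \<in> N \<Longrightarrow> \<xi> \<in> L2 \<Longrightarrow> lam s (a \<xi>) = sg s a (lam s \<xi>)"
  by (simp add: sg_apply lam_ell2 lam_inv)

definition V :: "'a \<Rightarrow> ('a \<Rightarrow> complex) set" where
  "V s = {\<zeta> \<in> L2. \<forall>a\<in>N. a \<zeta> = sg s a \<zeta>}"

text \<open>Passing to adjoints moves the condition defining \<open>V s\<close> onto test vectors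
  \<eta>, so \<open>V s\<close> is the orthogonal complement of this set, the form in which
  \<open>proj_op\<close> takes its range.\<close>

definition W :: "'a \<Rightarrow> ('a \<Rightarrow> complex) set" where
  "W s = {adjoint_op (carrier G) a \<eta> - adjoint_op (carrier G) (sg s a) \<eta> | a \<eta>. a \<in> N \<and> \<eta> \<in> L2}"

lemma W_subset:
  assumes s: "s \<in> carrier G" shows "W s \<subseteq> L2"
proof
  fix v assume "v \<in> W s"
  then obtain a \<eta> where a: "a \<in> N" and \<eta>: "\<eta> \<in> L2"
    and v: "v = adjoint_op (carrier G) a \<eta> - adjoint_op (carrier G) (sg s a) \<eta>"
    by (auto simp: W_def)
  show "v \<in> L2"
    unfolding v by (rule ell2_diff[OF N_ell2[OF N_adj[OF a] \<eta>] N_ell2[OF N_adj[OF sg_in_N[OF s a]] \<eta>]])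
qed

lemma orth_W:
  assumes s: "s \<in> carrier G" shows "orth (carrier G) (W s) = V s"
proof -
  have key: "ip \<zeta> (adjoint_op (carrier G) a \<eta> - adjoint_op (carrier G) (sg s a) \<eta>) = ip (a \<zeta> - sg s a \<zeta>) \<eta>"
    if z: "\<zeta> \<in> L2" and a: "a \<in> N" and e: "\<eta> \<in> L2" for \<zeta> a \<eta>
  proof -
    note b = sg_in_N[OF s a]
    show ?thesis
      by (simp only: ell2_inner_diff N_ell2[OF a z] N_ell2[OF b z] N_ell2[OF N_adj[OF a] e]
          N_ell2[OF N_adj[OF b] e] z e adjoint_op_inner[OF N_bounded[OF a] z e]
          adjoint_op_inner[OF N_bounded[OF b] z e])
  qed
  have "(\<forall>\<eta>\<in>L2. ip (a \<zeta> - sg s a \<zeta>) \<eta> = 0) \<longleftrightarrow> a \<zeta> = sg s a \<zeta>" if "\<zeta> \<in> L2" "a \<in> N" for \<zeta> a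
  proof
    have d: "a \<zeta> - sg s a \<zeta> \<in> L2" by (rule ell2_diff[OF N_ell2[OF that(2,1)] N_ell2[OF sg_in_N[OF s that(2)] that(1)]])
    assume "\<forall>\<eta>\<in>L2. ip (a \<zeta> - sg s a \<zeta>) \<eta> = 0"
    then have "a \<zeta> - sg s a \<zeta> = 0" using d ell2_inner_self_eq_0 by blast
    then show "a \<zeta> = sg s a \<zeta>" by simp
  qed simp
  then show ?thesis
    unfolding orth_def W_def V_def using key by (auto; metis)
qed

definition p :: "'a \<Rightarrow> 'a oper" where
  "p s = proj_op (carrier G) (W s)"

context
  fixes s assumes s: "s \<in> carrier G"
begin

lemma p_in_V: "\<xi> \<in> L2 \<Longrightarrow> p s \<xi> \<in> V s"
  using proj_op_in[OF W_subset[OF s]] orth_W[OF s] by (simp add: p_def)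

lemma p_fix: "\<zeta> \<in> V s \<Longrightarrow> p s \<zeta> = \<zeta>"
  using proj_op_fix[OF W_subset[OF s]] orth_W[OF s] by (simp add: p_def)

lemma p_self_adjoint: "\<xi> \<in> L2 \<Longrightarrow> \<eta> \<in> L2 \<Longrightarrow> ip (p s \<xi>) \<eta> = ip \<xi> (p s \<eta>)"
  using proj_op_self_adjoint[OF W_subset[OF s]] by (simp add: p_def)

lemma V_rtr:
  assumes t: "t \<in> carrier G" and \<zeta>: "\<zeta> \<in> V s" shows "rtr t \<zeta> \<in> V s"
proof -
  have z: "\<zeta> \<in> L2" using \<zeta> by (simp add: V_def)
  have "a (rtr t \<zeta>) = sg s a (rtr t \<zeta>)" if a: "a \<in> N" for a
    using \<zeta> a right_commD(2)[OF N_right_comm[OF a] t z] right_commD(2)[OF N_right_comm[OF sg_in_N[OF s a]] t z]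
    by (simp add: V_def)
  then show ?thesis using rtr_ell2[OF t z] by (simp add: V_def)
qed

lemma V_N:
  assumes b: "b \<in> N" and \<zeta>: "\<zeta> \<in> V s" shows "b \<zeta> \<in> V s"
proof -
  have "a (b \<zeta>) = sg s a (b \<zeta>)" if a: "a \<in> N" for a
  proof -
    have "a (b \<zeta>) = b (a \<zeta>)" using N_commute[OF a b] \<zeta> by (simp add: V_def)
    also have "\<dots> = b (sg s a \<zeta>)" using \<zeta> a by (simp add: V_def)
    also have "\<dots> = sg s a (b \<zeta>)" using N_commute[OF b sg_in_N[OF s a]] \<zeta> by (simp add: V_def)
    finally show ?thesis .
  qed
  then show ?thesis using \<zeta> N_ell2[OF b] by (simp add: V_def)
qed

text \<open>The space \<open>V s\<close> is invariant under right translations and under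
  \<open>N\<close>, so its projection lies in L(\<Gamma>) and commutes with
  \<open>N\<close>.\<close>

lemma p_in_N: "p s \<in> N"
proof (rule commutant_in_N)
  have "p s \<in> right_comm"
  proof (rule right_commI)
    show "p s \<in> bounded_ops (carrier G)" unfolding p_def by (rule proj_op_bounded[OF W_subset[OF s]])
    fix t \<xi> assume t: "t \<in> carrier G" and \<xi>: "\<xi> \<in> L2"
    show "p s (rtr t \<xi>) = rtr t (p s \<xi>)"
      unfolding p_def
      by (rule proj_op_commute[OF W_subset[OF s], of "rtr t" "rtr (inv t)"])
        (use t \<xi> V_rtr in \<open>auto simp: rtr_ell2 rtr_linear rtr_adj orth_W[OF s]\<close>)
  qed
  moreover have "p s (a \<xi>) = a (p s \<xi>)" if a: "a \<in> N" and \<xi>: "\<xi> \<in> L2" for a \<xi>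
    unfolding p_def
  proof (rule proj_op_commute[OF W_subset[OF s], of a "adjoint_op (carrier G) a"])
    show "a v \<in> orth (carrier G) (W s)" if "v \<in> orth (carrier G) (W s)" for v
      using that V_N[OF a] by (simp add: orth_W[OF s])
    show "adjoint_op (carrier G) a v \<in> orth (carrier G) (W s)" if "v \<in> orth (carrier G) (W s)" for v
      using that V_N[OF N_adj[OF a]] by (simp add: orth_W[OF s])
  qed (use \<xi> a in \<open>auto simp: N_ell2[OF a] bounded_ops_diff[OF N_bounded[OF a]] adjoint_op_inner[OF N_bounded[OF a]]\<close>)
  ultimately show "p s \<in> commutant N" by (simp add: commutant_def)
qed

text \<open>Moving \<open>lam s\<close> past \<open>a\<close> replaces \<open>a\<close> by
  \<open>sg s a\<close>, and on the range of \<open>p s\<close> this acts as \<open>a\<close> again;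
  so the product commutes with \<open>N\<close>.\<close>

lemma p_lam_in_N: "op_mult (carrier G) (p s) (lam s) \<in> N"
proof (rule commutant_in_N)
  have "p s (lam s (a \<xi>)) = a (p s (lam s \<xi>))" if a: "a \<in> N" and \<xi>: "\<xi> \<in> L2" for a \<xi>
  proof -
    have l: "lam s \<xi> \<in> L2" using s \<xi> by (rule lam_ell2)
    have "p s (lam s (a \<xi>)) = p s (sg s a (lam s \<xi>))" using lam_N[OF s a \<xi>] by simp
    also have "\<dots> = sg s a (p s (lam s \<xi>))" using N_commute[OF p_in_N sg_in_N[OF s a] l] .
    also have "\<dots> = a (p s (lam s \<xi>))" using p_in_V[OF l] a by (simp add: V_def)
    finally show ?thesis .
  qed
  then have "op_mult (carrier G) (p s) (lam s) (a \<xi>) = a (op_mult (carrier G) (p s) (lam s) \<xi>)"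
    if "a \<in> N" "\<xi> \<in> L2" for a \<xi> using that N_ell2[OF that] by simp
  then show "op_mult (carrier G) (p s) (lam s) \<in> commutant N"
    using right_comm_mult[OF N_right_comm[OF p_in_N] right_comm_lam[OF s]] by (simp add: commutant_def)
qed

end

lemma V_ell2: "\<zeta> \<in> V s \<Longrightarrow> \<zeta> \<in> L2" by (simp add: V_def)

text \<open>The products of \<open>p s\<close> with \<open>lam s\<close> and of \<open>p t\<close>
  with \<open>lam t\<close> lie in the abelian \<open>N\<close>, so translations by
  \<open>s \<otimes> t\<close> and by \<open>t \<otimes> s\<close> agree under both projections. A
  vector in both ranges is then fixed by a nontrivial group element.\<close>

lemma V_disjoint:
  assumes tf: "torsion_free G" and s: "s \<in> carrier G" and t: "t \<in> carrier G"
    and ne: "s \<otimes> t \<noteq> t \<otimes> s" and \<zeta>: "\<zeta> \<in> V s" "\<zeta> \<in> V t"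
  shows "\<zeta> = 0"
proof -
  note z = V_ell2[OF \<zeta>(1)]
  have swap: "p t (p s (lam (s \<otimes> t) \<xi>)) = p t (p s (lam (t \<otimes> s) \<xi>))" if \<xi>: "\<xi> \<in> L2" for \<xi>
  proof -
    have ls: "lam s \<xi> \<in> L2" "lam t \<xi> \<in> L2" "lam s (lam t \<xi>) \<in> L2" "lam t (lam s \<xi>) \<in> L2"
      using s t \<xi> by (auto intro: lam_ell2)
    have "op_mult (carrier G) (p s) (lam s) (p t (lam t \<xi>)) = p t (op_mult (carrier G) (p s) (lam s) (lam t \<xi>))"
      by (rule N_commute[OF p_lam_in_N[OF s] p_in_N[OF t] ls(2)])
    moreover have "op_mult (carrier G) (p t) (lam t) (p s (lam s \<xi>)) = p s (op_mult (carrier G) (p t) (lam t) (lam s \<xi>))"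
      by (rule N_commute[OF p_lam_in_N[OF t] p_in_N[OF s] ls(1)])
    moreover have "op_mult (carrier G) (p s) (lam s) (op_mult (carrier G) (p t) (lam t) \<xi>)
        = op_mult (carrier G) (p t) (lam t) (op_mult (carrier G) (p s) (lam s) \<xi>)"
      by (rule N_commute[OF p_lam_in_N[OF s] p_lam_in_N[OF t] \<xi>])
    moreover have "p s (p t (lam t (lam s \<xi>))) = p t (p s (lam t (lam s \<xi>)))"
      by (rule N_commute[OF p_in_N[OF s] p_in_N[OF t] ls(4)])
    ultimately show ?thesis
      using \<xi> s t ls by (simp add: lam_mult)
  qed
  \<comment> \<open>Pairing with \<zeta>, which both projections fix, removes the projections and
    moves the translations to the other side as inverses.\<close>
  have "lam (inv (s \<otimes> t)) \<zeta> = lam (inv (t \<otimes> s)) \<zeta>"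
  proof (rule ell2_inner_ext)
    have move: "ip (p t (p s (lam g \<xi>))) \<zeta> = ip \<xi> (lam (inv g) \<zeta>)" if "g \<in> carrier G" "\<xi> \<in> L2" for g \<xi>
    proof -
      have "ip (p t (p s (lam g \<xi>))) \<zeta> = ip (lam g \<xi>) (p s (p t \<zeta>))"
        using that z by (simp add: p_self_adjoint[OF t] p_self_adjoint[OF s] lam_ell2 N_ell2[OF p_in_N[OF s]] N_ell2[OF p_in_N[OF t]])
      then show ?thesis using that z \<zeta> by (simp add: p_fix[OF s] p_fix[OF t] lam_adj)
    qed
    fix \<xi> assume "\<xi> \<in> L2"
    then show "ip \<xi> (lam (inv (s \<otimes> t)) \<zeta>) = ip \<xi> (lam (inv (t \<otimes> s)) \<zeta>)"
      using move[of "s \<otimes> t" \<xi>] move[of "t \<otimes> s" \<xi>] swap[of \<xi>] s t by simp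
  qed (use z s t in \<open>auto intro!: lam_ell2\<close>)
  then have "lam (t \<otimes> s) (lam (inv (s \<otimes> t)) \<zeta>) = \<zeta>"
    using z s t by (simp add: lam_inv)
  then have f: "lam (t \<otimes> s \<otimes> inv (s \<otimes> t)) \<zeta> = \<zeta>"
    using z s t by (simp add: lam_mult)
  have "t \<otimes> s \<otimes> inv (s \<otimes> t) \<noteq> \<one>"
  proof
    assume "t \<otimes> s \<otimes> inv (s \<otimes> t) = \<one>"
    then have "t \<otimes> s = s \<otimes> t" using s t by (metis inv_closed inv_equality inv_inv m_closed)
    then show False using ne by simp
  qed
  then show ?thesis using lam_fixed_eq_0[OF tf _ _ z f] s t by blast
qed

text \<open>Both ranges are invariant under \<open>N\<close>, so \<open>p s (p t \<eta>)\<close>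
  lies in their intersection.\<close>

lemma p_orthogonal:
  assumes tf: "torsion_free G" and s: "s \<in> carrier G" and t: "t \<in> carrier G"
    and ne: "s \<otimes> t \<noteq> t \<otimes> s" and "\<xi> \<in> L2" "\<eta> \<in> L2"
  shows "ip (p s \<xi>) (p t \<eta>) = 0"
proof -
  have l: "p t \<eta> \<in> L2" using assms by (simp add: N_ell2[OF p_in_N[OF t]])
  have "p s (p t \<eta>) \<in> V t" using V_N[OF t p_in_N[OF s] p_in_V[OF t]] assms by blast
  then have "p s (p t \<eta>) = 0" using V_disjoint[OF tf s t ne p_in_V[OF s l]] by blast
  then show ?thesis using p_self_adjoint[OF s _ l] assms by simp
qed

lemma V_conj:
  assumes g: "g \<in> carrier G" and s: "s \<in> carrier G" and \<zeta>: "\<zeta> \<in> V s"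
  shows "lam g \<zeta> \<in> V (g \<otimes> s \<otimes> inv g)"
proof -
  note z = V_ell2[OF \<zeta>]
  have "a (lam g \<zeta>) = sg (g \<otimes> s \<otimes> inv g) a (lam g \<zeta>)" if a: "a \<in> N" for a
  proof -
    let ?b = "sg (inv g) a"
    have b: "?b \<in> N" using sg_in_N[OF inv_closed[OF g] a] .
    have "a (lam g \<zeta>) = lam g (?b \<zeta>)" using g z N_ell2[OF a] by (simp add: sg_apply lam_inv lam_ell2)
    also have "\<dots> = lam g (sg s ?b \<zeta>)" using \<zeta> b by (simp add: V_def)
    also have "\<dots> = sg (g \<otimes> s \<otimes> inv g) a (lam g \<zeta>)"
      using g s z N_ell2[OF a]
      by (simp add: sg_apply lam_ell2 lam_mult inv_mult_group m_assoc)
    finally show ?thesis .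
  qed
  then show ?thesis using lam_ell2[OF g z] by (simp add: V_def)
qed

lemma p_conj:
  assumes g: "g \<in> carrier G" and s: "s \<in> carrier G" and \<xi>: "\<xi> \<in> L2"
  shows "p (g \<otimes> s \<otimes> inv g) \<xi> = lam g (p s (lam (inv g) \<xi>))"
proof -
  let ?s = "g \<otimes> s \<otimes> inv g"
  have s': "?s \<in> carrier G" using g s by simp
  have l: "lam (inv g) \<xi> \<in> L2" using g \<xi> by (simp add: lam_ell2)
  have pl: "p s (lam (inv g) \<xi>) \<in> L2" using N_ell2[OF p_in_N[OF s] l] .
  have conj_back: "inv g \<otimes> ?s \<otimes> inv (inv g) = s" using g s by (simp add: m_assoc inv_cancel)
  show ?thesis
    unfolding p_def[of ?s]
  proof (rule proj_op_eqI[OF W_subset[OF s'] \<xi>], unfold orth_W[OF s'])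
    show "lam g (p s (lam (inv g) \<xi>)) \<in> V ?s" by (rule V_conj[OF g s p_in_V[OF s l]])
    have "ip (\<xi> - lam g (p s (lam (inv g) \<xi>))) v = 0" if v: "v \<in> V ?s" for v
    proof -
      have vl: "v \<in> L2" using V_ell2[OF v] .
      have v': "lam (inv g) v \<in> V s" using V_conj[OF inv_closed[OF g] s' v] conj_back by simp
      have "ip (lam g (p s (lam (inv g) \<xi>))) v = ip (p s (lam (inv g) \<xi>)) (lam (inv g) v)"
        using lam_adj[OF g pl vl] .
      also have "\<dots> = ip (lam (inv g) \<xi>) (lam (inv g) v)"
        using p_self_adjoint[OF s l V_ell2[OF v']] p_fix[OF s v'] by simp
      also have "\<dots> = ip \<xi> v" using g \<xi> vl by (simp add: lam_inner)
      finally show ?thesis using \<xi> vl pl g by (simp add: ell2_inner_diff lam_ell2)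
    qed
    then show "\<xi> - lam g (p s (lam (inv g) \<xi>)) \<in> orth (carrier G) (V ?s)"
      using \<xi> pl g by (auto simp: orth_def ell2_diff lam_ell2)
  qed
qed

text \<open>Conjugation invariance of the trace, seen on vectors: \<open>lam (inv g)\<close> and
  \<open>rtr g\<close> agree on \<open>delta \<one>\<close>, and right translations commute with
  \<open>p s\<close>.\<close>

lemma p_conj_norm:
  assumes g: "g \<in> carrier G" and s: "s \<in> carrier G"
  shows "nrm (p (g \<otimes> s \<otimes> inv g) (delta \<one>)) = nrm (p s (delta \<one>))"
proof -
  have d: "delta \<one> \<in> L2" by (simp add: delta_ell2)
  have "lam (inv g) (delta \<one>) = rtr g (delta \<one>)" using g by (simp add: lam_delta rtr_delta)
  then have "p (g \<otimes> s \<otimes> inv g) (delta \<one>) = lam g (rtr g (p s (delta \<one>)))"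
    using p_conj[OF g s d] right_commD(2)[OF N_right_comm[OF p_in_N[OF s]] g d] by simp
  then show ?thesis using g N_ell2[OF p_in_N[OF s] d] by (simp add: lam_norm rtr_ell2 rtr_norm)
qed

lemma p_inner_delta:
  assumes s: "s \<in> carrier G"
  shows "ip (p s (delta \<one>)) (delta \<one>) = of_real ((nrm (p s (delta \<one>)))\<^sup>2)"
  unfolding p_def by (rule proj_op_inner_self[OF W_subset[OF s]]) (simp add: delta_ell2)

text \<open>The vectors \<open>e g\<close> have a common squared norm \<open>q\<close> and, coming
  from projections, also pair with \<open>delta \<one>\<close> to \<open>q\<close>. If they were
  pairwise orthogonal, Cauchy-Schwarz for their sum would give \<open>card I * q \<le> 1\<close>; so
  any \<open>n\<close> above \<open>1 / q\<close> works.\<close>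

lemma recurrent_of_nonzero:
  assumes tf: "torsion_free G" and s: "s \<in> carrier G" and nz: "p s (delta \<one>) \<noteq> 0"
  shows "\<exists>n. conj_recurrent G s n"
proof -
  have d: "delta \<one> \<in> L2" by (simp add: delta_ell2)
  define q where "q = (nrm (p s (delta \<one>)))\<^sup>2"
  have q: "q > 0" using nz ell2_norm_eq_0[OF N_ell2[OF p_in_N[OF s] d]] by (simp add: q_def)
  obtain n where n: "1 / q < real n" using reals_Archimedean2 by blast
  have "\<exists>g\<in>I. \<exists>h\<in>I. g \<noteq> h \<and> commute_conj G s (inv g \<otimes> h)"
    if I: "finite I" "I \<subseteq> carrier G" "n < card I" for I
  proof (rule ccontr)
    assume no: "\<not> ?thesis"
    define c where "c g = g \<otimes> s \<otimes> inv g" for g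
    have c: "c g \<in> carrier G" if "g \<in> I" for g using that I s by (auto simp: c_def)
    define e where "e g = p (c g) (delta \<one>)" for g
    have e: "e g \<in> L2" if "g \<in> I" for g unfolding e_def by (rule N_ell2[OF p_in_N[OF c[OF that]] d])
    have nc: "c g \<otimes> c h \<noteq> c h \<otimes> c g" if gh: "g \<in> I" "h \<in> I" "g \<noteq> h" for g h
    proof
      have gc: "g \<in> carrier G" "h \<in> carrier G" using gh I by auto
      assume eq: "c g \<otimes> c h = c h \<otimes> c g"
      let ?k = "inv g \<otimes> h"
      have "s \<otimes> (?k \<otimes> s \<otimes> inv ?k) = inv g \<otimes> (c g \<otimes> c h) \<otimes> g"
        using gc s by (simp add: c_def inv_mult_group m_assoc inv_cancel)
      also have "\<dots> = inv g \<otimes> (c h \<otimes> c g) \<otimes> g" by (simp only: eq)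
      also have "\<dots> = (?k \<otimes> s \<otimes> inv ?k) \<otimes> s"
        using gc s by (simp add: c_def inv_mult_group m_assoc inv_cancel)
      finally show False using no gh by (auto simp: commute_conj_def)
    qed
    have orth: "ip (e g) (e h) = (if g = h then of_real q else 0)" if "g \<in> I" "h \<in> I" for g h
    proof (cases "g = h")
      case True
      have "nrm (e g) = nrm (p s (delta \<one>))"
        unfolding e_def c_def using that I s by (intro p_conj_norm) auto
      then show ?thesis using True ell2_inner_self[OF e[OF that(1)]] by (simp add: q_def)
    next
      case False
      then show ?thesis unfolding e_def
        using p_orthogonal[OF tf c[OF that(1)] c[OF that(2)] nc[OF that False] d d] by simp
    qed
    define w where "w = (\<Sum>g\<in>I. e g)"
    have w: "w \<in> L2" unfolding w_def by (rule ell2_sum[OF e])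
    have "ip w w = (\<Sum>h\<in>I. \<Sum>g\<in>I. ip (e g) (e h))"
      unfolding w_def by (simp add: ell2_inner_sum e ell2_sum)
    also have "\<dots> = (\<Sum>h\<in>I. \<Sum>g\<in>I. if g = h then of_real q else 0)"
      by (intro sum.cong refl orth)
    also have "\<dots> = of_real (real (card I) * q)" using I by simp
    finally have ww: "(nrm w)\<^sup>2 = real (card I) * q"
      using ell2_inner_self[OF w] of_real_eq_iff by metis
    have "ip w (delta \<one>) = (\<Sum>g\<in>I. ip (e g) (delta \<one>))" unfolding w_def by (simp add: ell2_inner_sum e d)
    also have "\<dots> = (\<Sum>g\<in>I. of_real q)"
    proof (intro sum.cong refl)
      fix g assume g: "g \<in> I"
      have "nrm (e g) = nrm (p s (delta \<one>))"
        unfolding e_def c_def using g I s by (intro p_conj_norm) auto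
      then show "ip (e g) (delta \<one>) = of_real q"
        using p_inner_delta[OF c[OF g]] by (simp add: e_def q_def)
    qed
    also have "\<dots> = of_real (real (card I) * q)" by simp
    finally have "cmod (ip w (delta \<one>)) = real (card I) * q"
      using q by (simp only: norm_of_real) simp
    then have "real (card I) * q \<le> nrm w"
      using ell2_cauchy_schwarz[OF w d] by simp
    then have "(real (card I) * q)\<^sup>2 \<le> real (card I) * q"
      using power_mono[of "real (card I) * q" "nrm w" 2] q by (simp only: ww) simp
    moreover have c1: "real (card I) * q > 1"
    proof -
      have "1 < real n * q" using n q by (simp add: field_simps)
      also have "\<dots> \<le> real (card I) * q" using I q by (intro mult_right_mono) auto
      finally show ?thesis .
    qed
    ultimately show False
      using mult_strict_right_mono[OF c1 order.strict_trans[OF zero_less_one c1]]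
      by (simp only: power2_eq_square mult_1)
  qed
  then show ?thesis unfolding conj_recurrent_def by blast
qed

text \<open>\<open>E\<close> projects onto the closure of \<open>N\<close> applied to
  \<open>delta \<one>\<close>, the Hilbert space form of the conditional expectation onto
  \<open>N\<close>. The vector \<open>E (delta s)\<close> lies in \<open>V s\<close>, which is zero
  for \<open>s \<noteq> \<one>\<close>, so elements of \<open>N\<close> have no coefficient at
  \<open>s\<close>. Hence \<open>N\<close> is scalar and, being its own commutant, contains every
  \<open>lam t\<close>.\<close>

lemma trivial_of_zero:
  assumes zero: "\<And>s. s \<in> carrier G \<Longrightarrow> s \<noteq> \<one> \<Longrightarrow> p s (delta \<one>) = 0"
  shows "carrier G = {\<one>}"
proof -
  let ?A = "carrier G"
  have d: "delta \<one> \<in> L2" by (simp add: delta_ell2)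
  define K where "K = (\<lambda>a. a (delta \<one>)) ` N"
  have K: "K \<subseteq> L2" using N_ell2[OF _ d] by (auto simp: K_def)
  note O = orth_subset[of ?A K]
  define E where "E = proj_op ?A (orth ?A K)"
  \<comment> \<open>By the convolution formula an element of L(\<Gamma>) that kills
    \<open>delta \<one>\<close> is zero; so \<open>p s\<close> vanishes, and with it its
    range.\<close>
  have V0: "\<zeta> = 0" if s: "s \<in> carrier G" "s \<noteq> \<one>" and \<zeta>: "\<zeta> \<in> V s" for s \<zeta>
  proof (rule L2_eqI[OF V_ell2[OF \<zeta>] ell2_zero])
    fix u assume u: "u \<in> carrier G"
    have "\<zeta> u = p s \<zeta> u" using p_fix[OF s(1) \<zeta>] by simp
    also have "\<dots> = 0"
      using right_comm_conv[OF N_right_comm[OF p_in_N[OF s(1)]] V_ell2[OF \<zeta>] u] zero[OF s]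
      by (simp add: vec_apply)
    finally show "\<zeta> u = 0 u" by (simp add: vec_apply)
  qed
  have Kmult: "a v \<in> K" if a: "a \<in> N" and v: "v \<in> K" for a v
  proof -
    obtain b where b: "b \<in> N" "v = b (delta \<one>)" using v by (auto simp: K_def)
    have "op_mult ?A a b \<in> N" using N_star a b by (simp add: star_subalgebra_def)
    moreover have "op_mult ?A a b (delta \<one>) = a v" using d b by simp
    ultimately show ?thesis unfolding K_def by (metis image_eqI)
  qed
  have KO: "a v \<in> orth ?A (orth ?A K)" if a: "a \<in> N" and v: "v \<in> orth ?A (orth ?A K)" for a v
  proof (rule orth_translate[OF O _ _ _ v, of a "adjoint_op ?A a"])
    fix w assume w: "w \<in> orth ?A K"
    show "adjoint_op ?A a w \<in> orth ?A K"
      by (rule orth_translate[OF K _ _ _ w, of "adjoint_op ?A a" a])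
        (auto simp: N_ell2[OF N_adj[OF a]] adjoint_op_inner'[OF N_bounded[OF a]] Kmult[OF a])
  qed (auto simp: N_ell2[OF a] adjoint_op_inner[OF N_bounded[OF a]])
  have E_fix: "E v = v" if "v \<in> K" for v
    unfolding E_def using that orth_orth_superset[OF K] by (intro proj_op_fix[OF O]) auto
  have coeff: "a (delta \<one>) s = 0" if a: "a \<in> N" and s: "s \<in> carrier G" "s \<noteq> \<one>" for a s
  proof -
    define f where "f = E (delta s)"
    have ds: "delta s \<in> L2" using s by (simp add: delta_ell2)
    have fO: "f \<in> orth ?A (orth ?A K)" unfolding f_def E_def by (rule proj_op_in[OF O ds])
    have fl: "f \<in> L2" using orth_ell2[OF fO] .
    have f_ip: "ip f v = ip (delta s) v" if "v \<in> K" for v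
      using proj_op_self_adjoint[OF O ds, of v] E_fix[OF that] that K by (auto simp: f_def E_def)
    have "f \<in> V s"
      unfolding V_def
    proof (intro CollectI conjI fl ballI)
      fix c assume c: "c \<in> N"
      note sgc = sg_in_N[OF s(1) c]
      \<comment> \<open>Vectors of \<open>K\<close> cannot distinguish \<open>f\<close> from
        \<open>delta s\<close>, so the pairing becomes the value at \<open>\<one>\<close> of a
        product applied to \<open>delta s\<close>.\<close>
      have move: "ip (c' f) (b (delta \<one>)) = (adjoint_op ?A b) (c' (delta s)) \<one>"
        if c': "c' \<in> N" and b: "b \<in> N" for c' b
      proof -
        have bd: "b (delta \<one>) \<in> K" using b by (auto simp: K_def)
        have bl: "b (delta \<one>) \<in> L2" using N_ell2[OF b d] .
        have "ip (c' f) (b (delta \<one>)) = ip f (adjoint_op ?A c' (b (delta \<one>)))"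
          by (rule adjoint_op_inner[OF N_bounded[OF c'] fl bl])
        also have "\<dots> = ip (delta s) (adjoint_op ?A c' (b (delta \<one>)))"
          by (rule f_ip[OF Kmult[OF N_adj[OF c'] bd]])
        also have "\<dots> = ip (c' (delta s)) (b (delta \<one>))"
          by (rule adjoint_op_inner[OF N_bounded[OF c'] ds bl, symmetric])
        also have "\<dots> = ip (adjoint_op ?A b (c' (delta s))) (delta \<one>)"
          by (rule adjoint_op_inner'[OF N_bounded[OF b] N_ell2[OF c' ds] d, symmetric])
        finally show ?thesis by (simp add: ell2_inner_delta)
      qed
      have "ip (c f - sg s c f) w = 0" if "w \<in> K" for w
      proof -
        obtain b where b: "b \<in> N" and w: "w = b (delta \<one>)" using \<open>w \<in> K\<close> by (auto simp: K_def)
        note b' = N_adj[OF b]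
        have sgd: "sg s c (delta s) = lam s (c (delta \<one>))"
          using s d ds by (simp add: sg_apply lam_delta)
        have "ip (sg s c f) w = (adjoint_op ?A b) (lam s (c (delta \<one>))) \<one>"
          using move[OF sgc b] by (simp add: w sgd)
        also have "\<dots> = op_mult ?A (adjoint_op ?A b) (lam s) (c (delta \<one>)) \<one>"
          using N_ell2[OF c d] by simp
        \<comment> \<open>The trace property carries \<open>c\<close> to the front, where it
          commutes with the adjoint of \<open>b\<close>. This identifies the pairing of
          \<open>sg s c f\<close> with that of \<open>c f\<close>.\<close>
        also have "\<dots> = c (op_mult ?A (adjoint_op ?A b) (lam s) (delta \<one>)) \<one>"
          by (rule trace_commute[OF right_comm_mult[OF N_right_comm[OF b'] right_comm_lam[OF s(1)]] N_right_comm[OF c]])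
        also have "\<dots> = c (adjoint_op ?A b (delta s)) \<one>" using d s by (simp add: lam_delta)
        also have "\<dots> = adjoint_op ?A b (c (delta s)) \<one>" by (simp only: N_commute[OF c b' ds])
        also have "\<dots> = ip (c f) w" using move[OF c b] by (simp add: w)
        finally show ?thesis
          using N_ell2[OF c fl] N_ell2[OF sgc fl] N_ell2[OF b d] by (simp add: ell2_inner_diff w)
      qed
      then have "c f - sg s c f \<in> orth ?A K"
        using N_ell2[OF c fl] N_ell2[OF sgc fl] by (auto simp: orth_def ell2_diff)
      moreover have "c f - sg s c f \<in> orth ?A (orth ?A K)"
        by (rule l2_subspaceD(5)[OF subspace_orth[OF O] KO[OF c fO] KO[OF sgc fO]])
      ultimately have "c f - sg s c f = 0" by (rule orth_inter_0)
      then show "c f = sg s c f" by simp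
    qed
    then have "f = 0" using V0[OF s] by blast
    moreover have "a (delta \<one>) \<in> K" using a by (auto simp: K_def)
    ultimately have "ip (delta s) (a (delta \<one>)) = 0" using f_ip[of "a (delta \<one>)"] by simp
    then show ?thesis using s by (simp add: ell2_inner_delta)
  qed
  have scalar: "a = op_scale ?A (a (delta \<one>) \<one>) (op_id ?A)" if a: "a \<in> N" for a
  proof (rule right_comm_eqI[OF N_right_comm[OF a] right_comm_scale[OF right_comm_id]])
    show "a (delta \<one>) = op_scale ?A (a (delta \<one>) \<one>) (op_id ?A) (delta \<one>)"
      by (rule L2_eqI) (use N_ell2[OF a d] d coeff[OF a] in \<open>auto simp: ell2_scale scale_vec_apply delta_apply\<close>)
  qed
  have "t = \<one>" if t: "t \<in> carrier G" for t
  proof -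
    have "lam t \<in> commutant N"
      unfolding commutant_def
    proof (intro CollectI conjI right_comm_lam[OF t] ballI)
      fix a \<xi> assume a: "a \<in> N" and \<xi>: "\<xi> \<in> L2"
      have *: "a \<eta> = scale_vec (a (delta \<one>) \<one>) \<eta>" if "\<eta> \<in> L2" for \<eta>
        by (subst scalar[OF a]) (simp add: that)
      show "lam t (a \<xi>) = a (lam t \<xi>)"
        using \<xi> t by (simp add: * lam_ell2 bounded_opsD(3)[OF lam_bounded])
    qed
    then have "lam t (delta \<one>) t = 0" if "t \<noteq> \<one>"
      using coeff[OF commutant_in_N t that] by blast
    then show ?thesis using t lam_delta[OF t one_closed] by (auto simp: delta_apply)
  qed
  then show ?thesis by blast
qed

theorem invariant_masa_recurrent:
  assumes "torsion_free G" "carrier G \<noteq> {\<one>}"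
  shows "\<exists>s\<in>carrier G. s \<noteq> \<one> \<and> (\<exists>n. conj_recurrent G s n)"
  using trivial_of_zero recurrent_of_nonzero[OF assms(1)] assms(2) by blast

end

section \<open>Hyperbolic groups\<close>

text \<open>The normalized counting measures of \<open>X j\<close> live in a compact cube and have a
  cluster point. A translate of \<open>X j\<close> is a subset of \<open>Y j\<close> of the same
  size, and \<open>Y j\<close> exceeds \<open>X j\<close> by a fraction 1 / (j + 1) at most, so the
  defect of invariance vanishes in the limit.\<close>

lemma folner_amenable:
  fixes G (structure) and X Y :: "nat \<Rightarrow> 'a set"
  assumes "group G"
    and X: "\<And>j. finite (X j)" "\<And>j. X j \<subseteq> carrier G" "\<And>j. X j \<noteq> {}" "\<And>j. X j \<subseteq> Y j"
    and Y: "\<And>j. finite (Y j)" "\<And>j. real (card (Y j)) \<le> (1 + 1 / real (Suc j)) * real (card (X j))"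
    and tr: "\<And>s. s \<in> carrier G \<Longrightarrow> \<forall>\<^sub>F j in sequentially. (\<lambda>x. s \<otimes>\<^bsub>G\<^esub> x) ` X j \<subseteq> Y j"
  shows "amenable G"
proof -
  interpret group G by fact
  define m where "m j E = real (card (E \<inter> X j)) / real (card (X j))" for j E
  have pos: "real (card (X j)) > 0" for j using X by (simp add: card_gt_0_iff)
  define K where "K = (PiE UNIV (\<lambda>_. {0..1}) :: ('a set \<Rightarrow> real) set)"
  have "compact K"
    using compactin_PiE[of "\<lambda>_. euclideanreal" UNIV "\<lambda>_. {0..1}"]
    unfolding K_def euclidean_product_topology compactin_euclidean_iff by auto
  have mK: "m j \<in> K" for j
    using X(1)[of j] pos[of j] by (auto simp: K_def m_def card_mono)
  define F where "F = filtermap m sequentially"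
  have "F \<noteq> bot" by (simp add: F_def filtermap_bot_iff)
  moreover have "eventually (\<lambda>x. x \<in> K) F" using mK by (simp add: F_def eventually_filtermap)
  ultimately obtain \<mu> where \<mu>: "\<mu> \<in> K" "inf (nhds \<mu>) F \<noteq> bot"
    using \<open>compact K\<close> unfolding compact_filter by blast
  \<comment> \<open>A cluster point in this large product need not be the limit of a subsequence.
    The filter converges to \<mu> and refines the tails of \<open>m\<close>, so whatever holds
    eventually along the sequence passes to \<mu>.\<close>
  define F' where "F' = inf (nhds \<mu>) F"
  have F'ne: "F' \<noteq> bot" using \<mu> by (simp add: F'_def)
  have lim: "((\<lambda>\<nu>. \<nu> E) \<longlongrightarrow> \<mu> E) F'" for E
  proof -
    have "((\<lambda>\<nu>. \<nu> E) \<longlongrightarrow> \<mu> E) (nhds \<mu>)"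
    proof (rule topological_tendstoI)
      fix O' :: "real set" assume O': "open O'" "\<mu> E \<in> O'"
      have "open ((\<lambda>\<nu>. \<nu> E) -` O')"
        by (rule open_vimage[OF O'(1) continuous_on_product_coordinates])
      then show "\<forall>\<^sub>F \<nu> in nhds \<mu>. \<nu> E \<in> O'" using O'(2) unfolding eventually_nhds by auto
    qed
    then show ?thesis by (rule tendsto_mono[rotated]) (simp add: F'_def)
  qed
  have ev: "eventually P F'" if "eventually (\<lambda>j. P (m j)) sequentially" for P
  proof -
    have "eventually P F" using that by (simp add: F_def eventually_filtermap)
    then show ?thesis by (rule filter_leD[rotated]) (simp add: F'_def)
  qed
  have Mu_unique: "\<mu> E = c" if "eventually (\<lambda>\<nu>. \<nu> E = c) F'" for E c
    by (rule tendsto_unique[OF F'ne lim tendsto_eventually[OF that]])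
  show ?thesis
    unfolding amenable_def
  proof (intro exI[of _ \<mu>] conjI allI impI ballI)
    fix E show "0 \<le> \<mu> E" using \<mu>(1) by (auto simp: K_def PiE_iff)
  next
    show "\<mu> (carrier G) = 1"
    proof (rule Mu_unique[OF ev])
      have "carrier G \<inter> X j = X j" for j using X(2)[of j] by auto
      then show "eventually (\<lambda>j. m j (carrier G) = 1) sequentially" using pos by (simp add: m_def)
    qed
  next
    fix E E' assume E: "E \<subseteq> carrier G \<and> E' \<subseteq> carrier G \<and> E \<inter> E' = {}"
    have "m j (E \<union> E') = m j E + m j E'" for j
    proof -
      have "card ((E \<union> E') \<inter> X j) = card (E \<inter> X j) + card (E' \<inter> X j)"
        unfolding Int_Un_distrib2 using X(1)[of j] E by (intro card_Un_disjoint) auto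
      then show ?thesis by (simp add: m_def add_divide_distrib)
    qed
    then have "eventually (\<lambda>\<nu>. \<nu> (E \<union> E') = \<nu> E + \<nu> E') F'" by (intro ev) simp
    moreover have "((\<lambda>\<nu>. \<nu> E + \<nu> E') \<longlongrightarrow> \<mu> E + \<mu> E') F'" by (intro tendsto_add lim)
    ultimately have "((\<lambda>\<nu>. \<nu> (E \<union> E')) \<longlongrightarrow> \<mu> E + \<mu> E') F'" by (simp add: tendsto_cong)
    then show "\<mu> (E \<union> E') = \<mu> E + \<mu> E'" by (rule tendsto_unique[OF F'ne lim])
  next
    fix s E assume s: "s \<in> carrier G" and E: "E \<subseteq> carrier G"
    have coset: "s <# E = (\<lambda>x. s \<otimes> x) ` E" by (auto simp: l_coset_def)
    have close: "\<bar>m j (s <# E) - m j E\<bar> \<le> 1 / real (Suc j)" if inv: "(\<lambda>x. inv s \<otimes> x) ` X j \<subseteq> Y j" for j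
    proof -
      define X' where "X' = (\<lambda>x. inv s \<otimes> x) ` X j"
      have inj: "inj_on (\<lambda>x. inv s \<otimes> x) (X j)" using X(2)[of j] s by (intro inj_onI) (simp add: subset_iff)
      have cX': "card X' = card (X j)" unfolding X'_def by (rule card_image[OF inj])
      have fin: "finite X'" using X by (simp add: X'_def)
      have "(s <# E) \<inter> X j = (\<lambda>x. s \<otimes> x) ` (E \<inter> X')"
      proof (intro subset_antisym subsetI)
        fix y assume y: "y \<in> (s <# E) \<inter> X j"
        then obtain e where e: "e \<in> E" "y = s \<otimes> e" by (auto simp: coset)
        then have "e = inv s \<otimes> y" using s E by (auto simp: inv_cancel)
        then show "y \<in> (\<lambda>x. s \<otimes> x) ` (E \<inter> X')" using e y by (auto simp: X'_def)
      next
        fix y assume "y \<in> (\<lambda>x. s \<otimes> x) ` (E \<inter> X')"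
        then obtain e x where e: "e \<in> E" "y = s \<otimes> e" "e = inv s \<otimes> x" "x \<in> X j" by (auto simp: X'_def)
        then have "y = x" using s X(2)[of j] by (auto simp: inv_cancel)
        moreover have "y \<in> s <# E" unfolding coset e(2) using e(1) by (rule imageI)
        ultimately show "y \<in> (s <# E) \<inter> X j" using e(4) by simp
      qed
      moreover have "inj_on (\<lambda>x. s \<otimes> x) (E \<inter> X')" using E s by (intro inj_onI) (auto simp: subset_iff)
      ultimately have c: "card ((s <# E) \<inter> X j) = card (E \<inter> X')" by (simp add: card_image)
      \<comment> \<open>Points of \<open>E\<close> in \<open>Z\<close> lie in \<open>Z'\<close> or
        among the few points of \<open>Y j\<close> outside \<open>Z'\<close>. This is used in both
        directions between \<open>X j\<close> and its translate.\<close>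
      have le: "card (E \<inter> Z) \<le> card (E \<inter> Z') + (card (Y j) - card Z')" if "Z \<subseteq> Y j" "Z' \<subseteq> Y j" for Z Z'
      proof -
        have f: "finite Z" "finite Z'"
          using finite_subset[OF that(1) Y(1)] finite_subset[OF that(2) Y(1)] by auto
        have "card (E \<inter> Z) \<le> card ((E \<inter> Z') \<union> (Y j - Z'))"
          using that f Y(1)[of j] by (intro card_mono) auto
        also have "\<dots> \<le> card (E \<inter> Z') + card (Y j - Z')" by (rule card_Un_le)
        also have "card (Y j - Z') = card (Y j) - card Z'" using that f by (simp add: card_Diff_subset)
        finally show ?thesis .
      qed
      have "card (X j) \<le> card (Y j)" using X(4) Y(1) by (simp add: card_mono)
      then have "\<bar>real (card (E \<inter> X')) - real (card (E \<inter> X j))\<bar> \<le> real (card (Y j)) - real (card (X j))"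
        using le[of X' "X j"] le[of "X j" X'] inv X(4)[of j] cX' unfolding X'_def by linarith
      also have "\<dots> \<le> real (card (X j)) / real (Suc j)" using Y(2)[of j] by (simp add: algebra_simps)
      finally have "\<bar>real (card (E \<inter> X')) - real (card (E \<inter> X j))\<bar> / real (card (X j)) \<le> 1 / real (Suc j)"
        using pos[of j] by (simp add: divide_le_eq)
      then show ?thesis using pos[of j] by (simp add: m_def c diff_divide_distrib[symmetric] abs_divide)
    qed
    have "\<bar>\<mu> (s <# E) - \<mu> E\<bar> \<le> e" if "e > 0" for e
    proof (rule tendsto_upperbound[OF _ _ F'ne])
      show "((\<lambda>\<nu>. \<bar>\<nu> (s <# E) - \<nu> E\<bar>) \<longlongrightarrow> \<bar>\<mu> (s <# E) - \<mu> E\<bar>) F'"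
        by (intro tendsto_rabs tendsto_diff lim)
      have "eventually (\<lambda>j. 1 / real (Suc j) < e) sequentially" using \<open>e > 0\<close> by real_asymp
      then have "eventually (\<lambda>j. \<bar>m j (s <# E) - m j E\<bar> \<le> e) sequentially"
        using tr[OF inv_closed[OF s]]
      proof eventually_elim
        case (elim j)
        then show ?case using close[OF elim(2)] by linarith
      qed
      then show "\<forall>\<^sub>F \<nu> in F'. \<bar>\<nu> (s <# E) - \<nu> E\<bar> \<le> e" by (rule ev)
    qed
    then have "\<bar>\<mu> (s <# E) - \<mu> E\<bar> \<le> 0" using field_le_epsilon[of "\<bar>\<mu> (s <# E) - \<mu> E\<bar>" 0] by simp
    then show "\<mu> (s <# E) = \<mu> E" by simp
  qed
qed

lemma quadratic_not_exponential:
  fixes M :: real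
  assumes "c > 1"
  shows "\<exists>k::nat. M * (real k + 1)\<^sup>2 < c ^ k"
proof -
  have "(\<lambda>k. (real k + 1)\<^sup>2 / c ^ k) \<longlonglongrightarrow> 0" using assms by real_asymp
  then have "(\<lambda>k. M * ((real k + 1)\<^sup>2 / c ^ k)) \<longlonglongrightarrow> M * 0" by (rule tendsto_mult_left)
  then have "eventually (\<lambda>k. M * ((real k + 1)\<^sup>2 / c ^ k) < 1) sequentially"
    by (rule order_tendstoD) simp
  then obtain k where "M * ((real k + 1)\<^sup>2 / c ^ k) < 1" by (auto simp: eventually_sequentially)
  then have "M * (real k + 1)\<^sup>2 < c ^ k" using assms by (simp add: field_simps)
  then show ?thesis ..
qed

text \<open>If for some \<open>j\<close> every enlargement of the radius by j + 1 multiplied the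
  size by more than 1 + 1 / (j + 1), growth would be exponential. So each \<open>j\<close> has a
  radius satisfying the inequality of \<open>folner_amenable\<close>, and the enlargement j + 1
  eventually exceeds the shift caused by any fixed \<open>s\<close>.\<close>

lemma quadratic_growth_amenable:
  fixes B :: "nat \<Rightarrow> 'a set"
  assumes G: "group G"
    and B: "\<And>n. finite (B n)" "\<And>n. B n \<subseteq> carrier G" "\<And>n. B n \<noteq> {}"
      "\<And>m n. m \<le> n \<Longrightarrow> B m \<subseteq> B n"
    and tr: "\<And>s. s \<in> carrier G \<Longrightarrow> \<exists>k. \<forall>n. (\<lambda>x. s \<otimes>\<^bsub>G\<^esub> x) ` B n \<subseteq> B (n + k)"
    and growth: "\<And>n. real (card (B n)) \<le> M * (real n + 1)\<^sup>2"
  shows "amenable G"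
proof -
  have "\<exists>n. real (card (B (n + Suc j))) \<le> (1 + 1 / real (Suc j)) * real (card (B n))" for j
  proof (rule ccontr)
    assume "\<not> ?thesis"
    then have gr: "(1 + 1 / real (Suc j)) * real (card (B n)) < real (card (B (n + Suc j)))" for n
      by (simp add: not_le)
    let ?c = "1 + 1 / real (Suc j)"
    have lower: "?c ^ k \<le> real (card (B (k * Suc j)))" for k
    proof (induction k)
      case 0
      have "0 < card (B 0)" using B(1,3)[of 0] by (simp add: card_gt_0_iff)
      then show ?case by simp
    next
      case (Suc k)
      have "?c ^ Suc k = ?c * ?c ^ k" by simp
      also have "\<dots> \<le> ?c * real (card (B (k * Suc j)))" by (rule mult_left_mono[OF Suc]) simp
      also have "\<dots> \<le> real (card (B (k * Suc j + Suc j)))" using gr[of "k * Suc j"] by simp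
      also have "k * Suc j + Suc j = Suc k * Suc j" by simp
      finally show ?case .
    qed
    have "M \<ge> 0" using growth[of 0] of_nat_0_le_iff[of "card (B 0)"] by (auto intro: order_trans)
    obtain k where k: "(M * (real (Suc j))\<^sup>2) * (real k + 1)\<^sup>2 < ?c ^ k"
      using quadratic_not_exponential[of ?c "M * (real (Suc j))\<^sup>2"] by auto
    have "?c ^ k \<le> M * (real (k * Suc j) + 1)\<^sup>2" using lower[of k] growth[of "k * Suc j"] by linarith
    also have "\<dots> \<le> M * (real (Suc j) * (real k + 1))\<^sup>2"
      using \<open>M \<ge> 0\<close> by (intro mult_left_mono power_mono) (auto simp: algebra_simps)
    also have "\<dots> = (M * (real (Suc j))\<^sup>2) * (real k + 1)\<^sup>2" by (simp only: power_mult_distrib mult.assoc)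
    finally show False using k by linarith
  qed
  then obtain N where N: "\<And>j. real (card (B (N j + Suc j))) \<le> (1 + 1 / real (Suc j)) * real (card (B (N j)))"
    by metis
  show ?thesis
  proof (rule folner_amenable[OF G, of "\<lambda>j. B (N j)" "\<lambda>j. B (N j + Suc j)"])
    fix s assume "s \<in> carrier G"
    then obtain k where k: "\<And>n. (\<lambda>x. s \<otimes>\<^bsub>G\<^esub> x) ` B n \<subseteq> B (n + k)" using tr by blast
    have "(\<lambda>x. s \<otimes>\<^bsub>G\<^esub> x) ` B (N j) \<subseteq> B (N j + Suc j)" if "j \<ge> k" for j
    proof -
      have "B (N j + k) \<subseteq> B (N j + Suc j)" by (rule B(4)) (use that in simp)
      then show ?thesis using k[of "N j"] by blast
    qed
    then show "\<forall>\<^sub>F j in sequentially. (\<lambda>x. s \<otimes>\<^bsub>G\<^esub> x) ` B (N j) \<subseteq> B (N j + Suc j)"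
      by (auto simp: eventually_sequentially)
  qed (use B N in auto)
qed

section \<open>Words, and covering a group by commuting conjugates\<close>

context group
begin

abbreviation listprod where "listprod ws \<equiv> foldr (\<otimes>) ws \<one>"

lemma listprod_closed: "set ws \<subseteq> carrier G \<Longrightarrow> listprod ws \<in> carrier G"
  by (induction ws) auto

lemma listprod_append:
  "set us \<subseteq> carrier G \<Longrightarrow> set ws \<subseteq> carrier G \<Longrightarrow> listprod (us @ ws) = listprod us \<otimes> listprod ws"
  by (induction us) (auto simp: m_assoc listprod_closed)

lemma listprod_inv:
  "set ws \<subseteq> carrier G \<Longrightarrow> inv (listprod ws) = listprod (rev (map (m_inv G) ws))"
proof (induction ws)
  case (Cons a ws)
  then have "set (rev (map (m_inv G) ws)) \<subseteq> carrier G" by auto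
  with Cons show ?case
    using listprod_append[of "rev (map (m_inv G) ws)" "[inv a]"]
    by (auto simp: inv_mult_group listprod_closed simp del: foldr_append)
qed simp

text \<open>Conjugating the commuting pair by \<open>inv k\<close>. It makes the relation between
  two conjugators symmetric.\<close>

lemma commute_conj_inv:
  assumes s: "s \<in> carrier G" and k: "k \<in> carrier G" and c: "commute_conj G s k"
  shows "commute_conj G s (inv k)"
proof -
  have "s \<otimes> (inv k \<otimes> s \<otimes> inv (inv k)) = inv k \<otimes> ((k \<otimes> s \<otimes> inv k) \<otimes> s) \<otimes> k"
    using s k by (simp add: m_assoc inv_cancel)
  also have "\<dots> = inv k \<otimes> (s \<otimes> (k \<otimes> s \<otimes> inv k)) \<otimes> k" using c by (simp only: commute_conj_def)
  also have "\<dots> = (inv k \<otimes> s \<otimes> inv (inv k)) \<otimes> s" using s k by (simp add: m_assoc inv_cancel)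
  finally show ?thesis by (simp add: commute_conj_def)
qed

text \<open>Conjugators with pairwise non-commuting conjugates number at most \<open>n\<close>, so a
  largest set of them exists, and by maximality every \<open>g\<close> is related to a member. Thus
  finitely many translates of the set of \<open>k\<close> with \<open>commute_conj G s k\<close>
  cover the group.\<close>

lemma conj_recurrent_cover:
  assumes s: "s \<in> carrier G" and rec: "conj_recurrent G s n"
  shows "\<exists>I. finite I \<and> I \<subseteq> carrier G \<and> (\<forall>g\<in>carrier G. \<exists>h\<in>I. commute_conj G s (inv h \<otimes> g))"
proof -
  define P where "P I \<longleftrightarrow> finite I \<and> I \<subseteq> carrier G \<and>
    (\<forall>g\<in>I. \<forall>h\<in>I. g \<noteq> h \<longrightarrow> \<not> commute_conj G s (inv g \<otimes> h))" for I
  have bound: "card I < Suc n" if "P I" for I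
    using rec that unfolding conj_recurrent_def P_def by (meson not_less_eq)
  have "P {}" by (simp add: P_def)
  then obtain I where I: "P I" and max: "\<And>J. P J \<Longrightarrow> card J \<le> card I"
    using ex_has_greatest_nat[of P "{}" card "Suc n"] bound less_imp_le by blast
  have cov: "\<exists>h\<in>I. commute_conj G s (inv h \<otimes> g)" if g: "g \<in> carrier G" for g
  proof (cases "g \<in> I")
    case True
    then show ?thesis using s g by (intro bexI[of _ g]) (simp_all add: commute_conj_def)
  next
    case False
    have nP: "\<not> P (insert g I)"
    proof
      assume "P (insert g I)"
      then have "card (insert g I) \<le> card I" by (rule max)
      moreover have "finite I" using I by (simp add: P_def)
      ultimately show False using False by simp
    qed
    have "\<exists>h\<in>I. commute_conj G s (inv g \<otimes> h) \<or> commute_conj G s (inv h \<otimes> g)"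
    proof (rule ccontr)
      assume "\<not> ?thesis"
      then have "P (insert g I)" using I g unfolding P_def by auto
      then show False using nP by contradiction
    qed
    then obtain h where h: "h \<in> I" "commute_conj G s (inv g \<otimes> h) \<or> commute_conj G s (inv h \<otimes> g)"
      by blast
    have hc: "h \<in> carrier G" using h I by (auto simp: P_def)
    have "inv (inv g \<otimes> h) = inv h \<otimes> g" using g hc by (simp add: inv_mult_group)
    then have "commute_conj G s (inv h \<otimes> g)"
      using h(2) commute_conj_inv[OF s, of "inv g \<otimes> h"] g hc by auto
    then show ?thesis using h by blast
  qed
  have "finite I" "I \<subseteq> carrier G" using I by (simp_all add: P_def)
  then show ?thesis using cov by (intro exI[of _ I] conjI ballI)
qed

end

section \<open>Word metrics\<close>

locale word_metric = group +
  fixes S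
  assumes S: "finite S" "S \<subseteq> carrier G" "generate G S = carrier G"
begin

abbreviation wl where "wl \<equiv> word_length G S"
abbreviation wd where "wd \<equiv> word_dist G S"

definition gens where "gens = S \<union> m_inv G ` S"

lemma gens: "finite gens" "gens \<subseteq> carrier G" "\<And>a. a \<in> gens \<Longrightarrow> inv a \<in> gens"
  using S by (auto simp: gens_def)

lemma word_exists: "g \<in> carrier G \<Longrightarrow> \<exists>ws. set ws \<subseteq> gens \<and> listprod ws = g"
proof -
  assume "g \<in> carrier G"
  then have "g \<in> generate G S" by (simp add: S)
  then show ?thesis
  proof (induction rule: generate.induct)
    case one then show ?case by (intro exI[of _ "[]"]) simp
  next
    case (incl h) then show ?case using S by (intro exI[of _ "[h]"]) (auto simp: gens_def)
  next
    case (inv h) then show ?case using S by (intro exI[of _ "[inv h]"]) (auto simp: gens_def)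
  next
    case (eng h1 h2)
    then obtain us ws where "set us \<subseteq> gens" "listprod us = h1" "set ws \<subseteq> gens" "listprod ws = h2" by blast
    then show ?case using listprod_append[of us ws] gens(2) by (intro exI[of _ "us @ ws"]) auto
  qed
qed

lemma wl_def: "wl g = (LEAST k. \<exists>ws. length ws = k \<and> set ws \<subseteq> gens \<and> listprod ws = g)"
  by (simp add: word_length_def gens_def)

lemma wl_word:
  assumes "g \<in> carrier G"
  obtains ws where "length ws = wl g" "set ws \<subseteq> gens" "listprod ws = g"
proof -
  have "\<exists>ws. length ws = wl g \<and> set ws \<subseteq> gens \<and> listprod ws = g"
    unfolding wl_def by (rule LeastI_ex) (use word_exists[OF assms] in blast)
  then show ?thesis using that by blast
qed

lemma wl_le: "set ws \<subseteq> gens \<Longrightarrow> wl (listprod ws) \<le> length ws"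
  unfolding wl_def by (rule Least_le) blast

lemma wl_one [simp]: "wl \<one> = 0" using wl_le[of "[]"] by simp

lemma wl_mult: "g \<in> carrier G \<Longrightarrow> h \<in> carrier G \<Longrightarrow> wl (g \<otimes> h) \<le> wl g + wl h"
proof -
  assume g: "g \<in> carrier G" and h: "h \<in> carrier G"
  obtain us where us: "length us = wl g" "set us \<subseteq> gens" "listprod us = g" using wl_word[OF g] .
  obtain ws where ws: "length ws = wl h" "set ws \<subseteq> gens" "listprod ws = h" using wl_word[OF h] .
  show ?thesis using wl_le[of "us @ ws"] us ws listprod_append[of us ws] gens(2) by auto
qed

lemma wl_inv_le: "g \<in> carrier G \<Longrightarrow> wl (inv g) \<le> wl g"
proof -
  assume g: "g \<in> carrier G"
  obtain us where us: "length us = wl g" "set us \<subseteq> gens" "listprod us = g" using wl_word[OF g] .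
  have "set (rev (map (m_inv G) us)) \<subseteq> gens" using us gens(3) by auto
  then show ?thesis using wl_le[of "rev (map (m_inv G) us)"] listprod_inv[of us] us gens(2) by auto
qed

lemma wl_inv [simp]: "g \<in> carrier G \<Longrightarrow> wl (inv g) = wl g"
  using wl_inv_le[of g] wl_inv_le[of "inv g"] by simp

definition wball where "wball n = {g \<in> carrier G. wl g \<le> n}"

lemma wball_finite: "finite (wball n)"
proof -
  have "wball n \<subseteq> listprod ` {ws. set ws \<subseteq> gens \<and> length ws \<le> n}"
  proof
    fix g assume g: "g \<in> wball n"
    then have gc: "g \<in> carrier G" by (simp add: wball_def)
    obtain us where us: "length us = wl g" "set us \<subseteq> gens" "listprod us = g" using wl_word[OF gc] .
    then show "g \<in> listprod ` {ws. set ws \<subseteq> gens \<and> length ws \<le> n}"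
      using g by (intro image_eqI[of _ _ us]) (auto simp: wball_def)
  qed
  then show ?thesis using finite_lists_length_le[OF gens(1)] finite_subset by blast
qed

lemma wd_eq: "wd x y = real (wl (inv x \<otimes> y))" by (simp add: word_dist_def)

lemma wd_sym: "x \<in> carrier G \<Longrightarrow> y \<in> carrier G \<Longrightarrow> wd x y = wd y x"
  using wl_inv[of "inv x \<otimes> y"] by (simp add: wd_eq inv_mult_group)

lemma wd_left: "g \<in> carrier G \<Longrightarrow> x \<in> carrier G \<Longrightarrow> y \<in> carrier G \<Longrightarrow> wd (g \<otimes> x) (g \<otimes> y) = wd x y"
  by (simp add: wd_eq inv_mult_group m_assoc inv_cancel)

lemma wd_triangle:
  assumes "x \<in> carrier G" "y \<in> carrier G" "z \<in> carrier G"
  shows "wd x z \<le> wd x y + wd y z"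
  using wl_mult[of "inv x \<otimes> y" "inv y \<otimes> z"] assms by (simp add: wd_eq m_assoc inv_cancel)

text \<open>Prefixes of a shortest word: prefix and suffix are shortest as well, since a shortcut in
  either would shorten the whole.\<close>

lemma geodesic:
  assumes x: "x \<in> carrier G"
  obtains \<gamma> where "\<And>i. i \<le> wl x \<Longrightarrow> \<gamma> i \<in> carrier G \<and> wl (\<gamma> i) = i \<and> wl (inv (\<gamma> i) \<otimes> x) = wl x - i"
proof -
  obtain ws where ws: "length ws = wl x" "set ws \<subseteq> gens" "listprod ws = x" using wl_word[OF x] .
  have tc: "set (take i ws) \<subseteq> gens" "set (drop i ws) \<subseteq> gens" for i
    using ws(2) set_take_subset[of i ws] set_drop_subset[of i ws] by blast+
  have "listprod (take i ws) \<in> carrier G \<and> wl (listprod (take i ws)) = i \<and>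
      wl (inv (listprod (take i ws)) \<otimes> x) = wl x - i" if i: "i \<le> wl x" for i
  proof -
    let ?p = "listprod (take i ws)" and ?q = "listprod (drop i ws)"
    have c: "?p \<in> carrier G" "?q \<in> carrier G" using subset_trans[OF tc(1) gens(2)] subset_trans[OF tc(2) gens(2)] by (simp_all add: listprod_closed)
    have "x = listprod (take i ws @ drop i ws)" using ws(3) by simp
    also have "\<dots> = ?p \<otimes> ?q" using tc[of i] gens(2) by (intro listprod_append) auto
    finally have pq: "x = ?p \<otimes> ?q" .
    have p: "wl ?p \<le> i" using wl_le[OF tc(1)[of i]] i ws(1) by simp
    have q: "wl ?q \<le> wl x - i" using wl_le[OF tc(2)[of i]] ws(1) by simp
    have "wl x \<le> wl ?p + wl ?q" using wl_mult[OF c] pq by simp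
    then have "wl ?p = i" "wl ?q = wl x - i" using p q i by linarith+
    moreover have "inv ?p \<otimes> x = ?q" using pq c by (metis inv_cancel(1))
    ultimately show ?thesis using c by simp
  qed
  then show ?thesis by (rule that[of "\<lambda>i. listprod (take i ws)"])
qed

end

section \<open>Growth in a group with the four-point condition\<close>

locale hyperbolic_metric = word_metric +
  fixes \<delta> :: real
  assumes hyp: "\<forall>w\<in>carrier G. \<forall>x\<in>carrier G. \<forall>y\<in>carrier G. \<forall>z\<in>carrier G.
        gromov_product (word_dist G S) w x z \<ge>
          min (gromov_product (word_dist G S) w x y) (gromov_product (word_dist G S) w y z) - \<delta>"
begin

lemma delta_nonneg: "\<delta> \<ge> 0"
  using hyp[rule_format, OF one_closed one_closed one_closed one_closed] by (simp add: gromov_product_def)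

text \<open>The condition with the base point treated like the other three points; clearing the
  factor 1/2 of the Gromov products doubles \<delta>.\<close>

lemma four_point:
  assumes "w \<in> carrier G" "x \<in> carrier G" "y \<in> carrier G" "z \<in> carrier G"
  shows "wd x z + wd y w \<le> max (wd x y + wd z w) (wd y z + wd x w) + 2 * \<delta>"
proof -
  let ?g = "gromov_product wd w"
  have "min (?g x y) (?g y z) \<le> ?g x z + \<delta>" using hyp[rule_format, OF assms] by simp
  then have "?g x y \<le> ?g x z + \<delta> \<or> ?g y z \<le> ?g x z + \<delta>" by linarith
  then have "wd x z + wd y w \<le> wd x y + wd z w + 2 * \<delta> \<or> wd x z + wd y w \<le> wd y z + wd x w + 2 * \<delta>"
    unfolding gromov_product_def by (auto simp: field_simps)
  then show ?thesis by linarith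
qed

text \<open>A centralizing element of length at most \<open>n\<close> moves a long geodesic from \<open>\<one>\<close> to a power of \<open>s\<close>
  along itself: it is determined by the translation length and by a displacement of bounded size.\<close>

lemma centralizer_growth:
  assumes tf: "torsion_free G" and s: "s \<in> carrier G" "s \<noteq> \<one>"
  defines "D \<equiv> card (wball (nat \<lfloor>6 * \<delta>\<rfloor>))"
  shows "card {c \<in> carrier G. c \<otimes> s = s \<otimes> c \<and> wl c \<le> n} \<le> (2 * n + 1) * D"
proof -
  define C where "C = {c \<in> carrier G. c \<otimes> s = s \<otimes> c \<and> wl c \<le> n}"
  \<comment> \<open>Powers of \<open>s\<close> are distinct and balls are finite, so some power
    leaves the ball. Radius \<open>2 * n\<close> leaves room for \<open>\<alpha> c\<close>, which
    can reach that value on the geodesic.\<close>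
  have "\<not> range (\<lambda>k::nat. s [^] k) \<subseteq> wball (2 * n)"
    using finite_subset[OF _ wball_finite] range_inj_infinite[OF torsion_free_inj[OF tf s]] by blast
  then obtain m :: nat where "s [^] m \<notin> wball (2 * n)" by blast
  then have m: "wl (s [^] m) > 2 * n" using s by (simp add: wball_def)
  define x where "x = s [^] m"
  have x: "x \<in> carrier G" using s by (simp add: x_def)
  define R where "R = wl x"
  have R: "R > 2 * n" using m by (simp add: R_def x_def)
  obtain \<gamma> where \<gamma>: "\<And>i. i \<le> R \<Longrightarrow> \<gamma> i \<in> carrier G \<and> wl (\<gamma> i) = i \<and> wl (inv (\<gamma> i) \<otimes> x) = R - i"
    using geodesic[OF x] unfolding R_def by blast
  \<comment> \<open>At depth \<open>n\<close> the displacements of the two endpoints, each at most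
    \<open>n\<close>, no longer decide the maxima in the four-point inequalities \<open>f1\<close>
    and \<open>f2\<close>.\<close>
  define p where "p = \<gamma> n"
  have p: "p \<in> carrier G" "wd \<one> p = n" "wd p \<one> = n" "wd p x = real R - n"
    using \<gamma>[of n] R wd_sym[of \<one> p] by (auto simp: p_def wd_eq)
  define \<alpha> where "\<alpha> c = wl (inv p \<otimes> c)" for c
  \<comment> \<open>The first entry selects on the translated geodesic the point as far from
    \<open>c\<close> as \<open>p\<close> is; the second is the displacement from \<open>p\<close> to
    that point, to be shown short. Together they recover \<open>c\<close>.\<close>
  define f where "f c = (\<alpha> c, inv p \<otimes> (c \<otimes> \<gamma> (\<alpha> c)))" for c
  have main: "f c \<in> {..2 * n} \<times> wball (nat \<lfloor>6 * \<delta>\<rfloor>) \<and> c = p \<otimes> snd (f c) \<otimes> inv (\<gamma> (fst (f c)))"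
    if c: "c \<in> C" for c
  proof -
    have cc: "c \<in> carrier G" "c \<otimes> s = s \<otimes> c" "wl c \<le> n" using c by (auto simp: C_def)
    have cx: "c \<otimes> x = x \<otimes> c"
      unfolding x_def using group_commutes_pow[of s c m] s cc by simp
    have cxc: "c \<otimes> x \<in> carrier G" using cc x by simp
    have d1: "wd \<one> c \<le> n" "wd c \<one> \<le> n" using cc wd_sym[of \<one> c] by (auto simp: wd_eq)
    have d2: "wd (c \<otimes> x) x \<le> n"
    proof -
      have "wd x (c \<otimes> x) = wl c" using x cc cx by (simp add: wd_eq inv_cancel)
      then show ?thesis using wd_sym[OF x cxc] cc by simp
    qed
    have dR: "wd \<one> x = R" "wd x \<one> = R" using x wd_sym[of \<one> x] by (auto simp: wd_eq R_def)
    have dR': "wd c (c \<otimes> x) = R" using wd_left[of c \<one> x] cc x dR by simp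
    have a: "real (\<alpha> c) = wd p c" by (simp add: \<alpha>_def wd_eq)
    have a2: "wd p c \<le> 2 * n" using wd_triangle[OF p(1) one_closed cc(1)] p d1 by simp
    then have "\<alpha> c \<le> 2 * n" using a by linarith
    then have g: "\<gamma> (\<alpha> c) \<in> carrier G" "wl (\<gamma> (\<alpha> c)) = \<alpha> c" "wl (inv (\<gamma> (\<alpha> c)) \<otimes> x) = R - \<alpha> c"
      using \<gamma>[of "\<alpha> c"] R by auto
    define q where "q = c \<otimes> \<gamma> (\<alpha> c)"
    have q: "q \<in> carrier G" using cc g by (simp add: q_def)
    have q1: "wd c q = wd p c" "wd q c = wd p c"
      using wd_left[of c \<one> "\<gamma> (\<alpha> c)"] cc g a wd_sym[OF cc(1) q] by (auto simp: q_def wd_eq)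
    have q2: "wd q (c \<otimes> x) = R - wd p c"
      using wd_left[of c "\<gamma> (\<alpha> c)" x] cc g x a \<open>\<alpha> c \<le> 2 * n\<close> R by (auto simp: q_def wd_eq)
    have e1: "real R \<le> wd c x + n"
      using wd_triangle[OF one_closed cc(1) x] d1 dR by simp
    \<comment> \<open>Each of the three inequalities costs \<open>2 * \<delta>\<close>. Adding
      \<open>f1\<close> and \<open>f2\<close> cancels \<open>wd c x\<close> and bounds
      \<open>wd p c + wd p (c \<otimes> x)\<close> by \<open>R + 4 * \<delta>\<close>;
      \<open>f3\<close> then yields the constant 6.\<close>
    have f1: "wd p c + R \<le> wd c x + n + 2 * \<delta>"
      using four_point[OF x p(1) one_closed cc(1)] p d1 dR e1 by simp
    have f2: "wd p (c \<otimes> x) + wd c x \<le> 2 * real R - n + 2 * \<delta>"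
      using four_point[OF x p(1) cc(1) cxc] p d2 dR' a2 R by (simp add: max_def split: if_splits)
    have f3: "wd p q + R \<le> max (wd p c + (R - wd p c)) (wd p c + wd p (c \<otimes> x)) + 2 * \<delta>"
      using four_point[OF cxc p(1) cc(1) q] q1 q2 dR' by simp
    have "wd p q \<le> 6 * \<delta>" using f1 f2 f3 delta_nonneg by (simp add: max_def split: if_splits)
    then have "wl (inv p \<otimes> q) \<le> nat \<lfloor>6 * \<delta>\<rfloor>" by (simp add: wd_eq le_nat_floor)
    moreover have "c = p \<otimes> (inv p \<otimes> q) \<otimes> inv (\<gamma> (\<alpha> c))"
      using p cc g by (simp add: q_def inv_cancel m_assoc)
    ultimately show ?thesis
      using \<open>\<alpha> c \<le> 2 * n\<close> p q by (simp add: f_def q_def[symmetric] wball_def)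
  qed
  then have inj: "inj_on f C" by (intro inj_onI) metis
  have "card C \<le> card ({..2 * n} \<times> wball (nat \<lfloor>6 * \<delta>\<rfloor>))"
  proof (rule card_inj_on_le[OF inj])
    show "f ` C \<subseteq> {..2 * n} \<times> wball (nat \<lfloor>6 * \<delta>\<rfloor>)" using main by blast
  qed (simp add: wball_finite)
  also have "\<dots> = (2 * n + 1) * D" by (simp add: D_def card_cartesian_product)
  finally show ?thesis by (simp only: C_def)
qed

text \<open>Sending \<open>k\<close> to the conjugate of \<open>s\<close> by \<open>k\<close> gives
  values in the centralizer of \<open>s\<close>, of length at most \<open>2 * n + wl s\<close>; two
  elements of one fibre differ by a centralizing element of length at most \<open>2 * n\<close>.
  Both counts are linear, so their product is quadratic.\<close>

lemma recurrent_growth: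
  assumes tf: "torsion_free G" and s: "s \<in> carrier G" "s \<noteq> \<one>"
  defines "D \<equiv> card (wball (nat \<lfloor>6 * \<delta>\<rfloor>))"
  shows "card {k \<in> carrier G. commute_conj G s k \<and> wl k \<le> n} \<le> ((2 * (2 * n + wl s) + 1) * D) * ((2 * (2 * n) + 1) * D)"
proof -
  define H where "H = {k \<in> carrier G. commute_conj G s k \<and> wl k \<le> n}"
  define C where "C n = {c \<in> carrier G. c \<otimes> s = s \<otimes> c \<and> wl c \<le> n}" for n
  have Cf: "finite (C n)" for n by (rule finite_subset[OF _ wball_finite[of n]]) (auto simp: C_def wball_def)
  have Cc: "card (C n) \<le> (2 * n + 1) * D" for n
    unfolding C_def D_def by (rule centralizer_growth[OF tf s])
  have Hf: "finite H" by (rule finite_subset[OF _ wball_finite[of n]]) (auto simp: H_def wball_def)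
  define c where "c k = k \<otimes> s \<otimes> inv k" for k
  have cH: "c k \<in> C (2 * n + wl s)" if "k \<in> H" for k
  proof -
    have k: "k \<in> carrier G" "wl k \<le> n" "commute_conj G s k" using that by (auto simp: H_def)
    have "wl (c k) \<le> wl k + wl s + wl (inv k)"
      unfolding c_def using wl_mult[of "k \<otimes> s" "inv k"] wl_mult[of k s] k s by simp
    then show ?thesis using k s by (simp add: C_def c_def commute_conj_def)
  qed
  have fiber: "card {k \<in> H. c k = d} \<le> (2 * (2 * n) + 1) * D" for d
  proof (cases "{k \<in> H. c k = d} = {}")
    case False
    then obtain k0 where k0: "k0 \<in> H" "c k0 = d" by blast
    have k0c: "k0 \<in> carrier G" "wl k0 \<le> n" using k0 by (auto simp: H_def)
    have "card {k \<in> H. c k = d} \<le> card (C (2 * n))"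
    proof (rule card_inj_on_le[where f = "\<lambda>k. inv k0 \<otimes> k"])
      show "inj_on (\<lambda>k. inv k0 \<otimes> k) {k \<in> H. c k = d}"
      proof (rule inj_onI)
        fix x y assume xy: "x \<in> {k \<in> H. c k = d}" "y \<in> {k \<in> H. c k = d}"
          and eq: "inv k0 \<otimes> x = inv k0 \<otimes> y"
        have "x \<in> carrier G" "y \<in> carrier G" using xy by (simp_all add: H_def)
        then show "x = y" using eq k0c by simp
      qed
      show "(\<lambda>k. inv k0 \<otimes> k) ` {k \<in> H. c k = d} \<subseteq> C (2 * n)"
      proof (intro image_subsetI)
        fix k assume "k \<in> {k \<in> H. c k = d}"
        then have k: "k \<in> carrier G" "wl k \<le> n" "c k = c k0" using k0 by (auto simp: H_def)
        have "inv k0 \<otimes> k \<otimes> s = inv k0 \<otimes> c k \<otimes> k" using k(1) k0c s by (simp add: c_def m_assoc)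
        also have "\<dots> = inv k0 \<otimes> c k0 \<otimes> k" by (simp only: k(3))
        also have "\<dots> = s \<otimes> (inv k0 \<otimes> k)" using k(1) k0c s by (simp add: c_def m_assoc inv_cancel)
        finally have "inv k0 \<otimes> k \<otimes> s = s \<otimes> (inv k0 \<otimes> k)" .
        moreover have "wl (inv k0 \<otimes> k) \<le> 2 * n" using wl_mult[of "inv k0" k] k k0c by simp
        ultimately show "inv k0 \<otimes> k \<in> C (2 * n)" using k k0c by (simp add: C_def)
      qed
    qed (rule Cf)
    then show ?thesis using Cc[of "2 * n"] by simp
  next
    case True then show ?thesis by (simp only: card.empty)
  qed
  have "H = (\<Union>d\<in>C (2 * n + wl s). {k \<in> H. c k = d})" using cH by auto
  then have "card H = card (\<Union>d\<in>C (2 * n + wl s). {k \<in> H. c k = d})" by (rule arg_cong)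
  also have "\<dots> \<le> (\<Sum>d\<in>C (2 * n + wl s). card {k \<in> H. c k = d})"
    by (rule card_UN_le[OF Cf])
  also have "\<dots> \<le> (\<Sum>d\<in>C (2 * n + wl s). (2 * (2 * n) + 1) * D)" by (intro sum_mono fiber)
  also have "\<dots> = card (C (2 * n + wl s)) * ((2 * (2 * n) + 1) * D)" by simp
  also have "\<dots> \<le> ((2 * (2 * n + wl s) + 1) * D) * ((2 * (2 * n) + 1) * D)"
    by (rule mult_le_mono1[OF Cc])
  finally show ?thesis by (simp only: H_def)
qed

text \<open>Finitely many translates of the set counted in \<open>recurrent_growth\<close> cover the
  group, so balls grow at most quadratically.\<close>

lemma recurrent_amenable:
  assumes tf: "torsion_free G" and s: "s \<in> carrier G" "s \<noteq> \<one>" and rec: "conj_recurrent G s N"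
  shows "amenable G"
proof -
  obtain I where I: "finite I" "I \<subseteq> carrier G" "\<And>g. g \<in> carrier G \<Longrightarrow> \<exists>h\<in>I. commute_conj G s (inv h \<otimes> g)"
    using conj_recurrent_cover[OF s(1) rec] by blast
  define L where "L = Max (insert 0 (wl ` I))"
  have L: "wl h \<le> L" if "h \<in> I" for h unfolding L_def using I(1) that by (intro Max_ge) auto
  define D where "D = card (wball (nat \<lfloor>6 * \<delta>\<rfloor>))"
  define H where "H n = {k \<in> carrier G. commute_conj G s k \<and> wl k \<le> n}" for n
  have Hf: "finite (H n)" for n by (rule finite_subset[OF _ wball_finite[of n]]) (auto simp: H_def wball_def)
  have sub: "wball n \<subseteq> (\<Union>h\<in>I. (\<lambda>k. h \<otimes> k) ` H (n + L))" for n
  proof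
    fix g assume g: "g \<in> wball n"
    then have gc: "g \<in> carrier G" "wl g \<le> n" by (auto simp: wball_def)
    obtain h where h: "h \<in> I" "commute_conj G s (inv h \<otimes> g)" using I(3)[OF gc(1)] by blast
    have hc: "h \<in> carrier G" using h I by auto
    have "wl (inv h \<otimes> g) \<le> n + L" using wl_mult[of "inv h" g] hc gc L[OF h(1)] by simp
    then have "inv h \<otimes> g \<in> H (n + L)" using h hc gc by (simp add: H_def)
    moreover have "g = h \<otimes> (inv h \<otimes> g)" using hc gc by (simp add: inv_cancel)
    ultimately show "g \<in> (\<Union>h\<in>I. (\<lambda>k. h \<otimes> k) ` H (n + L))" using h by blast
  qed
  \<comment> \<open>Large enough for \<open>q * (n + 1)\<close> to dominate both linear factors of
    \<open>recurrent_growth\<close> at radius \<open>n + L\<close>.\<close>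
  define q where "q = 4 * L + 2 * wl s + 5"
  have card_H: "card (H (n + L)) \<le> (q * (n + 1) * D) * (q * (n + 1) * D)" for n
  proof -
    have "card (H (n + L)) \<le> ((2 * (2 * (n + L) + wl s) + 1) * D) * ((2 * (2 * (n + L)) + 1) * D)"
      unfolding H_def D_def by (rule recurrent_growth[OF tf s])
    also have "\<dots> \<le> (q * (n + 1) * D) * (q * (n + 1) * D)"
      by (intro mult_le_mono order_refl) (auto simp: q_def algebra_simps)
    finally show ?thesis .
  qed
  have growth: "card (wball n) \<le> card I * ((q * (n + 1) * D) * (q * (n + 1) * D))" for n
  proof -
    have "card (wball n) \<le> card (\<Union>h\<in>I. (\<lambda>k. h \<otimes> k) ` H (n + L))"
      using I Hf by (intro card_mono sub) auto
    also have "\<dots> \<le> (\<Sum>h\<in>I. card ((\<lambda>k. h \<otimes> k) ` H (n + L)))" by (rule card_UN_le[OF I(1)])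
    also have "\<dots> \<le> (\<Sum>h\<in>I. card (H (n + L)))" by (intro sum_mono card_image_le Hf)
    also have "\<dots> = card I * card (H (n + L))" by simp
    also have "\<dots> \<le> card I * ((q * (n + 1) * D) * (q * (n + 1) * D))" by (intro mult_le_mono2 card_H)
    finally show ?thesis .
  qed
  show ?thesis
  proof (rule quadratic_growth_amenable[OF is_group, of wball "real (card I * q * q * D * D)"])
    fix n
    have "real (card (wball n)) \<le> real (card I * ((q * (n + 1) * D) * (q * (n + 1) * D)))"
      using growth[of n] of_nat_le_iff by blast
    also have "\<dots> = real (card I * q * q * D * D) * (real n + 1)\<^sup>2"
      by (simp add: power2_eq_square algebra_simps)
    finally show "real (card (wball n)) \<le> real (card I * q * q * D * D) * (real n + 1)\<^sup>2" .
    show "wball n \<noteq> {}" by (auto simp: wball_def intro!: exI[of _ \<one>])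
  next
    fix g assume g: "g \<in> carrier G"
    have "wl (g \<otimes> h) \<le> n + wl g" if "h \<in> carrier G" "wl h \<le> n" for h n
      using wl_mult[OF g that(1)] that(2) by linarith
    then show "\<exists>k. \<forall>n. (\<lambda>x. g \<otimes> x) ` wball n \<subseteq> wball (n + k)"
      using g by (intro exI[of _ "wl g"]) (auto simp: wball_def)
  qed (auto simp: wball_finite[unfolded wball_def] wball_def)
qed

end

theorem hyperbolic_recurrent_amenable:
  assumes "group G" "hyperbolic_group G" "torsion_free G"
    and s: "s \<in> carrier G" "s \<noteq> \<one>\<^bsub>G\<^esub>" and "conj_recurrent G s n"
  shows "amenable G"
proof -
  interpret group G by fact
  obtain S \<delta> where S: "finite S" "S \<subseteq> carrier G" "generate G S = carrier G"
    and h: "\<forall>w\<in>carrier G. \<forall>x\<in>carrier G. \<forall>y\<in>carrier G. \<forall>z\<in>carrier G.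
        gromov_product (word_dist G S) w x z \<ge>
          min (gromov_product (word_dist G S) w x y) (gromov_product (word_dist G S) w y z) - \<delta>"
    using assms(2) unfolding hyperbolic_group_def by blast
  interpret hyperbolic_metric G S \<delta> by unfold_locales (use S h in auto)
  show ?thesis by (rule recurrent_amenable) fact+
qed

text \<open>The point mass is invariant. The lemma serves to show that a non-amenable factor is
  nontrivial.\<close>

lemma trivial_amenable:
  fixes G (structure)
  assumes "group G" "carrier G = {\<one>\<^bsub>G\<^esub>}"
  shows "amenable G"
proof -
  interpret group G by fact
  have c: "\<one> <# E = E" if "E \<subseteq> {\<one>}" for E using that by (force simp: l_coset_def)
  show ?thesis
    unfolding amenable_def
    by (rule exI[of _ "\<lambda>E. if \<one> \<in> E then 1 else 0"]) (auto simp: assms(2) c)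
qed

section \<open>Solving the cocycle equation on a dense set\<close>

lemma ell2_cnj:
  assumes "\<xi> \<in> ell2 A"
  shows "(\<lambda>t. cnj (\<xi> t)) \<in> ell2 A" "ell2_norm A (\<lambda>t. cnj (\<xi> t)) = ell2_norm A \<xi>"
  using assms by (simp_all add: ell2_iff ell2_norm_def)

lemma l2_subspace_sum:
  "l2_subspace A V \<Longrightarrow> (\<And>i. i \<in> I \<Longrightarrow> f i \<in> V) \<Longrightarrow> (\<Sum>i\<in>I. f i) \<in> V"
  by (induction I rule: infinite_finite_induct) (auto simp: l2_subspaceD)

context group
begin

lemma mod_conj_eq: "mod_conj G \<xi> = (\<lambda>t. cnj (permute (carrier G) (m_inv G) \<xi> t))"
  by (auto simp: mod_conj_def permute_def fun_eq_iff)

lemma mod_conj_ell2: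
  assumes "\<xi> \<in> L2" shows "mod_conj G \<xi> \<in> L2" "nrm (mod_conj G \<xi>) = nrm \<xi>"
  using ell2_cnj[OF permute_ell2[OF bij_inv assms]] permute_norm[OF bij_inv]
  by (simp_all add: mod_conj_eq)

lemma mod_conj_add: "mod_conj G (\<xi> + \<eta>) = mod_conj G \<xi> + mod_conj G \<eta>"
  by (auto simp: mod_conj_def fun_eq_iff vec_apply)

section \<open>The right action of L(\<Gamma>) as convolution\<close>

context
  fixes x assumes x: "x \<in> right_comm"
begin

lemma right_act_ell2: "\<eta> \<in> L2 \<Longrightarrow> right_act G \<eta> x \<in> L2"
  unfolding right_act_def by (intro mod_conj_ell2 right_commD(3)[OF right_comm_adjoint[OF x]])

lemma right_act_add:
  assumes "\<xi> \<in> L2" "\<eta> \<in> L2"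
  shows "right_act G (\<xi> + \<eta>) x = right_act G \<xi> x + right_act G \<eta> x"
  unfolding right_act_def mod_conj_add
  using bounded_opsD(2)[OF right_commD(1)[OF right_comm_adjoint[OF x]] mod_conj_ell2(1) mod_conj_ell2(1)] assms
  by (simp add: mod_conj_add)

text \<open>Unwinding the modular conjugation exhibits the action as right convolution by
  \<open>x (delta \<one>)\<close>. In this form it visibly commutes with left translation.\<close>

lemma right_act_apply:
  assumes \<eta>: "\<eta> \<in> L2" and t: "t \<in> carrier G"
  shows "right_act G \<eta> x t = (\<Sum>\<^sub>\<infinity>w\<in>carrier G. \<eta> w * x (delta \<one>) (inv w \<otimes> t))"
proof -
  note xb = right_commD(1)[OF x]
  have u: "inv t \<in> carrier G" using t by simp
  have "adjoint_op (carrier G) x (mod_conj G \<eta>) (inv t) = ip (adjoint_op (carrier G) x (mod_conj G \<eta>)) (delta (inv t))"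
    using u by (simp add: ell2_inner_delta)
  also have "\<dots> = ip (mod_conj G \<eta>) (x (delta (inv t)))"
    by (rule adjoint_op_inner'[OF xb mod_conj_ell2(1)[OF \<eta>] delta_ell2[OF u]])
  also have "\<dots> = (\<Sum>\<^sub>\<infinity>v\<in>carrier G. cnj (\<eta> (inv v) * x (delta \<one>) (v \<otimes> t)))"
    unfolding ell2_inner_def
  proof (intro infsum_cong)
    fix v assume v: "v \<in> carrier G"
    then show "mod_conj G \<eta> v * cnj (x (delta (inv t)) v) = cnj (\<eta> (inv v) * x (delta \<one>) (v \<otimes> t))"
      using right_comm_coeff[OF x u v] t by (simp add: mod_conj_def)
  qed
  also have "\<dots> = cnj (\<Sum>\<^sub>\<infinity>v\<in>carrier G. \<eta> (inv v) * x (delta \<one>) (v \<otimes> t))" by (rule infsum_cnj)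
  also have "(\<Sum>\<^sub>\<infinity>v\<in>carrier G. \<eta> (inv v) * x (delta \<one>) (v \<otimes> t)) = (\<Sum>\<^sub>\<infinity>v\<in>carrier G. \<eta> (inv v) * x (delta \<one>) (inv (inv v) \<otimes> t))"
    by (intro infsum_cong) simp
  also have "\<dots> = (\<Sum>\<^sub>\<infinity>w\<in>carrier G. \<eta> w * x (delta \<one>) (inv w \<otimes> t))"
    by (rule infsum_reindex_bij_betw[OF bij_inv, of "\<lambda>w. \<eta> w * x (delta \<one>) (inv w \<otimes> t)"])
  finally show ?thesis using t by (simp add: right_act_def mod_conj_def[of G "adjoint_op (carrier G) x (mod_conj G \<eta>)"])
qed

lemma right_act_lam:
  assumes s: "s \<in> carrier G" and \<eta>: "\<eta> \<in> L2"
  shows "right_act G (lam s \<eta>) x = lam s (right_act G \<eta> x)"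
proof (rule L2_eqI)
  fix t assume t: "t \<in> carrier G"
  have "right_act G (lam s \<eta>) x t = (\<Sum>\<^sub>\<infinity>w\<in>carrier G. lam s \<eta> w * x (delta \<one>) (inv w \<otimes> t))"
    by (rule right_act_apply[OF lam_ell2[OF s \<eta>] t])
  also have "\<dots> = (\<Sum>\<^sub>\<infinity>w\<in>carrier G. lam s \<eta> (s \<otimes> w) * x (delta \<one>) (inv (s \<otimes> w) \<otimes> t))"
    by (rule infsum_reindex_bij_betw[OF bij_left[OF s], symmetric])
  also have "\<dots> = (\<Sum>\<^sub>\<infinity>w\<in>carrier G. \<eta> w * x (delta \<one>) (inv w \<otimes> (inv s \<otimes> t)))"
    using s t \<eta> by (intro infsum_cong) (simp add: lam_apply inv_cancel inv_mult_group m_assoc)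
  also have "\<dots> = right_act G \<eta> x (inv s \<otimes> t)" using s t \<eta> by (simp add: right_act_apply)
  also have "\<dots> = lam s (right_act G \<eta> x) t" using s t \<eta> by (simp add: lam_apply right_act_ell2)
  finally show "right_act G (lam s \<eta>) x t = lam s (right_act G \<eta> x) t" .
qed (use s \<eta> in \<open>auto intro!: right_act_ell2 lam_ell2\<close>)

end

text \<open>The right regular representation on a direct sum. Closed invariant subspaces are Hilbert
  modules; their von Neumann dimension is the sum of squared norms in
  \<open>graph_trace\<close>.\<close>

definition amp_rtr :: "'i set \<Rightarrow> 'a \<Rightarrow> ('i \<times> 'a \<Rightarrow> complex) \<Rightarrow> ('i \<times> 'a \<Rightarrow> complex)" where
  "amp_rtr I s = permute (I \<times> carrier G) (\<lambda>(i, t). (i, t \<otimes> s))"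

context
  fixes I :: "'i set" and B
  defines "B \<equiv> I \<times> carrier G"
begin

lemma amp_bij: "s \<in> carrier G \<Longrightarrow> bij_betw (\<lambda>(i, t). (i, t \<otimes> s)) B B"
  by (rule bij_betwI[where g = "\<lambda>(i, t). (i, t \<otimes> inv s)"]) (auto simp: B_def m_assoc)

lemma amp_rtr_ell2: "s \<in> carrier G \<Longrightarrow> u \<in> ell2 B \<Longrightarrow> amp_rtr I s u \<in> ell2 B"
  unfolding amp_rtr_def B_def[symmetric] by (rule permute_ell2[OF amp_bij])

lemma amp_rtr_linear:
  "amp_rtr I s (u + w) = amp_rtr I s u + amp_rtr I s w"
  "amp_rtr I s (u - w) = amp_rtr I s u - amp_rtr I s w"
  "amp_rtr I s (scale_vec c u) = scale_vec c (amp_rtr I s u)"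
  by (simp_all add: amp_rtr_def permute_linear)

lemma amp_rtr_mult:
  assumes "s \<in> carrier G" "t \<in> carrier G"
  shows "amp_rtr I s (amp_rtr I t u) = amp_rtr I (s \<otimes> t) u"
proof -
  have "amp_rtr I s (amp_rtr I t u) = permute B (\<lambda>p. (\<lambda>(i, v). (i, v \<otimes> t)) ((\<lambda>(i, v). (i, v \<otimes> s)) p)) u"
    unfolding amp_rtr_def B_def[symmetric] using assms by (intro permute_permute) (auto simp: B_def)
  also have "\<dots> = amp_rtr I (s \<otimes> t) u"
    unfolding amp_rtr_def B_def[symmetric] using assms
    by (intro fun_cong[OF permute_cong]) (auto simp: B_def m_assoc)
  finally show ?thesis .
qed

lemma amp_rtr_one: "u \<in> ell2 B \<Longrightarrow> amp_rtr I \<one> u = u"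
  using ell2_off[of u B] by (auto simp: amp_rtr_def permute_def B_def fun_eq_iff)

lemma amp_rtr_adj:
  assumes "s \<in> carrier G" "u \<in> ell2 B" "w \<in> ell2 B"
  shows "ell2_inner B (amp_rtr I s u) w = ell2_inner B u (amp_rtr I (inv s) w)"
proof -
  have "ell2_inner B (amp_rtr I s u) (amp_rtr I s (amp_rtr I (inv s) w)) = ell2_inner B u (amp_rtr I (inv s) w)"
    unfolding amp_rtr_def B_def[symmetric] by (rule permute_inner[OF amp_bij[OF assms(1)]])
  then show ?thesis using assms by (simp add: amp_rtr_mult amp_rtr_one)
qed

lemma amp_rtr_component:
  assumes "i \<in> I" shows "component (amp_rtr I s u) i = rtr s (component u i)"
  using assms by (auto simp: amp_rtr_def component_def rtr_def permute_def fun_eq_iff)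

lemma amp_rtr_delta:
  assumes "s \<in> carrier G" "t \<in> carrier G" "i \<in> I"
  shows "amp_rtr I s (delta (i, t)) = delta (i, t \<otimes> inv s)"
  using assms by (auto simp: amp_rtr_def permute_def delta_apply fun_eq_iff m_assoc)

lemma orth_amp_rtr:
  assumes s: "s \<in> carrier G" and V: "V \<subseteq> ell2 B" "\<And>t v. t \<in> carrier G \<Longrightarrow> v \<in> V \<Longrightarrow> amp_rtr I t v \<in> V"
    and u: "u \<in> orth B V"
  shows "amp_rtr I s u \<in> orth B V"
  by (rule orth_translate[OF V(1) _ _ _ u, of "amp_rtr I s" "amp_rtr I (inv s)"])
    (use s V amp_rtr_ell2 amp_rtr_adj in auto)

lemma proj_amp_rtr:
  assumes V: "V \<subseteq> ell2 B" "\<And>t v. t \<in> carrier G \<Longrightarrow> v \<in> V \<Longrightarrow> amp_rtr I t v \<in> V"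
    and s: "s \<in> carrier G" and u: "u \<in> ell2 B"
  shows "proj_op B (orth B V) (amp_rtr I s u) = amp_rtr I s (proj_op B (orth B V) u)"
proof -
  have O: "amp_rtr I t v \<in> orth B V" if "t \<in> carrier G" "v \<in> orth B V" for t v
    by (rule orth_amp_rtr[OF that(1) V that(2)])
  have OO: "amp_rtr I t v \<in> orth B (orth B V)" if "t \<in> carrier G" "v \<in> orth B (orth B V)" for t v
    by (rule orth_amp_rtr[OF that(1) orth_subset O that(2)])
  show ?thesis
    by (rule proj_op_commute[OF orth_subset[of B V], of "amp_rtr I s" "amp_rtr I (inv s)"])
      (use s u OO amp_rtr_ell2 amp_rtr_adj in \<open>auto simp: amp_rtr_linear\<close>)
qed

text \<open>Up to the factor \<open>\<epsilon>\<close>, the closed right submodule generated by \<open>\<Theta>\<close> is the graph of convolution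
  with the other components, so its von Neumann dimension is one.\<close>

lemma graph_trace:
  assumes I: "finite I" and o: "o' \<in> I" and \<Theta>: "\<Theta> \<in> ell2 B"
    and \<epsilon>: "\<epsilon> \<noteq> 0" "component \<Theta> o' = scale_vec (of_real \<epsilon>) (delta \<one>)"
  defines "M \<equiv> (\<lambda>t. amp_rtr I t \<Theta>) ` carrier G"
  shows "(\<Sum>i\<in>I. (ell2_norm B (proj_op B (orth B M) (delta (i, \<one>))))\<^sup>2) = 1"
proof -
  define P where "P = proj_op B (orth B M)"
  define e where "e i = delta (i, \<one>)" for i :: 'i
  have M: "M \<subseteq> ell2 B" using \<Theta> by (auto simp: M_def amp_rtr_ell2)
  have Minv: "amp_rtr I t v \<in> M" if t: "t \<in> carrier G" and v: "v \<in> M" for t v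
  proof -
    obtain w where w: "w \<in> carrier G" "v = amp_rtr I w \<Theta>" using v by (auto simp: M_def)
    then have "amp_rtr I t v = amp_rtr I (t \<otimes> w) \<Theta>" using t by (simp add: amp_rtr_mult)
    then show ?thesis using t w by (simp add: M_def)
  qed
  note O = orth_subset[of B M]
  have d: "delta (i, t) \<in> ell2 B" if "i \<in> I" "t \<in> carrier G" for i t
    using that by (intro delta_ell2) (simp add: B_def)
  have Pl: "P u \<in> ell2 B" if "u \<in> ell2 B" for u
    unfolding P_def using proj_op_ell2[OF O that] .
  have self: "ell2_inner B (P u) w = ell2_inner B u (P w)" if "u \<in> ell2 B" "w \<in> ell2 B" for u w
    unfolding P_def using proj_op_self_adjoint[OF O that] .
  have coord: "ell2_inner B u (delta (i, t)) = u (i, t)" "ell2_inner B (delta (i, t)) u = cnj (u (i, t))"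
    if "i \<in> I" "t \<in> carrier G" for u i t
    using that by (simp_all add: ell2_inner_delta B_def)
  have \<Theta>c: "component \<Theta> i \<in> L2" for i using component_ell2[of \<Theta> I "carrier G" i] \<Theta> by (simp add: B_def)
  \<comment> \<open>The modular conjugate of \<open>component \<Theta> i\<close> is the symbol of
    the adjoint convolution; placed in slot \<open>o'\<close> it makes
    \<open>scale_vec (of_real \<epsilon>) (e i) - k i\<close> orthogonal to
    \<open>M\<close>.\<close>
  define k where "k i = family I (\<lambda>j. if j = o' then mod_conj G (component \<Theta> i) else 0)" for i
  have k: "k i \<in> ell2 B" for i
    unfolding k_def B_def using mod_conj_ell2(1)[OF \<Theta>c] by (intro family_ell2[OF I]) auto
  have inner_k: "ell2_inner B u (k i) = ip (component u o') (mod_conj G (component \<Theta> i))" if "u \<in> ell2 B" for u i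
  proof -
    have "ell2_inner B u (k i) = (\<Sum>j\<in>I. ip (component u j) (component (k i) j))"
      using ell2_inner_components[OF I, of u "carrier G" "k i"] that k by (simp add: B_def)
    also have "\<dots> = (\<Sum>j\<in>I. if j = o' then ip (component u o') (mod_conj G (component \<Theta> i)) else 0)"
      by (intro sum.cong refl) (simp add: k_def)
    finally show ?thesis using I o by simp
  qed
  have inner_mod: "ip (mod_conj G \<eta>) (mod_conj G \<xi>) = ip \<xi> \<eta>" if "\<xi> \<in> L2" "\<eta> \<in> L2" for \<xi> \<eta>
  proof -
    have "ip (mod_conj G \<eta>) (mod_conj G \<xi>) = (\<Sum>\<^sub>\<infinity>t\<in>carrier G. \<xi> (inv t) * cnj (\<eta> (inv t)))"
      unfolding ell2_inner_def by (intro infsum_cong) (simp add: mod_conj_def mult.commute)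
    also have "\<dots> = ip \<xi> \<eta>"
      unfolding ell2_inner_def by (rule infsum_reindex_bij_betw[OF bij_inv, of "\<lambda>t. \<xi> t * cnj (\<eta> t)"])
    finally show ?thesis .
  qed
  have "delta (i, \<one>) \<in> ell2 B" if "i \<in> I" for i using d that by simp
  then have e: "e i \<in> ell2 B" if "i \<in> I" for i using that by (simp add: e_def)
  have zM: "scale_vec (of_real \<epsilon>) (e i) - k i \<in> orth B M" if i: "i \<in> I" for i
    unfolding orth_def
  proof (intro CollectI conjI ballI)
    show "scale_vec (of_real \<epsilon>) (e i) - k i \<in> ell2 B" using e[OF i] k by (intro ell2_diff ell2_scale)
    fix v assume "v \<in> M"
    then obtain w where w: "w \<in> carrier G" "v = amp_rtr I w \<Theta>" by (auto simp: M_def)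
    have v: "v \<in> ell2 B" using M \<open>v \<in> M\<close> by auto
    have vi: "v (i, \<one>) = \<Theta> (i, w)" using w i by (simp add: amp_rtr_def)
    have co: "component v o' = scale_vec (of_real \<epsilon>) (delta (inv w))"
      using w o by (simp add: amp_rtr_component \<epsilon>(2) rtr_linear rtr_delta)
    have "ell2_inner B v (k i) = of_real \<epsilon> * ip (delta (inv w)) (mod_conj G (component \<Theta> i))"
      using inner_k[OF v] by (simp add: co)
    also have "\<dots> = of_real \<epsilon> * \<Theta> (i, w)"
      using w by (simp add: ell2_inner_delta mod_conj_def component_def)
    finally have "ell2_inner B v (scale_vec (of_real \<epsilon>) (e i) - k i) = 0"
      using e[OF i] k v coord(1)[OF i one_closed, of v] vi
      by (simp add: ell2_inner_diff ell2_scale e_def)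
    then show "ell2_inner B (scale_vec (of_real \<epsilon>) (e i) - k i) v = 0"
      by (subst ell2_inner_commute) simp
  qed
  \<comment> \<open>Orthogonality to \<open>scale_vec (of_real \<epsilon>) (e i) - k i\<close>
    converts the diagonal trace entry into a pairing in slot \<open>o'\<close>. Self-adjointness and
    equivariance of \<open>P\<close> then express it through the one vector
    \<open>P (e o')\<close>.\<close>
  have trace_term: "of_real (\<epsilon> * (ell2_norm B (P (e i)))\<^sup>2) = ip (component \<Theta> i) (component (P (e o')) i)" if i: "i \<in> I" for i
  proof -
    let ?u = "P (e i)"
    have u: "?u \<in> ell2 B" by (rule Pl[OF e[OF i]])
    have uc: "component ?u o' \<in> L2" "component (P (e o')) i \<in> L2"
      using component_ell2[of _ I "carrier G"] u Pl[OF e[OF o]] by (auto simp: B_def)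
    have "?u \<in> orth B (orth B M)" unfolding P_def by (rule proj_op_in[OF O e[OF i]])
    then have "ell2_inner B ?u (scale_vec (of_real \<epsilon>) (e i) - k i) = 0" using zM[OF i] by (rule orthD)
    then have "of_real \<epsilon> * ell2_inner B ?u (e i) = ell2_inner B ?u (k i)"
      using u e[OF i] k by (simp add: ell2_inner_diff ell2_scale)
    moreover have "ell2_inner B ?u (e i) = of_real ((ell2_norm B ?u)\<^sup>2)"
      unfolding P_def by (rule proj_op_inner_self[OF O e[OF i]])
    ultimately have "of_real (\<epsilon> * (ell2_norm B ?u)\<^sup>2) = ip (component ?u o') (mod_conj G (component \<Theta> i))"
      using inner_k[OF u] by simp
    also have "component ?u o' = mod_conj G (component (P (e o')) i)"
    proof (rule L2_eqI[OF uc(1) mod_conj_ell2(1)[OF uc(2)]])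
      fix v assume v: "v \<in> carrier G"
      have "component ?u o' v = ell2_inner B ?u (delta (o', v))"
        using coord(1)[OF o v] by (simp add: component_def)
      also have "\<dots> = ell2_inner B (e i) (P (delta (o', v)))" by (rule self[OF e[OF i] d[OF o v]])
      also have "\<dots> = cnj (P (delta (o', v)) (i, \<one>))" unfolding e_def by (rule coord(2)[OF i one_closed])
      also have "delta (o', v) = amp_rtr I (inv v) (e o')"
        using v o by (simp add: e_def amp_rtr_delta)
      also have "P (amp_rtr I (inv v) (e o')) = amp_rtr I (inv v) (P (e o'))"
        unfolding P_def using v by (intro proj_amp_rtr[OF M Minv] e[OF o]) auto
      also have "amp_rtr I (inv v) (P (e o')) (i, \<one>) = P (e o') (i, inv v)"
        using v i by (simp add: amp_rtr_def)
      finally show "component ?u o' v = mod_conj G (component (P (e o')) i) v"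
        using v by (simp add: mod_conj_def component_def)
    qed
    finally show ?thesis using inner_mod[OF \<Theta>c uc(2)] by simp
  qed
  \<comment> \<open>Summed over \<open>i\<close> the entries form the inner product of \<Theta> with
    \<open>P (e o')\<close>. As \<open>P\<close> fixes \<Theta>, this is the coefficient \<epsilon>
    in slot \<open>o'\<close>.\<close>
  have "complex_of_real (\<epsilon> * (\<Sum>i\<in>I. (ell2_norm B (P (e i)))\<^sup>2)) = (\<Sum>i\<in>I. of_real (\<epsilon> * (ell2_norm B (P (e i)))\<^sup>2))"
    by (simp add: sum_distrib_left)
  also have "\<dots> = (\<Sum>i\<in>I. ip (component \<Theta> i) (component (P (e o')) i))" by (intro sum.cong refl trace_term)
  also have "\<dots> = ell2_inner B \<Theta> (P (e o'))"
    using ell2_inner_components[OF I, of \<Theta> "carrier G" "P (e o')"] \<Theta> Pl[OF e[OF o]] by (simp add: B_def)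
  also have "\<dots> = ell2_inner B (P \<Theta>) (e o')" by (rule self[OF \<Theta> e[OF o], symmetric])
  also have "P \<Theta> = \<Theta>"
  proof -
    have "\<Theta> \<in> M" unfolding M_def using amp_rtr_one[OF \<Theta>] by (metis image_eqI one_closed)
    then show ?thesis unfolding P_def using orth_orth_superset[OF M] by (intro proj_op_fix[OF O]) auto
  qed
  also have "ell2_inner B \<Theta> (e o') = component \<Theta> o' \<one>"
    using coord(1)[OF o one_closed] by (simp add: e_def component_def)
  also have "\<dots> = of_real \<epsilon>" by (simp add: \<epsilon>(2) vec_apply delta_apply)
  finally have "\<epsilon> * (\<Sum>i\<in>I. (ell2_norm B (P (e i)))\<^sup>2) = \<epsilon>" using of_real_eq_iff by blast
  then show ?thesis using \<epsilon>(1) by (simp add: P_def e_def)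
qed

end

end

lemma component_sum: "component (\<Sum>k\<in>K. f k) i = (\<Sum>k\<in>K. component (f k) i)"
  by (auto simp: component_def fun_eq_iff sum_fun_apply)

lemma component_ell2_zero [simp]: "component 0 i = 0"
  by (simp add: component_def fun_eq_iff vec_apply)

text \<open>Abel summation with weights falling linearly from 1. For \<open>j = m\<close> the last
  term drops out, and only an average of the \<open>u k\<close> separates the sum from
  \<open>u 0\<close>.\<close>

lemma summation_by_parts:
  fixes u :: "nat \<Rightarrow> 'a \<Rightarrow> complex" and m :: real
  assumes "m \<noteq> 0"
  shows "(\<Sum>k<j. scale_vec (of_real (1 - real k / m)) (u k - u (Suc k)))
    = u 0 - scale_vec (of_real (1 / m)) (\<Sum>k\<in>{1..j}. u k) - scale_vec (of_real (1 - real j / m)) (u j)"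
proof (induction j)
  case (Suc j)
  have "scale_vec (of_real (1 - real j / m)) (u j - u (Suc j)) =
      scale_vec (of_real (1 - real j / m)) (u j) - scale_vec (of_real (1 / m)) (u (Suc j))
      - scale_vec (of_real (1 - real (Suc j) / m)) (u (Suc j))"
    using assms by (simp add: fun_eq_iff vec_apply field_simps)
  then have "(\<Sum>k<Suc j. scale_vec (of_real (1 - real k / m)) (u k - u (Suc k))) =
      (u 0 - scale_vec (of_real (1 / m)) (\<Sum>k\<in>{1..j}. u k) - scale_vec (of_real (1 - real j / m)) (u j))
      + (scale_vec (of_real (1 - real j / m)) (u j) - scale_vec (of_real (1 / m)) (u (Suc j))
      - scale_vec (of_real (1 - real (Suc j) / m)) (u (Suc j)))"
    by (simp only: sum.lessThan_Suc Suc)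
  also have "\<dots> = u 0 - (scale_vec (of_real (1 / m)) (\<Sum>k\<in>{1..j}. u k) + scale_vec (of_real (1 / m)) (u (Suc j)))
      - scale_vec (of_real (1 - real (Suc j) / m)) (u (Suc j))"
    by (simp only: algebra_simps)
  also have "scale_vec (of_real (1 / m)) (\<Sum>k\<in>{1..j}. u k) + scale_vec (of_real (1 / m)) (u (Suc j))
      = scale_vec (of_real (1 / m)) (\<Sum>k\<in>{1..Suc j}. u k)"
    by (simp add: scale_vec_distrib)
  finally show ?case .
qed (simp add: fun_eq_iff vec_apply)

context group
begin

lemma rtr_zero [simp]: "rtr t 0 = 0"
  by (simp add: rtr_def permute_linear)

lemma average_norm:
  fixes g :: "nat \<Rightarrow> 'a"
  assumes g: "\<And>k. g k \<in> carrier G" "inj g" and m: "m > 0"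
  shows "(nrm (scale_vec (of_real (1 / real m)) (\<Sum>k\<in>{1..m}. delta (g k))))\<^sup>2 = 1 / real m"
proof -
  define v where "v = scale_vec (of_real (1 / real m)) (\<Sum>k\<in>{1..m}. delta (g k))"
  have inj: "inj_on g {1..m}" using g(2) by (rule inj_on_subset) simp
  have v: "v t = (if t \<in> g ` {1..m} then of_real (1 / real m) else 0)" for t
  proof -
    have "v t = of_real (1 / real m) * (\<Sum>k\<in>{1..m}. delta (g k) t)"
      by (simp add: v_def vec_apply sum_fun_apply)
    also have "(\<Sum>k\<in>{1..m}. delta (g k) t) = (\<Sum>x\<in>g ` {1..m}. delta x t)"
      by (subst sum.reindex[OF inj]) (simp add: comp_def)
    also have "\<dots> = (if t \<in> g ` {1..m} then 1 else 0)" by (simp add: delta_apply)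
    finally show ?thesis by simp
  qed
  have "(nrm v)\<^sup>2 = (\<Sum>t\<in>g ` {1..m}. (cmod (v t))\<^sup>2)"
    by (rule ell2_finite_support(2)) (use g v in auto)
  also have "\<dots> = (\<Sum>t\<in>g ` {1..m}. (1 / real m)\<^sup>2)"
    by (intro sum.cong) (simp_all add: v norm_divide)
  also have "\<dots> = 1 / real m"
  proof -
    have "card (g ` {1..m}) = m" using card_image[OF inj] by simp
    then have "(\<Sum>t\<in>g ` {1..m}. (1 / real m)\<^sup>2) = real m * (1 / real m)\<^sup>2" by (simp only: sum_constant)
    then show ?thesis using m by (simp add: power2_eq_square)
  qed
  finally show ?thesis by (simp add: v_def)
qed

text \<open>The pairs \<open>(x \<delta>\<^sub>\<one>, y)\<close> with \<open>c \<eta> x = (\<lambda>(s) - 1) y\<close> form the orthogonal complement of the right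
  submodule generated by \<open>\<Theta>\<close>, of dimension at most one by \<open>graph_trace\<close>. As \<open>\<lambda>(s) - 1\<close> has dense range,
  this submodule nearly contains the second coordinate axis, so its complement nearly contains the first.\<close>

lemma cocycle_solution:
  assumes tf: "torsion_free G" and s: "s \<in> carrier G" "s \<noteq> \<one>" and \<eta>: "\<eta> \<in> L2" and e: "e > 0"
  shows "\<exists>x\<in>right_comm. \<exists>y\<in>L2. right_act G \<eta> x = lam s y - y \<and> nrm (delta \<one> - x (delta \<one>)) < e"
proof -
  define I where "I = {0, 1, 2 :: nat}"
  have I: "finite I" "0 \<in> I" "1 \<in> I" "2 \<in> I" by (auto simp: I_def)
  define B where "B = I \<times> carrier G"
  define R where "R t = amp_rtr I t" for t
  \<comment> \<open>\<open>m\<close> controls the error in slot 2, whose squared norm will be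
    \<open>1 / m\<close>. Then \<open>c\<close> is so small that the error in slot 1, made of
    \<open>m\<close> terms of norm at most \<open>c * nrm \<eta>\<close>, stays within
    \<open>e / 2\<close>.\<close>
  obtain m :: nat where m: "2 / e\<^sup>2 < real m" using reals_Archimedean2 by blast
  have m0: "m > 0" using m e by (cases m) (auto simp: field_simps)
  define c where "c = e / (2 * real m * (nrm \<eta> + 1))"
  have \<eta>1: "nrm \<eta> + 1 > 0" by (simp add: add_nonneg_pos)
  have c: "c > 0" unfolding c_def using e m0 \<eta>1 by simp
  \<comment> \<open>Slots 1 and 2 carry the coefficients of the equation, so that orthogonality to
    all right translates of \<Theta> becomes the equation itself. Slot 0 is kept free for a
    perturbation.\<close>
  define \<theta> where "\<theta> i = (if i = (1::nat) then scale_vec (of_real (- c)) (mod_conj G \<eta>)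
      else if i = 2 then delta (inv s) - delta \<one> else 0)" for i
  define \<Theta> where "\<Theta> = family I \<theta>"
  have J: "mod_conj G \<eta> \<in> L2" "nrm (mod_conj G \<eta>) = nrm \<eta>" using mod_conj_ell2[OF \<eta>] by auto
  have \<theta>: "\<theta> i \<in> L2" for i using J s by (auto simp: \<theta>_def intro!: ell2_scale ell2_diff delta_ell2)
  have \<Theta>: "\<Theta> \<in> ell2 B" unfolding \<Theta>_def B_def by (rule family_ell2[OF I(1) \<theta>])
  have \<Theta>c: "component \<Theta> i = \<theta> i" if "i \<in> I" for i using that by (simp add: \<Theta>_def)
  have d: "delta (i, t) \<in> ell2 B" if "i \<in> I" "t \<in> carrier G" for i t
    using that by (intro delta_ell2) (simp add: B_def)
  note R_ell2 = amp_rtr_ell2[of _ _ I, folded B_def R_def]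
  note R_mult = amp_rtr_mult[of _ _ I, folded B_def R_def]
  have R_lin: "R t (u + w) = R t u + R t w" "R t (scale_vec a u) = scale_vec a (R t u)" for t u w a
    unfolding R_def by (simp_all add: amp_rtr_linear)
  have R_comp: "component (R t u) i = rtr t (component u i)" if "i \<in> I" for t u i
    unfolding R_def using that by (rule amp_rtr_component)
  define e0 where "e0 = delta (0::nat, \<one>)"
  define e1 where "e1 = delta (1::nat, \<one>)"
  define e2 where "e2 = delta (2::nat, \<one>)"
  have es: "e0 \<in> ell2 B" "e1 \<in> ell2 B" "e2 \<in> ell2 B" using I d by (simp_all add: e0_def e1_def e2_def)
  have e_norm: "ell2_norm B e1 = 1" using I by (simp add: e1_def B_def)
  \<comment> \<open>\<open>graph_trace\<close> needs a slot holding a nonzero multiple of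
    \<open>delta \<one>\<close>, and \<epsilon> in slot 0 supplies it. The trace is 1 for every
    nonzero \<epsilon>, so \<epsilon> can tend to 0 in \<open>key\<close>.\<close>
  define M where "M \<epsilon> = (\<lambda>t. R t (\<Theta> + scale_vec (of_real \<epsilon>) e0)) ` carrier G" for \<epsilon> :: real
  have M: "M \<epsilon> \<subseteq> ell2 B" for \<epsilon>
    unfolding M_def using \<Theta> es by (auto intro!: R_ell2 ell2_add ell2_scale)
  have Minv: "R t v \<in> M \<epsilon>" if t: "t \<in> carrier G" and v: "v \<in> M \<epsilon>" for t v \<epsilon>
  proof -
    obtain w where w: "w \<in> carrier G" "v = R w (\<Theta> + scale_vec (of_real \<epsilon>) e0)" using v by (auto simp: M_def)
    then have "R t v = R (t \<otimes> w) (\<Theta> + scale_vec (of_real \<epsilon>) e0)" using t by (simp add: R_mult)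
    then show ?thesis using t w by (simp add: M_def)
  qed
  define Cl where "Cl \<epsilon> = orth B (orth B (M \<epsilon>))" for \<epsilon> :: real
  have Cl_sub: "l2_subspace B (Cl \<epsilon>)" for \<epsilon> unfolding Cl_def by (rule subspace_orth[OF orth_subset])
  have Oinv: "R t v \<in> orth B (M \<epsilon>)" if "t \<in> carrier G" "v \<in> orth B (M \<epsilon>)" for t v \<epsilon>
    using orth_amp_rtr[OF that(1), of "M \<epsilon>" I v, folded B_def R_def, OF M Minv that(2)] .
  have Clinv: "R t v \<in> Cl \<epsilon>" if "t \<in> carrier G" "v \<in> Cl \<epsilon>" for t v \<epsilon>
    using orth_amp_rtr[OF that(1), of "orth B (M \<epsilon>)" I v, folded B_def R_def, OF orth_subset Oinv that(2)[unfolded Cl_def]]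
    by (simp add: Cl_def)
  \<comment> \<open>Vectors lying in every perturbed closed module up to a correction of order
    \<epsilon> in slot 0. They form a subspace containing the translates of \<Theta>, and the
    correction disappears in the limit.\<close>
  define V where "V = {v \<in> ell2 B. \<exists>w\<in>ell2 B. component w 1 = 0 \<and> component w 2 = 0 \<and>
      (\<forall>\<epsilon>. \<epsilon> \<noteq> 0 \<longrightarrow> v + scale_vec (of_real \<epsilon>) w \<in> Cl \<epsilon>)}"
  have V: "V \<subseteq> ell2 B" by (auto simp: V_def)
  have VI: "v \<in> V" if "v \<in> ell2 B" "w \<in> ell2 B" "component w 1 = 0" "component w 2 = 0"
    "\<And>\<epsilon>. \<epsilon> \<noteq> 0 \<Longrightarrow> v + scale_vec (of_real \<epsilon>) w \<in> Cl \<epsilon>" for v w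
    using that unfolding V_def by blast
  have sub: "l2_subspace B V"
    unfolding l2_subspace_def
  proof (intro conjI V ballI allI)
    show "0 \<in> V" by (rule VI[of _ 0]) (auto simp: l2_subspaceD(2)[OF Cl_sub])
  next
    fix u v assume "u \<in> V" "v \<in> V"
    then obtain w w' where w: "u \<in> ell2 B" "w \<in> ell2 B" "component w 1 = 0" "component w 2 = 0"
        "\<And>\<epsilon>. \<epsilon> \<noteq> 0 \<Longrightarrow> u + scale_vec (of_real \<epsilon>) w \<in> Cl \<epsilon>"
      and w': "v \<in> ell2 B" "w' \<in> ell2 B" "component w' 1 = 0" "component w' 2 = 0"
        "\<And>\<epsilon>. \<epsilon> \<noteq> 0 \<Longrightarrow> v + scale_vec (of_real \<epsilon>) w' \<in> Cl \<epsilon>"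
      unfolding V_def by blast
    show "u + v \<in> V"
    proof (rule VI[of _ "w + w'"])
      fix \<epsilon> :: real assume "\<epsilon> \<noteq> 0"
      have eq: "u + v + scale_vec (of_real \<epsilon>) (w + w') = (u + scale_vec (of_real \<epsilon>) w) + (v + scale_vec (of_real \<epsilon>) w')"
        by (simp add: scale_vec_distrib)
      then show "u + v + scale_vec (of_real \<epsilon>) (w + w') \<in> Cl \<epsilon>"
        unfolding eq using \<open>\<epsilon> \<noteq> 0\<close> by (intro l2_subspaceD(3)[OF Cl_sub] w(5) w'(5))
    qed (use w w' in \<open>auto simp: component_linear\<close>)
  next
    fix a v assume "v \<in> V"
    then obtain w where w: "v \<in> ell2 B" "w \<in> ell2 B" "component w 1 = 0" "component w 2 = 0"
        "\<And>\<epsilon>. \<epsilon> \<noteq> 0 \<Longrightarrow> v + scale_vec (of_real \<epsilon>) w \<in> Cl \<epsilon>"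
      unfolding V_def by blast
    show "scale_vec a v \<in> V"
    proof (rule VI[of _ "scale_vec a w"])
      fix \<epsilon> :: real assume "\<epsilon> \<noteq> 0"
      have eq: "scale_vec a v + scale_vec (of_real \<epsilon>) (scale_vec a w) = scale_vec a (v + scale_vec (of_real \<epsilon>) w)"
        by (simp add: scale_vec_distrib mult.commute)
      then show "scale_vec a v + scale_vec (of_real \<epsilon>) (scale_vec a w) \<in> Cl \<epsilon>"
        unfolding eq using \<open>\<epsilon> \<noteq> 0\<close> by (intro l2_subspaceD(4)[OF Cl_sub] w(5))
    qed (use w in \<open>auto simp: component_linear\<close>)
  qed
  have R\<Theta>: "R t \<Theta> \<in> V" if t: "t \<in> carrier G" for t
  proof (rule VI[of _ "R t e0"])
    show "component (R t e0) 1 = 0" "component (R t e0) 2 = 0"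
      using I by (simp_all add: R_comp e0_def component_delta)
    fix \<epsilon> :: real
    have "R t \<Theta> + scale_vec (of_real \<epsilon>) (R t e0) \<in> M \<epsilon>"
      using t by (auto simp: M_def R_lin)
    then show "R t \<Theta> + scale_vec (of_real \<epsilon>) (R t e0) \<in> Cl \<epsilon>"
      using orth_orth_superset[OF M] by (auto simp: Cl_def)
  qed (use t \<Theta> es R_ell2 in auto)
  have Vinv: "R t v \<in> V" if t: "t \<in> carrier G" and v: "v \<in> V" for t v
  proof -
    obtain w where w: "v \<in> ell2 B" "w \<in> ell2 B" "component w 1 = 0" "component w 2 = 0"
        "\<And>\<epsilon>. \<epsilon> \<noteq> 0 \<Longrightarrow> v + scale_vec (of_real \<epsilon>) w \<in> Cl \<epsilon>"
      using v unfolding V_def by blast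
    show ?thesis
    proof (rule VI[of _ "R t w"])
      fix \<epsilon> :: real assume "\<epsilon> \<noteq> 0"
      then show "R t v + scale_vec (of_real \<epsilon>) (R t w) \<in> Cl \<epsilon>"
        using Clinv[OF t w(5)[of \<epsilon>]] by (simp add: R_lin)
    qed (use t w I in \<open>auto simp: R_ell2 R_comp\<close>)
  qed
  \<comment> \<open>Trace 1 forces the squared norms of \<open>P e1\<close> and \<open>P e2\<close>
    to sum to at most 1, so \<open>P e1\<close> is no longer than the distance of \<open>e2\<close>
    from the module. A vector of \<open>V\<close> close to \<open>e2\<close> thus makes all of
    \<open>V\<close> nearly orthogonal to \<open>e1\<close>.\<close>
  have key: "cmod (ell2_inner B e1 v) \<le> ell2_norm B (e2 - v') * ell2_norm B v" if v: "v \<in> V" and v': "v' \<in> V" for v v'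
  proof -
    obtain w where w: "v \<in> ell2 B" "w \<in> ell2 B" "component w 1 = 0" "component w 2 = 0"
        "\<And>\<epsilon>. \<epsilon> \<noteq> 0 \<Longrightarrow> v + scale_vec (of_real \<epsilon>) w \<in> Cl \<epsilon>"
      using v unfolding V_def by blast
    obtain w' where w': "v' \<in> ell2 B" "w' \<in> ell2 B"
        "\<And>\<epsilon>. \<epsilon> \<noteq> 0 \<Longrightarrow> v' + scale_vec (of_real \<epsilon>) w' \<in> Cl \<epsilon>"
      using v' unfolding V_def by blast
    have bound: "cmod (ell2_inner B e1 v) \<le> (ell2_norm B (e2 - v') + \<epsilon> * ell2_norm B w') * (ell2_norm B v + \<epsilon> * ell2_norm B w)"
      if \<epsilon>: "\<epsilon> > 0" for \<epsilon>
    proof -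
      define P where "P = proj_op B (orth B (M \<epsilon>))"
      note O = orth_subset[of B "M \<epsilon>"]
      define a where "a = v + scale_vec (of_real \<epsilon>) w"
      define b where "b = v' + scale_vec (of_real \<epsilon>) w'"
      have a: "a \<in> Cl \<epsilon>" and b: "b \<in> Cl \<epsilon>" using w(5)[of \<epsilon>] w'(3)[of \<epsilon>] \<epsilon> by (simp_all add: a_def b_def)
      have al: "a \<in> ell2 B" "b \<in> ell2 B" using w w' by (auto simp: a_def b_def)
      have Pl: "P u \<in> ell2 B" if "u \<in> ell2 B" for u unfolding P_def using proj_op_ell2[OF O that] .
      have Pa: "P a = a" unfolding P_def using a by (intro proj_op_fix[OF O]) (simp add: Cl_def)
      have "component (\<Theta> + scale_vec (of_real \<epsilon>) e0) 0 = scale_vec (of_real \<epsilon>) (delta \<one>)"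
        using I by (simp add: component_linear \<Theta>c \<theta>_def e0_def component_delta)
      then have "(\<Sum>i\<in>I. (ell2_norm B (P (delta (i, \<one>))))\<^sup>2) = 1"
        unfolding P_def M_def B_def R_def
        using \<epsilon> \<Theta> es by (intro graph_trace[OF I(1) I(2)]) (auto simp: B_def)
      then have "(ell2_norm B (P e0))\<^sup>2 + ((ell2_norm B (P e1))\<^sup>2 + (ell2_norm B (P e2))\<^sup>2) = 1"
        by (simp add: I_def e0_def e1_def e2_def)
      then have tr: "(ell2_norm B (P e1))\<^sup>2 + (ell2_norm B (P e2))\<^sup>2 \<le> 1"
        using zero_le_power2[of "ell2_norm B (P e0)"] by linarith
      have e2P: "e2 - P e2 \<in> orth B (Cl \<epsilon>)" unfolding P_def Cl_def by (rule proj_op_compl[OF O es(3)])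
      have Pe2: "P e2 \<in> Cl \<epsilon>" unfolding P_def Cl_def by (rule proj_op_in[OF O es(3)])
      have "(ell2_norm B ((e2 - P e2) + P e2))\<^sup>2 = (ell2_norm B (e2 - P e2))\<^sup>2 + (ell2_norm B (P e2))\<^sup>2"
        using orthD[OF e2P Pe2] es Pl by (intro ell2_pythagoras) (auto intro: ell2_diff)
      moreover have "ell2_norm B e2 = 1" using I by (simp add: e2_def B_def)
      ultimately have n2: "(ell2_norm B (e2 - P e2))\<^sup>2 = 1 - (ell2_norm B (P e2))\<^sup>2" by simp
      have diff: "P e2 - b \<in> Cl \<epsilon>" by (rule l2_subspaceD(5)[OF Cl_sub Pe2 b])
      have "(ell2_norm B ((e2 - P e2) + (P e2 - b)))\<^sup>2 = (ell2_norm B (e2 - P e2))\<^sup>2 + (ell2_norm B (P e2 - b))\<^sup>2"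
        using orthD[OF e2P diff] es Pl al by (intro ell2_pythagoras) (auto intro: ell2_diff)
      then have "(ell2_norm B (e2 - P e2))\<^sup>2 \<le> (ell2_norm B (e2 - b))\<^sup>2" by simp
      then have "(ell2_norm B (P e1))\<^sup>2 \<le> (ell2_norm B (e2 - b))\<^sup>2" using tr n2 by linarith
      then have P1: "ell2_norm B (P e1) \<le> ell2_norm B (e2 - b)" by (rule power2_le_imp_le) simp
      have "w (1, \<one>) = 0" using fun_cong[OF w(3), of \<one>] by (simp add: component_def vec_apply)
      then have "ell2_inner B e1 w = 0" using I unfolding e1_def by (subst ell2_inner_delta(2)) (auto simp: B_def)
      then have "ell2_inner B e1 v = ell2_inner B e1 a"
        using es w by (simp add: a_def ell2_inner_add ell2_scale)
      also have "\<dots> = ell2_inner B (P e1) a"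
        using proj_op_self_adjoint[OF O es(2) al(1)] Pa by (simp add: P_def)
      finally have "cmod (ell2_inner B e1 v) \<le> ell2_norm B (P e1) * ell2_norm B a"
        using ell2_cauchy_schwarz[OF Pl[OF es(2)] al(1)] by simp
      also have "\<dots> \<le> ell2_norm B (e2 - b) * ell2_norm B a" by (rule mult_right_mono[OF P1]) simp
      also have "\<dots> \<le> (ell2_norm B (e2 - v') + \<epsilon> * ell2_norm B w') * (ell2_norm B v + \<epsilon> * ell2_norm B w)"
      proof (rule mult_mono)
        have "ell2_norm B (e2 - b) \<le> ell2_norm B (e2 - v') + ell2_norm B (v' - b)"
          using es w' al by (intro ell2_norm_triangle_diff)
        also have "v' - b = scale_vec (- of_real \<epsilon>) w'" by (simp add: b_def fun_eq_iff vec_apply)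
        finally show "ell2_norm B (e2 - b) \<le> ell2_norm B (e2 - v') + \<epsilon> * ell2_norm B w'"
          using \<epsilon> by (simp add: ell2_norm_scale)
        have "ell2_norm B a \<le> ell2_norm B v + ell2_norm B (scale_vec (of_real \<epsilon>) w)"
          unfolding a_def using w by (intro ell2_norm_triangle) auto
        then show "ell2_norm B a \<le> ell2_norm B v + \<epsilon> * ell2_norm B w"
          using \<epsilon> by (simp add: ell2_norm_scale)
      qed (use \<epsilon> in auto)
      finally show ?thesis .
    qed
    have lim: "((\<lambda>\<epsilon>. (ell2_norm B (e2 - v') + \<epsilon> * ell2_norm B w') * (ell2_norm B v + \<epsilon> * ell2_norm B w)) \<longlongrightarrow>
        (ell2_norm B (e2 - v') + 0 * ell2_norm B w') * (ell2_norm B v + 0 * ell2_norm B w)) (at_right 0)"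
      by (intro tendsto_intros)
    have "eventually (\<lambda>\<epsilon>::real. cmod (ell2_inner B e1 v) \<le> (ell2_norm B (e2 - v') + \<epsilon> * ell2_norm B w') * (ell2_norm B v + \<epsilon> * ell2_norm B w)) (at_right 0)"
      using eventually_at_right_less[of "0::real"] by eventually_elim (rule bound)
    from tendsto_lowerbound[OF lim this] show ?thesis by simp
  qed
  \<comment> \<open>By \<open>summation_by_parts\<close>, slot 2 of this combination is
    \<open>delta \<one>\<close> minus the average of the \<open>delta (inv (s [^] k))\<close>; hence
    it is close to \<open>e2\<close>.\<close>
  define v' where "v' = (\<Sum>k<m. scale_vec (of_real (- (1 - real k / real m))) (R (s [^] k) \<Theta>))"
  have v': "v' \<in> V"
    unfolding v'_def using s by (intro l2_subspace_sum[OF sub] l2_subspaceD(4)[OF sub] R\<Theta>) auto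
  define D where "D = e2 - v'"
  have Dl: "D \<in> ell2 (I \<times> carrier G)" using es v' V by (auto simp: D_def B_def[symmetric] intro!: ell2_diff)
  have v'c: "component v' i = (\<Sum>k<m. scale_vec (of_real (- (1 - real k / real m))) (rtr (s [^] k) (\<theta> i)))"
    if "i \<in> I" for i
    using that by (simp add: v'_def component_sum component_linear R_comp \<Theta>c)
  have D0: "component D 0 = 0"
    using I by (simp add: D_def component_linear v'c e2_def component_delta \<theta>_def)
  have D1: "nrm (component D 1) \<le> e / 2"
  proof -
    have "component D 1 = - component v' 1" by (simp add: D_def component_linear e2_def component_delta)
    also have "\<dots> = scale_vec (- 1) (component v' 1)" by (rule ell2_uminus_eq)
    finally have "nrm (component D 1) = nrm (component v' 1)" by (simp add: ell2_norm_scale)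
    also have "\<dots> \<le> (\<Sum>k<m. nrm (scale_vec (of_real (- (1 - real k / real m))) (rtr (s [^] k) (\<theta> 1))))"
      unfolding v'c[OF I(3)] using \<theta> s by (intro ell2_norm_sum_le ell2_scale rtr_ell2) auto
    also have "\<dots> \<le> (\<Sum>k<m. c * nrm \<eta>)"
    proof (rule sum_mono)
      fix k assume "k \<in> {..<m}"
      then have k: "\<bar>1 - real k / real m\<bar> \<le> 1" using m0 by (simp add: divide_le_eq_1)
      have "nrm (scale_vec (of_real (- (1 - real k / real m))) (rtr (s [^] k) (\<theta> 1)))
          = \<bar>1 - real k / real m\<bar> * nrm (\<theta> 1)"
        using s by (simp only: ell2_norm_scale norm_of_real abs_minus_cancel) (simp add: rtr_norm)
      also have "\<dots> \<le> 1 * nrm (\<theta> 1)" using k by (rule mult_right_mono) simp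
      also have "\<dots> = c * nrm \<eta>" using c J by (simp add: \<theta>_def ell2_norm_scale)
      finally show "nrm (scale_vec (of_real (- (1 - real k / real m))) (rtr (s [^] k) (\<theta> 1))) \<le> c * nrm \<eta>" .
    qed
    also have "\<dots> = real m * c * nrm \<eta>" by simp
    also have "\<dots> \<le> real m * c * (nrm \<eta> + 1)" using c by (intro mult_left_mono) auto
    also have "\<dots> = e / 2"
    proof -
      have *: "a * (e / (2 * a * h)) * h = e / 2" if "a \<noteq> 0" "h \<noteq> 0" for a h :: real
        using that by (simp add: field_simps)
      show ?thesis unfolding c_def using m0 \<eta>1 by (intro *) auto
    qed
    finally show ?thesis .
  qed
  have D2: "(nrm (component D 2))\<^sup>2 = 1 / real m"
  proof -
    define u where "u k = delta (inv (s [^] k))" for k :: nat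
    have step: "scale_vec (of_real (- (1 - real k / real m))) (rtr (s [^] k) (\<theta> 2))
        = scale_vec (of_real (1 - real k / real m)) (u k - u (Suc k))" for k
    proof -
      have "rtr (s [^] k) (\<theta> 2) = delta (inv s \<otimes> inv (s [^] k)) - delta (inv (s [^] k))"
        using s by (simp add: \<theta>_def rtr_linear rtr_delta)
      also have "inv s \<otimes> inv (s [^] k) = inv (s [^] Suc k)" using s by (simp add: inv_mult_group)
      finally have "rtr (s [^] k) (\<theta> 2) = u (Suc k) - u k" by (simp only: u_def)
      then show ?thesis by (simp only: fun_eq_iff vec_apply of_real_minus) (simp add: algebra_simps)
    qed
    have "component v' 2 = (\<Sum>k<m. scale_vec (of_real (1 - real k / real m)) (u k - u (Suc k)))"
      unfolding v'c[OF I(4)] step ..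
    also have "\<dots> = u 0 - scale_vec (of_real (1 / real m)) (\<Sum>k\<in>{1..m}. u k) - scale_vec (of_real (1 - real m / real m)) (u m)"
      using m0 by (intro summation_by_parts) simp
    finally have "component v' 2 = u 0 - scale_vec (of_real (1 / real m)) (\<Sum>k\<in>{1..m}. u k)"
      using m0 by simp
    then have "component D 2 = scale_vec (of_real (1 / real m)) (\<Sum>k\<in>{1..m}. delta (inv (s [^] k)))"
      by (simp add: D_def component_linear e2_def component_delta u_def)
    moreover have "inj (\<lambda>k::nat. inv (s [^] k))"
      using torsion_free_inj[OF tf s] s by (intro injI) (metis inv_inv nat_pow_closed injD)
    ultimately show ?thesis using average_norm[of "\<lambda>k. inv (s [^] k)" m] s m0 by simp
  qed
  define dd where "dd = ell2_norm B D"
  have "(ell2_norm (I \<times> carrier G) D)\<^sup>2 = (\<Sum>i\<in>I. (nrm (component D i))\<^sup>2)" by (rule ell2_norm_components[OF I(1) Dl])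
  also have "\<dots> = (nrm (component D 1))\<^sup>2 + 1 / real m" by (simp add: I_def D0 D2)
  also have "\<dots> \<le> (e / 2)\<^sup>2 + 1 / real m" using D1 by (intro add_right_mono power_mono) auto
  also have "\<dots> < (e / 2)\<^sup>2 + e\<^sup>2 / 2" using m m0 e by (simp add: field_simps)
  also have "\<dots> \<le> e\<^sup>2" by (simp add: power2_eq_square)
  finally have "dd\<^sup>2 < e\<^sup>2" by (simp add: dd_def B_def)
  then have dd: "dd < e" by (rule power2_less_imp_less) (use e in simp)
  have dd0: "dd \<ge> 0" by (simp add: dd_def)
  define Q where "Q = proj_op B (orth B V)"
  note O = orth_subset[of B V]
  have Ql: "Q u \<in> ell2 B" if "u \<in> ell2 B" for u unfolding Q_def using proj_op_ell2[OF O that] .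
  \<comment> \<open>The bound \<open>key\<close> extends to the closure of \<open>V\<close> by
    approximation. It is applied to \<open>Q e1\<close>, whose pairing with \<open>e1\<close> is its
    own squared norm.\<close>
  have Q1: "ell2_norm B (Q e1) \<le> dd"
  proof -
    define u where "u = Q e1"
    have u: "u \<in> orth B (orth B V)" unfolding u_def Q_def by (rule proj_op_in[OF O es(2)])
    have ul: "u \<in> ell2 B" using orth_ell2[OF u] .
    have uu: "ell2_inner B u e1 = of_real ((ell2_norm B u)\<^sup>2)"
      unfolding u_def Q_def by (rule proj_op_inner_self[OF O es(2)])
    then have "ell2_inner B e1 u = of_real ((ell2_norm B u)\<^sup>2)" by (subst ell2_inner_commute) simp
    then have n: "cmod (ell2_inner B e1 u) = (ell2_norm B u)\<^sup>2" by (simp only: norm_of_real) simp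
    have "(ell2_norm B u)\<^sup>2 \<le> dd * ell2_norm B u + r" if r: "r > 0" for r
    proof -
      define t where "t = r / (dd + 1)"
      have t: "t > 0" using r dd0 by (simp add: t_def)
      obtain v where v: "v \<in> V" "ell2_norm B (u - v) < t" using orth_orth_approx[OF sub u t] by blast
      have vl: "v \<in> ell2 B" using v V by auto
      have "ell2_inner B e1 u = ell2_inner B e1 v + ell2_inner B e1 (u - v)"
        using es ul vl by (simp add: ell2_inner_diff)
      then have "(ell2_norm B u)\<^sup>2 \<le> cmod (ell2_inner B e1 v) + cmod (ell2_inner B e1 (u - v))"
        using n norm_triangle_ineq by metis
      also have "\<dots> \<le> dd * ell2_norm B v + ell2_norm B (u - v)"
        using key[OF v(1) v'] ell2_cauchy_schwarz[OF es(2) ell2_diff[OF ul vl]]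
        by (intro add_mono) (simp_all add: dd_def D_def e_norm)
      also have "\<dots> \<le> dd * (ell2_norm B u + t) + t"
        using v(2) ell2_norm_triangle_sub[OF vl ul] dd0
        by (intro add_mono mult_left_mono) (auto simp: ell2_norm_minus_commute[of B v u])
      also have "\<dots> = dd * ell2_norm B u + t * (dd + 1)" by (simp add: algebra_simps)
      also have "t * (dd + 1) = r" using dd0 by (simp add: t_def)
      finally show ?thesis .
    qed
    then have "(ell2_norm B u)\<^sup>2 \<le> dd * ell2_norm B u" by (rule field_le_epsilon)
    then show ?thesis
      using dd0 ell2_norm_nonneg[of B u] unfolding u_def[symmetric] power2_eq_square
      by (cases "ell2_norm B u = 0") (auto simp: mult_le_cancel_right)
  qed
  define emb where "emb \<zeta> = family I (\<lambda>i. if i = 1 then \<zeta> else 0)" for \<zeta> :: "'a \<Rightarrow> complex"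
  have emb: "emb \<zeta> \<in> ell2 B" "ell2_norm B (emb \<zeta>) = nrm \<zeta>" if "\<zeta> \<in> L2" for \<zeta>
  proof -
    show l: "emb \<zeta> \<in> ell2 B" unfolding emb_def B_def using that by (intro family_ell2[OF I(1)]) auto
    have "(ell2_norm B (emb \<zeta>))\<^sup>2 = (\<Sum>i\<in>I. (nrm (component (emb \<zeta>) i))\<^sup>2)"
      using ell2_norm_components[OF I(1), of "emb \<zeta>" "carrier G"] l by (simp add: B_def)
    also have "\<dots> = (nrm \<zeta>)\<^sup>2" by (simp add: I_def emb_def)
    finally show "ell2_norm B (emb \<zeta>) = nrm \<zeta>" by simp
  qed
  have emb_lin: "emb (\<xi> + \<zeta>) = emb \<xi> + emb \<zeta>" "emb (scale_vec a \<zeta>) = scale_vec a (emb \<zeta>)" for \<xi> \<zeta> a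
    by (auto simp: emb_def family_def fun_eq_iff vec_apply)
  have emb_rtr: "emb (rtr t \<zeta>) = R t (emb \<zeta>)" if "t \<in> carrier G" for t \<zeta>
    by (auto simp: emb_def family_def R_def amp_rtr_def permute_def rtr_def fun_eq_iff vec_apply that)
  have emb_delta: "emb (delta \<one>) = e1"
    by (auto simp: emb_def family_def e1_def delta_apply fun_eq_iff vec_apply I_def)
  note Qb = proj_op_bounded[OF O, folded Q_def]
  \<comment> \<open>The slot 1 corner of the projection onto the complement of \<open>V\<close>. It
    commutes with right translations and moves \<open>delta \<one>\<close> by at most the norm of
    \<open>Q e1\<close>.\<close>
  define x where "x = (\<lambda>\<zeta>\<in>L2. \<zeta> - component (Q (emb \<zeta>)) 1)"
  have Qc: "component (Q u) i \<in> L2" if "u \<in> ell2 B" for u i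
    using component_ell2[of "Q u" I "carrier G" i] Ql[OF that] by (simp add: B_def)
  have Qn: "nrm (component (Q u) i) \<le> ell2_norm B (Q u)" if "u \<in> ell2 B" "i \<in> I" for u i
  proof (rule power2_le_imp_le)
    have "(nrm (component (Q u) i))\<^sup>2 \<le> (\<Sum>j\<in>I. (nrm (component (Q u) j))\<^sup>2)"
      using I that by (intro member_le_sum) auto
    also have "\<dots> = (ell2_norm B (Q u))\<^sup>2"
      using ell2_norm_components[OF I(1), of "Q u" "carrier G"] Ql[OF that(1)] by (simp add: B_def)
    finally show "(nrm (component (Q u) i))\<^sup>2 \<le> (ell2_norm B (Q u))\<^sup>2" .
  qed simp
  have xb: "x \<in> bounded_ops (carrier G)"
    unfolding x_def
  proof (rule bounded_opsI[where K = 2])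
    fix \<zeta> assume z: "\<zeta> \<in> L2"
    show "\<zeta> - component (Q (emb \<zeta>)) 1 \<in> L2" using z Qc[OF emb(1)[OF z]] by (rule ell2_diff)
    have "nrm (\<zeta> - component (Q (emb \<zeta>)) 1) \<le> nrm \<zeta> + nrm (component (Q (emb \<zeta>)) 1)"
      using ell2_norm_triangle[OF z ell2_scale[OF Qc[OF emb(1)[OF z]], of "- 1" 1]]
      by (simp add: ell2_diff_eq ell2_norm_scale)
    also have "nrm (component (Q (emb \<zeta>)) 1) \<le> nrm \<zeta>"
      using Qn[OF emb(1)[OF z] I(3)] proj_op_norm_le[OF O emb(1)[OF z]] emb(2)[OF z] by (simp add: Q_def)
    finally show "nrm (\<zeta> - component (Q (emb \<zeta>)) 1) \<le> 2 * nrm \<zeta>" by simp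
  next
    fix \<xi> \<zeta> assume "\<xi> \<in> L2" "\<zeta> \<in> L2"
    then show "\<xi> + \<zeta> - component (Q (emb (\<xi> + \<zeta>))) 1
      = (\<xi> - component (Q (emb \<xi>)) 1) + (\<zeta> - component (Q (emb \<zeta>)) 1)"
      by (simp add: emb_lin bounded_opsD(2)[OF Qb] emb component_linear)
  next
    fix a \<zeta> assume "\<zeta> \<in> L2"
    then show "scale_vec a \<zeta> - component (Q (emb (scale_vec a \<zeta>))) 1 = scale_vec a (\<zeta> - component (Q (emb \<zeta>)) 1)"
      by (simp add: emb_lin bounded_opsD(3)[OF Qb] emb component_linear scale_vec_distrib)
  qed
  have x: "x \<in> right_comm"
  proof (rule right_commI[OF xb])
    fix t \<zeta> assume t: "t \<in> carrier G" and z: "\<zeta> \<in> L2"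
    have "Q (R t (emb \<zeta>)) = R t (Q (emb \<zeta>))"
      using proj_amp_rtr[of V I t "emb \<zeta>", folded B_def R_def Q_def, OF V Vinv t emb(1)[OF z]] .
    then show "x (rtr t \<zeta>) = rtr t (x \<zeta>)"
      using t z I by (simp add: x_def rtr_ell2 emb_rtr R_comp rtr_linear)
  qed
  have d1: "delta \<one> \<in> L2" by (simp add: delta_ell2)
  have x1: "x (delta \<one>) = delta \<one> - component (Q e1) 1" using d1 by (simp add: x_def emb_delta)
  have close: "nrm (delta \<one> - x (delta \<one>)) < e"
    using Qn[OF es(2) I(3)] Q1 dd by (simp add: x1)
  \<comment> \<open>This vector is orthogonal to \<open>V\<close>; its slot 1 is
    \<open>x (delta \<one>)\<close> and its slot 2 solves the equation up to the factor
    \<open>c\<close>.\<close>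
  define q where "q = e1 - Q e1"
  have q: "q \<in> orth B V" using proj_op_compl[OF O es(2)] orth3[OF V] by (simp add: q_def Q_def)
  have ql: "q \<in> ell2 B" using orth_ell2[OF q] .
  have q1: "component q 1 = x (delta \<one>)" by (simp add: q_def component_linear e1_def component_delta x1[unfolded e1_def])
  define y0 where "y0 = component q 2"
  have y0: "y0 \<in> L2" using component_ell2[of q I "carrier G"] ql by (simp add: y0_def B_def)
  have rel: "of_real c * right_act G \<eta> x t = lam s y0 t - y0 t" if t: "t \<in> carrier G" for t
  proof -
    have t': "inv t \<in> carrier G" using t by simp
    have "ell2_inner B q (R (inv t) \<Theta>) = 0" by (rule orthD[OF q R\<Theta>[OF t']])
    then have "(\<Sum>i\<in>I. ip (component q i) (rtr (inv t) (\<theta> i))) = 0"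
      using ell2_inner_components[OF I(1), of q "carrier G" "R (inv t) \<Theta>"] ql R_ell2[OF t' \<Theta>]
      by (simp add: B_def R_comp \<Theta>c)
    then have sum0: "ip (x (delta \<one>)) (rtr (inv t) (\<theta> 1)) + ip y0 (rtr (inv t) (\<theta> 2)) = 0"
      by (simp add: I_def \<theta>_def q1[symmetric] y0_def)
    have "rtr (inv t) (\<theta> 2) = delta (inv s \<otimes> t) - delta t"
      using s t by (simp add: \<theta>_def rtr_linear rtr_delta)
    then have "ip y0 (rtr (inv t) (\<theta> 2)) = y0 (inv s \<otimes> t) - y0 t"
      using s t y0 by (simp add: ell2_inner_diff delta_ell2 ell2_inner_delta)
    then have second: "ip y0 (rtr (inv t) (\<theta> 2)) = lam s y0 t - y0 t"
      using s t y0 by (simp add: lam_apply)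
    have "ip (x (delta \<one>)) (rtr (inv t) (mod_conj G \<eta>)) = (\<Sum>\<^sub>\<infinity>w\<in>carrier G. x (delta \<one>) w * \<eta> (t \<otimes> inv w))"
      unfolding ell2_inner_def using t
      by (intro infsum_cong) (simp add: rtr_apply mod_conj_def inv_mult_group)
    also have "\<dots> = (\<Sum>\<^sub>\<infinity>w\<in>carrier G. x (delta \<one>) (inv w \<otimes> t) * \<eta> (t \<otimes> inv (inv w \<otimes> t)))"
    proof -
      have bij: "bij_betw (\<lambda>w. inv w \<otimes> t) (carrier G) (carrier G)"
        by (rule bij_betwI[where g = "\<lambda>w. t \<otimes> inv w"])
          (use t in \<open>auto simp: inv_mult_group m_assoc inv_cancel\<close>)
      show ?thesis by (rule infsum_reindex_bij_betw[OF bij, symmetric])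
    qed
    also have "\<dots> = right_act G \<eta> x t"
      unfolding right_act_apply[OF x \<eta> t]
      using t by (intro infsum_cong) (simp add: inv_mult_group inv_cancel mult.commute)
    finally have "ip (x (delta \<one>)) (rtr (inv t) (\<theta> 1)) = - of_real c * right_act G \<eta> x t"
      by (simp add: \<theta>_def rtr_linear)
    then show ?thesis using sum0 second by simp
  qed
  define y where "y = scale_vec (of_real (1 / c)) y0"
  have y: "y \<in> L2" using y0 by (auto simp: y_def)
  have "right_act G \<eta> x = lam s y - y"
  proof (rule L2_eqI)
    fix t assume t: "t \<in> carrier G"
    have "right_act G \<eta> x t = of_real (1 / c) * (lam s y0 t - y0 t)"
      using rel[OF t] c by (simp add: field_simps)
    also have "\<dots> = (lam s y - y) t"
      using s t y0 y by (simp add: lam_apply y_def vec_apply algebra_simps ell2_scale)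
    finally show "right_act G \<eta> x t = (lam s y - y) t" .
  qed (use right_act_ell2[OF x \<eta>] y s in \<open>auto intro!: ell2_diff lam_ell2\<close>)
  then show ?thesis using close by (intro bexI[OF _ x] bexI[OF _ y] conjI)
qed

end

section \<open>Cocycles and the first L2-Betti number\<close>

context group
begin

text \<open>Recurrence is applied to the \<open>n + 1\<close> distinct powers with exponents 0 to
  \<open>n\<close>. The quotient of two of them is a power again, and inversion makes its exponent
  positive.\<close>

lemma recurrent_power:
  assumes tf: "torsion_free G" and s: "s \<in> carrier G" and g: "g \<in> carrier G" "g \<noteq> \<one>"
    and rec: "conj_recurrent G s n"
  shows "\<exists>k::nat. k > 0 \<and> commute_conj G s (g [^] k)"
proof -
  have inj: "inj (\<lambda>k::nat. g [^] k)" by (rule torsion_free_inj[OF tf g])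
  define J where "J = (\<lambda>k::nat. g [^] k) ` {..n}"
  have "card J = Suc n" unfolding J_def by (subst card_image) (auto intro: inj_on_subset[OF inj])
  then have "\<exists>a\<in>J. \<exists>b\<in>J. a \<noteq> b \<and> commute_conj G s (inv a \<otimes> b)"
    using rec[unfolded conj_recurrent_def, rule_format, of J] g by (auto simp: J_def)
  then obtain i j :: nat where ij: "g [^] i \<noteq> g [^] j" "commute_conj G s (inv (g [^] i) \<otimes> g [^] j)"
    by (auto simp: J_def)
  have pow: "inv (g [^] a) \<otimes> g [^] b = g [^] (b - a)" if "a \<le> b" for a b :: nat
  proof -
    have "g [^] b = g [^] a \<otimes> g [^] (b - a)" using g that by (simp add: nat_pow_mult)
    then show ?thesis using g by (simp add: inv_cancel)
  qed
  show ?thesis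
  proof (cases "i < j")
    case True
    then show ?thesis using ij(2) pow[of i j] by (intro exI[of _ "j - i"]) simp
  next
    case False
    then have lt: "j < i" using ij(1) by (cases "i = j") auto
    have "inv (inv (g [^] i) \<otimes> g [^] j) = inv (g [^] j) \<otimes> g [^] i" using g by (simp add: inv_mult_group)
    also have "\<dots> = g [^] (i - j)" using pow[of j i] lt by simp
    finally have "commute_conj G s (g [^] (i - j))"
      using commute_conj_inv[OF s _ ij(2)] g by simp
    then show ?thesis using lt by (intro exI[of _ "i - j"]) simp
  qed
qed

text \<open>The zero set of a cocycle is malnormal and closed under centralizers: if \<open>c t = 0\<close> and
  \<open>h\<close> conjugates \<open>t\<close> to another zero \<open>t'\<close>, or commutes with \<open>t\<close>, then \<open>\<lambda>(t')\<close> fixes \<open>c h\<close>.\<close>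

lemma cocycle_zero:
  assumes tf: "torsion_free G" and s: "s \<in> carrier G" "s \<noteq> \<one>" and rec: "conj_recurrent G s n"
    and cl: "\<And>g. g \<in> carrier G \<Longrightarrow> c g \<in> L2"
    and coc: "\<And>g h. g \<in> carrier G \<Longrightarrow> h \<in> carrier G \<Longrightarrow> c (g \<otimes> h) = c g + lam g (c h)"
    and cs: "c s = 0" and g: "g \<in> carrier G"
  shows "c g = 0"
proof (cases "g = \<one>")
  case True
  have "c (\<one> \<otimes> \<one>) = c \<one> + lam \<one> (c \<one>)" by (rule coc) simp_all
  then show ?thesis using True cl[of \<one>] by (simp add: lam_one)
next
  case False
  have lam0: "lam h 0 = 0" if "h \<in> carrier G" for h using bounded_ops_zero[OF lam_bounded[OF that]] .
  have fixed0: "c h = 0"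
    if t: "t \<in> carrier G" "t \<noteq> \<one>" and h: "h \<in> carrier G" and t': "t' \<in> carrier G"
      and zero: "c t = 0" "c t' = 0" and eq: "h \<otimes> t = t' \<otimes> h" for t t' h
  proof -
    have "t' \<noteq> \<one>" using eq t h by auto
    have "c (h \<otimes> t) = c h" using coc[OF h t(1)] zero lam0[OF h] by simp
    moreover have "c (t' \<otimes> h) = lam t' (c h)" using coc[OF t' h] zero by simp
    ultimately have "lam t' (c h) = c h" using eq by simp
    then show ?thesis by (rule lam_fixed_eq_0[OF tf t' \<open>t' \<noteq> \<one>\<close> cl[OF h]])
  qed
  obtain k :: nat where k: "k > 0" "commute_conj G s (g [^] k)"
    using recurrent_power[OF tf s(1) g False rec] by blast
  define h where "h = g [^] k"
  define t where "t = h \<otimes> s \<otimes> inv h"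
  have hc: "h \<in> carrier G" "t \<in> carrier G" using g s by (simp_all add: h_def t_def)
  have h1: "h \<noteq> \<one>"
  proof
    assume "h = \<one>"
    then have "g [^] k = g [^] (0::nat)" by (simp add: h_def)
    then show False using injD[OF torsion_free_inj[OF tf g False]] k(1) by blast
  qed
  have st: "t \<otimes> s = s \<otimes> t" using k(2) by (simp add: commute_conj_def h_def t_def)
  have ht: "h \<otimes> s = t \<otimes> h" using hc s by (simp add: t_def m_assoc)
  \<comment> \<open>Zeros spread in three steps: \<open>t\<close> commutes with \<open>s\<close>,
    then \<open>h\<close> conjugates \<open>s\<close> to \<open>t\<close>, then \<open>g\<close>
    commutes with its power \<open>h\<close>, which is nontrivial by torsion-freeness.\<close>
  have "c t = 0" by (rule fixed0[OF s hc(2) s(1) cs cs st])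
  then have ch: "c h = 0" by (rule fixed0[OF s hc(1) hc(2) cs _ ht])
  have "g \<otimes> h = h \<otimes> g" using g unfolding h_def by (metis nat_pow_Suc nat_pow_Suc2)
  then show ?thesis by (rule fixed0[OF hc(1) h1 g hc(1) ch ch])
qed

section \<open>Cocycles, coboundaries and the module structure on cohomology\<close>

definition cob :: "('a \<Rightarrow> complex) \<Rightarrow> 'a \<Rightarrow> 'a \<Rightarrow> complex" where
  "cob \<xi> = (\<lambda>s\<in>carrier G. lam s \<xi> - \<xi>)"

lemma coboundaries_eq: "coboundaries G = cob ` L2"
  by (simp add: coboundaries_def cob_def)

lemma cocyclesI:
  assumes "\<And>s. s \<in> carrier G \<Longrightarrow> b s \<in> L2"
    "\<And>s t. s \<in> carrier G \<Longrightarrow> t \<in> carrier G \<Longrightarrow> b (s \<otimes> t) = b s + lam s (b t)"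
  shows "(\<lambda>s\<in>carrier G. b s) \<in> carrier (cocycles G)"
  using assms by (auto simp: cocycles_def)

lemma cocyclesD:
  assumes "b \<in> carrier (cocycles G)"
  shows "s \<in> carrier G \<Longrightarrow> b s \<in> L2"
    "s \<in> carrier G \<Longrightarrow> t \<in> carrier G \<Longrightarrow> b (s \<otimes> t) = b s + lam s (b t)"
    "b \<in> extensional (carrier G)"
  using assms by (auto simp: cocycles_def PiE_iff)

lemma cocycles_mult: "b \<otimes>\<^bsub>cocycles G\<^esub> c = (\<lambda>s\<in>carrier G. b s + c s)"
  and cocycles_one: "\<one>\<^bsub>cocycles G\<^esub> = (\<lambda>s\<in>carrier G. 0)"
  by (simp_all add: cocycles_def)

lemma lam_add: "s \<in> carrier G \<Longrightarrow> \<xi> \<in> L2 \<Longrightarrow> \<eta> \<in> L2 \<Longrightarrow> lam s (\<xi> + \<eta>) = lam s \<xi> + lam s \<eta>"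
  using bounded_opsD(2)[OF lam_bounded] .

lemma lam_scale: "s \<in> carrier G \<Longrightarrow> \<xi> \<in> L2 \<Longrightarrow> lam s (scale_vec c \<xi>) = scale_vec c (lam s \<xi>)"
  using bounded_opsD(3)[OF lam_bounded] .

lemma cocycles_scale:
  assumes "b \<in> carrier (cocycles G)"
  shows "(\<lambda>s\<in>carrier G. scale_vec a (b s)) \<in> carrier (cocycles G)"
  by (rule cocyclesI)
    (use cocyclesD[OF assms] in \<open>auto simp: scale_vec_distrib lam_scale\<close>)

lemma cocycles_add:
  assumes b: "b \<in> carrier (cocycles G)" and c: "c \<in> carrier (cocycles G)"
  shows "(\<lambda>s\<in>carrier G. b s + c s) \<in> carrier (cocycles G)"
  by (rule cocyclesI) (auto simp: cocyclesD[OF b] cocyclesD[OF c] lam_add add_ac)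

lemma cocycles_comm_group: "comm_group (cocycles G)"
proof (rule comm_groupI)
  show "\<one>\<^bsub>cocycles G\<^esub> \<in> carrier (cocycles G)"
    unfolding cocycles_one by (rule cocyclesI) (auto simp: bounded_ops_zero[OF lam_bounded])
next
  fix b c assume "b \<in> carrier (cocycles G)" "c \<in> carrier (cocycles G)"
  then show "b \<otimes>\<^bsub>cocycles G\<^esub> c \<in> carrier (cocycles G)"
    unfolding cocycles_mult by (rule cocycles_add)
next
  fix b assume b: "b \<in> carrier (cocycles G)"
  show "\<one>\<^bsub>cocycles G\<^esub> \<otimes>\<^bsub>cocycles G\<^esub> b = b"
    unfolding cocycles_mult cocycles_one
    by (rule extensionalityI[OF _ cocyclesD(3)[OF b]]) auto
  have "(\<lambda>s\<in>carrier G. scale_vec (- 1) (b s)) \<otimes>\<^bsub>cocycles G\<^esub> b = \<one>\<^bsub>cocycles G\<^esub>"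
    unfolding cocycles_mult cocycles_one by (auto simp: fun_eq_iff vec_apply)
  then show "\<exists>c\<in>carrier (cocycles G). c \<otimes>\<^bsub>cocycles G\<^esub> b = \<one>\<^bsub>cocycles G\<^esub>"
    using cocycles_scale[OF b, of "- 1"] by blast
qed (auto simp: cocycles_mult fun_eq_iff vec_apply add_ac)

lemma cob_cocycle:
  assumes \<xi>: "\<xi> \<in> L2" shows "cob \<xi> \<in> carrier (cocycles G)"
  unfolding cob_def
proof (rule cocyclesI)
  fix s t assume s: "s \<in> carrier G" and t: "t \<in> carrier G"
  show "lam (s \<otimes> t) \<xi> - \<xi> = lam s \<xi> - \<xi> + lam s (lam t \<xi> - \<xi>)"
    using s t \<xi> by (simp add: bounded_ops_diff[OF lam_bounded] lam_ell2 lam_mult)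
qed (use \<xi> in \<open>auto intro: ell2_diff lam_ell2\<close>)

lemma cob_add: "\<xi> \<in> L2 \<Longrightarrow> \<eta> \<in> L2 \<Longrightarrow> cob \<xi> \<otimes>\<^bsub>cocycles G\<^esub> cob \<eta> = cob (\<xi> + \<eta>)"
  unfolding cocycles_mult by (auto simp: cob_def fun_eq_iff lam_add vec_apply)

lemma cob_zero: "cob 0 = \<one>\<^bsub>cocycles G\<^esub>"
  unfolding cocycles_one cob_def
  by (rule restrict_ext) (simp add: bounded_ops_zero[OF lam_bounded])

lemma coboundaries_normal: "normal (coboundaries G) (cocycles G)"
proof -
  interpret Z: comm_group "cocycles G" by (rule cocycles_comm_group)
  have "subgroup (coboundaries G) (cocycles G)"
  proof (rule Z.subgroupI)
    show "coboundaries G \<subseteq> carrier (cocycles G)" using cob_cocycle by (auto simp: coboundaries_eq)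
    show "coboundaries G \<noteq> {}" by (auto simp: coboundaries_eq)
  next
    fix b assume "b \<in> coboundaries G"
    then obtain \<xi> where \<xi>: "\<xi> \<in> L2" "b = cob \<xi>" by (auto simp: coboundaries_eq)
    have \<xi>': "scale_vec (- 1) \<xi> \<in> L2" using \<xi> by auto
    have "scale_vec (- 1) \<xi> + \<xi> = 0" by (simp add: fun_eq_iff vec_apply)
    then have "cob (scale_vec (- 1) \<xi>) \<otimes>\<^bsub>cocycles G\<^esub> b = \<one>\<^bsub>cocycles G\<^esub>"
      using cob_add[OF \<xi>' \<xi>(1)] \<xi> by (simp add: cob_zero)
    then have "inv\<^bsub>cocycles G\<^esub> b = cob (scale_vec (- 1) \<xi>)"
      using cob_cocycle \<xi> \<xi>' by (intro Z.inv_equality) auto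
    then show "inv\<^bsub>cocycles G\<^esub> b \<in> coboundaries G" using \<xi>' by (auto simp: coboundaries_eq)
  next
    fix b c assume "b \<in> coboundaries G" "c \<in> coboundaries G"
    then obtain \<xi> \<eta> where "\<xi> \<in> L2" "b = cob \<xi>" "\<eta> \<in> L2" "c = cob \<eta>" by (auto simp: coboundaries_eq)
    then show "b \<otimes>\<^bsub>cocycles G\<^esub> c \<in> coboundaries G" by (simp add: cob_add coboundaries_eq ell2_add)
  qed
  then show ?thesis by (rule Z.subgroup_imp_normal)
qed

definition coc_act :: "('a \<Rightarrow> 'a \<Rightarrow> complex) \<Rightarrow> 'a oper \<Rightarrow> 'a \<Rightarrow> 'a \<Rightarrow> complex" where
  "coc_act b x = (\<lambda>s\<in>carrier G. right_act G (b s) x)"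

lemma coc_act_cocycle:
  assumes b: "b \<in> carrier (cocycles G)" and x: "x \<in> right_comm"
  shows "coc_act b x \<in> carrier (cocycles G)"
  unfolding coc_act_def
  by (rule cocyclesI)
    (auto simp: cocyclesD[OF b] right_act_ell2[OF x] right_act_add[OF x] right_act_lam[OF x] lam_ell2)

definition zero_op :: "'a oper" where
  "zero_op = (\<lambda>\<xi>\<in>L2. 0)"

lemma zero_op_right_comm: "zero_op \<in> right_comm"
  unfolding zero_op_def
  by (intro right_commI bounded_opsI[where K = 0]) (auto simp: rtr_ell2)

text \<open>Positive dimension yields a projection matrix with a nonzero diagonal entry
  \<open>p i i\<close>, taken as \<open>a\<close>. Its column \<open>i\<close> generates a submodule
  embedded into cohomology, and \<open>b\<close> represents the image of the generator. If
  \<open>coc_act b x\<close> is a coboundary, injectivity kills the column times \<open>x\<close>,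
  in particular \<open>p i i\<close> times \<open>x\<close>.\<close>

lemma betti_witness:
  assumes pos: "L2_betti_1 G > 0"
  shows "\<exists>b\<in>carrier (cocycles G). \<exists>a\<in>right_comm. a (delta \<one>) \<noteq> 0 \<and>
    (\<forall>x\<in>right_comm. coc_act b x \<in> coboundaries G \<longrightarrow> a (x (delta \<one>)) = 0)"
proof -
  interpret Z: comm_group "cocycles G" by (rule cocycles_comm_group)
  interpret N: normal "coboundaries G" "cocycles G" by (rule coboundaries_normal)
  interpret H: group "H1 G" unfolding H1_def by (rule N.factorgroup_is_group)
  obtain n p \<phi> where tr: "0 < ennreal (Re (\<Sum>i<n. vna_trace G (p i i)))"
    and mp: "matrix_projection G n p"
    and \<phi>: "\<phi> \<in> mon (projective_module G n p) (H1 G)"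
    and act: "\<forall>v\<in>carrier (projective_module G n p). \<forall>x\<in>group_vna G.
          \<phi> (projective_act G n v x) = H1_act G (\<phi> v) x"
    using pos unfolding L2_betti_1_def lueck_dim_def less_Sup_iff by blast
  have "\<exists>i<n. vna_trace G (p i i) \<noteq> 0"
  proof (rule ccontr)
    assume "\<not> ?thesis"
    then have "(\<Sum>i<n. vna_trace G (p i i)) = 0" by (intro sum.neutral) auto
    then show False using tr by simp
  qed
  then obtain i where i: "i < n" and tri: "vna_trace G (p i i) \<noteq> 0" by blast
  have pr: "p j k \<in> right_comm" if "j < n" "k < n" for j k
    using mp that unfolding matrix_projection_def group_vna_eq by blast
  have a0: "p i i (delta \<one>) \<noteq> 0"
    using tri by (auto simp: vna_trace_def)
  define emb where "emb x = (\<lambda>j\<in>{..<n}. if j = i then x else zero_op)" for x :: "'a oper"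
  define pv where "pv x = mat_vec G n p (emb x)" for x
  have pv_in: "pv x \<in> carrier (projective_module G n p)" if "x \<in> right_comm" for x
    unfolding pv_def projective_module_def using that zero_op_right_comm
    by (auto simp: emb_def group_vna_eq intro!: imageI)
  have pv: "pv x = (\<lambda>j\<in>{..<n}. \<lambda>\<xi>\<in>L2. p j i (x \<xi>))" for x
  proof -
    have "(\<Sum>k<n. p j k (emb x k \<xi>)) = p j i (x \<xi>)" if j: "j < n" and \<xi>: "\<xi> \<in> L2" for j \<xi>
    proof -
      have "(\<Sum>k<n. p j k (emb x k \<xi>)) = (\<Sum>k<n. if k = i then p j i (x \<xi>) else 0)"
        using \<xi> bounded_ops_zero[OF right_commD(1)[OF pr[OF j]]]
        by (intro sum.cong refl) (auto simp: emb_def zero_op_def)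
      then show ?thesis using i by simp
    qed
    then show ?thesis unfolding pv_def mat_vec_def by (auto intro!: restrict_ext)
  qed
  define v where "v = pv (op_id (carrier G))"
  have v: "v \<in> carrier (projective_module G n p)" unfolding v_def by (rule pv_in[OF right_comm_id])
  have vx: "projective_act G n v x = pv x" if x: "x \<in> right_comm" for x
    unfolding projective_act_def v_def pv op_mult_def compose_def
    by (auto intro!: restrict_ext simp: right_commD(3)[OF x])
  define z where "z = pv zero_op"
  have z: "z \<in> carrier (projective_module G n p)" unfolding z_def by (rule pv_in[OF zero_op_right_comm])
  have z_eq: "z = (\<lambda>j\<in>{..<n}. \<lambda>\<xi>\<in>L2. 0)"
    unfolding z_def pv using bounded_ops_zero[OF right_commD(1)[OF pr]] i
    by (auto intro!: restrict_ext simp: zero_op_def)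
  have hom: "\<phi> \<in> hom (projective_module G n p) (H1 G)" and inj: "inj_on \<phi> (carrier (projective_module G n p))"
    using \<phi> by (auto simp: mon_def)
  \<comment> \<open>An idempotent of a group is trivial, so \<phi> sends the zero column to the
    trivial class.\<close>
  have "z \<otimes>\<^bsub>projective_module G n p\<^esub> z = z"
    unfolding z_eq projective_module_def by (auto intro!: restrict_ext simp: op_add_def)
  then have "\<phi> z \<otimes>\<^bsub>H1 G\<^esub> \<phi> z = \<phi> z" using hom_mult[OF hom z z] by simp
  moreover have \<phi>z: "\<phi> z \<in> carrier (H1 G)" using hom_in_carrier[OF hom z] .
  ultimately have "\<phi> z = \<one>\<^bsub>H1 G\<^esub>" using H.r_cancel_one by blast
  then have \<phi>z1: "\<phi> z = coboundaries G" by (simp add: H1_def FactGroup_def)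
  have "\<phi> v \<in> rcosets\<^bsub>cocycles G\<^esub> coboundaries G"
    using hom_in_carrier[OF hom v] by (simp add: H1_def FactGroup_def)
  then obtain b where b: "b \<in> carrier (cocycles G)" "\<phi> v = coboundaries G #>\<^bsub>cocycles G\<^esub> b"
    by (auto simp: RCOSETS_def)
  have "p i i (x (delta \<one>)) = 0" if x: "x \<in> right_comm" and cb: "coc_act b x \<in> coboundaries G" for x
  proof -
    have "\<phi> (pv x) = H1_act G (\<phi> v) x"
      using act[rule_format, OF v, of x] x vx[OF x] by (simp add: group_vna_eq)
    moreover have "b \<in> \<phi> v" using Z.rcos_self[OF b(1) N.is_subgroup] b(2) by simp
    \<comment> \<open>\<open>H1_act\<close> is a union over representatives. It suffices to find one
      coset inside it, because the value of \<phi> is itself a coset and distinct cosets are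
      disjoint.\<close>
    ultimately have "coboundaries G #>\<^bsub>cocycles G\<^esub> coc_act b x \<subseteq> \<phi> (pv x)"
      unfolding H1_act_def coc_act_def by blast
    moreover have "coboundaries G #>\<^bsub>cocycles G\<^esub> coc_act b x = coboundaries G"
      by (rule Z.coset_join2[OF coc_act_cocycle[OF b(1) x] N.is_subgroup cb])
    ultimately have "coboundaries G \<subseteq> \<phi> (pv x)" by simp
    moreover have "\<one>\<^bsub>cocycles G\<^esub> \<in> coboundaries G" using N.is_subgroup by (rule subgroup.one_closed)
    ultimately have "\<one>\<^bsub>cocycles G\<^esub> \<in> \<phi> (pv x) \<inter> \<phi> z" using \<phi>z1 by blast
    moreover have "\<phi> (pv x) \<in> rcosets\<^bsub>cocycles G\<^esub> coboundaries G" "\<phi> z \<in> rcosets\<^bsub>cocycles G\<^esub> coboundaries G"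
      using hom_in_carrier[OF hom pv_in[OF x]] \<phi>z by (simp_all add: H1_def FactGroup_def)
    ultimately have "\<phi> (pv x) = \<phi> z"
      using Z.rcos_disjoint[OF N.is_subgroup] unfolding pairwise_def disjnt_def by blast
    then have "pv x = z" using inj pv_in[OF x] z by (auto dest: inj_onD)
    then have "pv x i (delta \<one>) = z i (delta \<one>)" by simp
    then show ?thesis using i by (simp add: pv z_eq delta_ell2)
  qed
  then show ?thesis using b(1) pr[OF i i] a0 by blast
qed

text \<open>In a trivial group every cocycle vanishes, so the witness property at the identity
  operator would give \<open>a (delta \<one>) = 0\<close>.\<close>

lemma betti_nontrivial:
  assumes "L2_betti_1 G > 0"
  shows "carrier G \<noteq> {\<one>}"
proof
  assume triv: "carrier G = {\<one>}"
  obtain b a where b: "b \<in> carrier (cocycles G)" and a: "a \<in> right_comm" "a (delta \<one>) \<noteq> 0"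
    and w: "\<forall>x\<in>right_comm. coc_act b x \<in> coboundaries G \<longrightarrow> a (x (delta \<one>)) = 0"
    using betti_witness[OF assms] by blast
  have "b (\<one> \<otimes> \<one>) = b \<one> + lam \<one> (b \<one>)" by (rule cocyclesD(2)[OF b]) simp_all
  then have b1: "b \<one> = 0" using cocyclesD(1)[OF b one_closed] by (simp add: lam_one)
  have "right_act G (0 + 0) (op_id (carrier G)) = right_act G 0 (op_id (carrier G)) + right_act G 0 (op_id (carrier G))"
    by (rule right_act_add[OF right_comm_id]) auto
  then have r0: "right_act G 0 (op_id (carrier G)) = 0" by simp
  have "coc_act b (op_id (carrier G)) = cob 0"
    unfolding coc_act_def cob_zero cocycles_one
  proof (rule restrict_ext)
    fix s assume "s \<in> carrier G"
    then have "s = \<one>" using triv by auto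
    then show "right_act G (b s) (op_id (carrier G)) = 0" by (simp only: b1 r0)
  qed
  then have "coc_act b (op_id (carrier G)) \<in> coboundaries G" by (auto simp: coboundaries_eq)
  then have "a (op_id (carrier G) (delta \<one>)) = 0" using w right_comm_id by blast
  then show False using a(2) by (simp add: delta_ell2)
qed

text \<open>Multiplying \<open>b\<close> by \<open>x\<close> makes its value at \<open>s\<close>
  that of a coboundary. Subtracting this coboundary leaves a cocycle vanishing at \<open>s\<close>,
  hence everywhere by recurrence, so \<open>coc_act b x\<close> is a coboundary. Yet
  \<open>x (delta \<one>)\<close> is close enough to \<open>delta \<one>\<close> for
  \<open>a\<close> not to kill it.\<close>

lemma betti_not_recurrent:
  assumes tf: "torsion_free G" and pos: "L2_betti_1 G > 0" and s: "s \<in> carrier G" "s \<noteq> \<one>"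
  shows "\<not> conj_recurrent G s n"
proof
  assume rec: "conj_recurrent G s n"
  obtain b a where b: "b \<in> carrier (cocycles G)" and a: "a \<in> right_comm" "a (delta \<one>) \<noteq> 0"
    and w: "\<forall>x\<in>right_comm. coc_act b x \<in> coboundaries G \<longrightarrow> a (x (delta \<one>)) = 0"
    using betti_witness[OF pos] by blast
  have d: "delta \<one> \<in> L2" by (simp add: delta_ell2)
  note ab = right_commD(1)[OF a(1)]
  obtain K where K: "K \<ge> 0" "\<And>\<xi>. \<xi> \<in> L2 \<Longrightarrow> nrm (a \<xi>) \<le> K * nrm \<xi>"
    using bounded_ops_bound[OF ab] by blast
  have ad: "a (delta \<one>) \<in> L2" by (rule right_commD(3)[OF a(1) d])
  have pos: "nrm (a (delta \<one>)) > 0" using a(2) ell2_norm_eq_0[OF ad] ell2_norm_nonneg[of "carrier G" "a (delta \<one>)"] by linarith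
  \<comment> \<open>An error below \<open>e\<close> changes \<open>a (delta \<one>)\<close> by less
    than its own norm, as \<open>K\<close> bounds \<open>a\<close>; \<open>K + 1\<close> avoids
    division by zero.\<close>
  define e where "e = nrm (a (delta \<one>)) / (K + 1)"
  have e: "e > 0" using pos K(1) by (simp add: e_def)
  obtain x y where x: "x \<in> right_comm" and y: "y \<in> L2" and eq: "right_act G (b s) x = lam s y - y"
    and close: "nrm (delta \<one> - x (delta \<one>)) < e"
    using cocycle_solution[OF tf s cocyclesD(1)[OF b s(1)] e] by blast
  have xd: "x (delta \<one>) \<in> L2" by (rule right_commD(3)[OF x d])
  have ne: "a (x (delta \<one>)) \<noteq> 0"
  proof
    assume "a (x (delta \<one>)) = 0"
    then have "a (delta \<one>) = a (delta \<one> - x (delta \<one>))"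
      using bounded_ops_diff[OF ab d xd] by simp
    then have "nrm (a (delta \<one>)) \<le> K * nrm (delta \<one> - x (delta \<one>))"
      using K(2)[OF ell2_diff[OF d xd]] by simp
    also have "\<dots> \<le> K * e" using close K(1) by (intro mult_left_mono) auto
    also have "\<dots> < (K + 1) * e" using e by simp
    also have "\<dots> = nrm (a (delta \<one>))" using K(1) by (simp add: e_def)
    finally show False by simp
  qed
  define c where "c = (\<lambda>g\<in>carrier G. coc_act b x g + scale_vec (- 1) (cob y g))"
  have c: "c \<in> carrier (cocycles G)"
    using cocycles_add[OF coc_act_cocycle[OF b x] cocycles_scale[OF cob_cocycle[OF y], of "- 1"]]
    by (simp add: c_def cong: restrict_cong)
  have cs: "c s = 0" using s by (simp add: c_def coc_act_def cob_def eq fun_eq_iff vec_apply)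
  have "c g = 0" if "g \<in> carrier G" for g
    by (rule cocycle_zero[OF tf s rec cocyclesD(1)[OF c] cocyclesD(2)[OF c] cs that])
  then have eq': "coc_act b x g = cob y g" if "g \<in> carrier G" for g
    using that by (simp add: c_def fun_eq_iff vec_apply)
  have "coc_act b x = cob y"
  proof
    fix g show "coc_act b x g = cob y g"
      by (cases "g \<in> carrier G") (rule eq', simp_all add: coc_act_def cob_def)
  qed
  then have "coc_act b x \<in> coboundaries G" using y by (auto simp: coboundaries_eq)
  then show False using w x ne by blast
qed

end

section \<open>The main theorem\<close>

text \<open>Here \<open>i\<close> is only a set-theoretic section. It lifts distinct elements to
  distinct elements, so a large set lifts to an equally large one, and \<open>f\<close> carries the
  commutation back with the same \<open>n\<close>.\<close>

lemma conj_recurrent_image: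
  assumes "group G" "group H" and f: "f \<in> hom G H"
    and i: "\<And>h. h \<in> carrier H \<Longrightarrow> i h \<in> carrier G \<and> f (i h) = h"
    and s: "s \<in> carrier G" and rec: "conj_recurrent G s n"
  shows "conj_recurrent H (f s) n"
  unfolding conj_recurrent_def
proof (intro allI impI)
  interpret G: group G by fact
  interpret H: group H by fact
  interpret f: group_hom G H f by unfold_locales (rule f)
  fix J assume J: "finite J \<and> J \<subseteq> carrier H \<and> n < card J"
  have inj: "inj_on i J" using i J by (intro inj_onI) (metis subsetD)
  have "finite (i ` J) \<and> i ` J \<subseteq> carrier G \<and> n < card (i ` J)"
    using J i by (auto simp: card_image[OF inj])
  then obtain g h where gh: "g \<in> J" "h \<in> J" "i g \<noteq> i h" "commute_conj G s (inv\<^bsub>G\<^esub> i g \<otimes>\<^bsub>G\<^esub> i h)"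
    using rec[unfolded conj_recurrent_def, rule_format, of "i ` J"] by blast
  have c: "i g \<in> carrier G" "i h \<in> carrier G" "f (i g) = g" "f (i h) = h" using i gh J by auto
  define k where "k = inv\<^bsub>G\<^esub> i g \<otimes>\<^bsub>G\<^esub> i h"
  have k: "k \<in> carrier G" "f k = inv\<^bsub>H\<^esub> g \<otimes>\<^bsub>H\<^esub> h" using c by (simp_all add: k_def)
  have "f (s \<otimes>\<^bsub>G\<^esub> (k \<otimes>\<^bsub>G\<^esub> s \<otimes>\<^bsub>G\<^esub> inv\<^bsub>G\<^esub> k)) = f ((k \<otimes>\<^bsub>G\<^esub> s \<otimes>\<^bsub>G\<^esub> inv\<^bsub>G\<^esub> k) \<otimes>\<^bsub>G\<^esub> s)"
    using gh(4) by (simp add: commute_conj_def k_def)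
  then have "commute_conj H (f s) (f k)" using s k by (simp add: commute_conj_def)
  then show "\<exists>g\<in>J. \<exists>h\<in>J. g \<noteq> h \<and> commute_conj H (f s) (inv\<^bsub>H\<^esub> g \<otimes>\<^bsub>H\<^esub> h)"
    using gh k by (intro bexI[of _ g] bexI[of _ h]) auto
qed

lemma cartan_recurrent:
  assumes G: "group G" and tf: "torsion_free G" and nt: "carrier G \<noteq> {\<one>\<^bsub>G\<^esub>}"
    and N: "cartan_subalgebra (carrier G) (group_vna G) N"
      "left_reg G ` carrier G \<subseteq> normalizer_ops (carrier G) (group_vna G) N"
  shows "\<exists>s\<in>carrier G. s \<noteq> \<one>\<^bsub>G\<^esub> \<and> (\<exists>n. conj_recurrent G s n)"
proof -
  interpret group G by (rule G)
  interpret invariant_masa G N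
    by unfold_locales (use N in \<open>auto simp: cartan_subalgebra_def\<close>)
  show ?thesis by (rule invariant_masa_recurrent[OF tf nt])
qed

text \<open>The common ground of the two kinds of factors; from here on they are treated
  alike.\<close>

lemma factor_properties:
  assumes G: "group G"
    and cls: "(torsion_free G \<and> \<not> amenable G \<and> hyperbolic_group G) \<or> positive_betti_class G"
  shows "torsion_free G" "carrier G \<noteq> {\<one>\<^bsub>G\<^esub>}"
    "\<And>s n. s \<in> carrier G \<Longrightarrow> s \<noteq> \<one>\<^bsub>G\<^esub> \<Longrightarrow> \<not> conj_recurrent G s n"
  using cls trivial_amenable[OF G] hyperbolic_recurrent_amenable[OF G]
    group.betti_nontrivial[OF G] group.betti_not_recurrent[OF G]
  by (auto simp: positive_betti_class_def)

theorem corollary4p4: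
  fixes \<Gamma> :: "('a, 'm) monoid_scheme"
    and n :: nat
    and \<Gamma>s :: "nat \<Rightarrow> ('b, 'k) monoid_scheme"
  assumes "group \<Gamma>" and "countable (carrier \<Gamma>)"
    and "positive_betti_class \<Gamma> \<or>
      (n \<ge> 2 \<and> \<Gamma> \<cong> product_group {1..n} \<Gamma>s \<and>
       (\<forall>i\<in>{1..n}. group (\<Gamma>s i) \<and>
          ((torsion_free (\<Gamma>s i) \<and> \<not> amenable (\<Gamma>s i) \<and> hyperbolic_group (\<Gamma>s i)) \<or>
           positive_betti_class (\<Gamma>s i))))"
  shows "\<not> (\<exists>\<A>. cartan_subalgebra (carrier \<Gamma>) (group_vna \<Gamma>) \<A> \<and>
      left_reg \<Gamma> ` carrier \<Gamma> \<subseteq> normalizer_ops (carrier \<Gamma>) (group_vna \<Gamma>) \<A>)"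
proof
  assume "\<exists>\<A>. cartan_subalgebra (carrier \<Gamma>) (group_vna \<Gamma>) \<A> \<and>
      left_reg \<Gamma> ` carrier \<Gamma> \<subseteq> normalizer_ops (carrier \<Gamma>) (group_vna \<Gamma>) \<A>"
  then obtain \<A> where \<A>: "cartan_subalgebra (carrier \<Gamma>) (group_vna \<Gamma>) \<A>"
    "left_reg \<Gamma> ` carrier \<Gamma> \<subseteq> normalizer_ops (carrier \<Gamma>) (group_vna \<Gamma>) \<A>" by blast
  show False
  proof (cases "positive_betti_class \<Gamma>")
    case True
    note fp = factor_properties[OF assms(1) disjI2[OF True]]
    show False using cartan_recurrent[OF assms(1) fp(1,2) \<A>] fp(3) by blast
  next
    case False
    let ?I = "{1..n}" and ?P = "product_group {1..n} \<Gamma>s"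
    have n: "n \<ge> 2" and iso: "\<Gamma> \<cong> ?P"
      and fac: "\<And>i. i \<in> ?I \<Longrightarrow> group (\<Gamma>s i) \<and>
          ((torsion_free (\<Gamma>s i) \<and> \<not> amenable (\<Gamma>s i) \<and> hyperbolic_group (\<Gamma>s i)) \<or>
           positive_betti_class (\<Gamma>s i))"
      using assms(3) False by blast+
    have grp: "group (\<Gamma>s i)" if "i \<in> ?I" for i using fac[OF that] by blast
    note fp = factor_properties[OF grp conjunct2[OF fac]]
    interpret G: group \<Gamma> by fact
    have P: "group ?P" by (rule product_group) (rule grp)
    interpret P: group ?P by (rule P)
    obtain f where f: "f \<in> iso \<Gamma> ?P" using iso by (auto simp: is_iso_def)
    have fh: "f \<in> hom \<Gamma> ?P" and fb: "bij_betw f (carrier \<Gamma>) (carrier ?P)"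
      using f by (auto simp: iso_def)
    interpret f: group_hom \<Gamma> ?P f by unfold_locales (rule fh)
    have proj: "(\<lambda>x. f x i) \<in> hom \<Gamma> (\<Gamma>s i)" if i: "i \<in> ?I" for i
    proof (rule homI)
      fix x assume "x \<in> carrier \<Gamma>"
      then show "f x i \<in> carrier (\<Gamma>s i)" using f.hom_closed[of x] i by (auto simp: PiE_iff)
    next
      fix x y assume "x \<in> carrier \<Gamma>" "y \<in> carrier \<Gamma>"
      then show "f (x \<otimes>\<^bsub>\<Gamma>\<^esub> y) i = f x i \<otimes>\<^bsub>\<Gamma>s i\<^esub> f y i" using i by (simp add: f.hom_mult)
    qed
    have eq1: "x = \<one>\<^bsub>\<Gamma>\<^esub>" if x: "x \<in> carrier \<Gamma>" and "\<And>i. i \<in> ?I \<Longrightarrow> f x i = \<one>\<^bsub>\<Gamma>s i\<^esub>" for x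
    proof -
      have "f x = \<one>\<^bsub>?P\<^esub>"
        using f.hom_closed[OF x] that(2) by (intro extensionalityI[of _ ?I]) (auto simp: PiE_iff)
      then have "f x = f \<one>\<^bsub>\<Gamma>\<^esub>" by (simp only: f.hom_one)
      then show ?thesis by (rule inj_onD[OF bij_betw_imp_inj_on[OF fb] _ x G.one_closed])
    qed
    have tf: "torsion_free \<Gamma>"
      unfolding torsion_free_def
    proof (intro ballI allI impI)
      fix x and m :: nat assume x: "x \<in> carrier \<Gamma>" and m: "m > 0 \<and> x [^]\<^bsub>\<Gamma>\<^esub> m = \<one>\<^bsub>\<Gamma>\<^esub>"
      show "x = \<one>\<^bsub>\<Gamma>\<^esub>"
      proof (rule eq1[OF x])
        fix i assume i: "i \<in> ?I"
        interpret g: group_hom \<Gamma> "\<Gamma>s i" "\<lambda>x. f x i"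
          unfolding group_hom_def group_hom_axioms_def using assms(1) grp[OF i] proj[OF i] by blast
        have "f x i [^]\<^bsub>\<Gamma>s i\<^esub> m = \<one>\<^bsub>\<Gamma>s i\<^esub>"
          using g.hom_nat_pow[OF x, of m] m g.hom_one by simp
        then show "f x i = \<one>\<^bsub>\<Gamma>s i\<^esub>"
          using fp(1)[OF i i] m g.hom_closed[OF x] unfolding torsion_free_def by blast
      qed
    qed
    \<comment> \<open>The preimage of the tuple with \<open>g\<close> in place \<open>i\<close> and
      identities elsewhere: a section of the \<open>i\<close>-th projection, as
      \<open>conj_recurrent_image\<close> requires.\<close>
    define \<iota> where "\<iota> i g = inv_into (carrier \<Gamma>) f (\<lambda>j\<in>?I. if j = i then g else \<one>\<^bsub>\<Gamma>s j\<^esub>)" for i g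
    have \<iota>: "\<iota> i g \<in> carrier \<Gamma> \<and> f (\<iota> i g) i = g" if i: "i \<in> ?I" and g: "g \<in> carrier (\<Gamma>s i)" for i g
    proof -
      define u where "u = (\<lambda>j\<in>?I. if j = i then g else \<one>\<^bsub>\<Gamma>s j\<^esub>)"
      have "u \<in> carrier ?P" using g grp group.is_monoid monoid.one_closed by (force simp: u_def PiE_iff)
      then have "u \<in> f ` carrier \<Gamma>" using fb by (simp add: bij_betw_def)
      then have "inv_into (carrier \<Gamma>) f u \<in> carrier \<Gamma>" "f (inv_into (carrier \<Gamma>) f u) = u"
        by (auto intro: inv_into_into f_inv_into_f)
      moreover have "u i = g" using i by (simp add: u_def)
      ultimately show ?thesis unfolding \<iota>_def u_def[symmetric] by simp
    qed
    have nt: "carrier \<Gamma> \<noteq> {\<one>\<^bsub>\<Gamma>\<^esub>}"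
    proof
      assume triv: "carrier \<Gamma> = {\<one>\<^bsub>\<Gamma>\<^esub>}"
      have 1: "1 \<in> ?I" using n by simp
      have "g = \<one>\<^bsub>\<Gamma>s 1\<^esub>" if g: "g \<in> carrier (\<Gamma>s 1)" for g
      proof -
        have "\<iota> 1 g = \<one>\<^bsub>\<Gamma>\<^esub>" "f (\<iota> 1 g) 1 = g" using \<iota>[OF 1 g] triv by auto
        then show ?thesis using 1 by simp
      qed
      then have "carrier (\<Gamma>s 1) = {\<one>\<^bsub>\<Gamma>s 1\<^esub>}"
        using grp[OF 1] group.is_monoid monoid.one_closed by blast
      then show False using fp(2)[OF 1 1] by simp
    qed
    obtain s m where s: "s \<in> carrier \<Gamma>" "s \<noteq> \<one>\<^bsub>\<Gamma>\<^esub>" and rec: "conj_recurrent \<Gamma> s m"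
      using cartan_recurrent[OF assms(1) tf nt \<A>] by blast
    \<comment> \<open>Some coordinate of \<open>s\<close> is nontrivial, and recurrence descends to
      that factor, which admits no nontrivial recurrent element.\<close>
    obtain i where i: "i \<in> ?I" "f s i \<noteq> \<one>\<^bsub>\<Gamma>s i\<^esub>" using eq1[OF s(1)] s(2) by blast
    have "conj_recurrent (\<Gamma>s i) (f s i) m"
      by (rule conj_recurrent_image[OF assms(1) grp[OF i(1)] proj[OF i(1)] \<iota>[OF i(1)] s(1) rec])
    moreover have "f s i \<in> carrier (\<Gamma>s i)" using hom_in_carrier[OF proj[OF i(1)] s(1)] .
    ultimately show False using fp(3)[OF i(1) i(1)] i(2) by blast
  qed
qed

end
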